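(* Every forcing set of permutations (whose elements may have arbitrary, possibly different, orders) has at least four elements.
   Context: For $k\in\mathbb{N}$, a $k$-permutation (permutation of order $k$) is a bijection of $[k]=\{1,\dots,k\}$; the order of $\pi$ is denoted $|\pi|$. For an $n$-permutation $\Pi$ and a $k$-permutation $\pi$, the density $d(\pi,\Pi)$ is the probability that a uniformly random $k$-element subset $\{a_1<\dots<a_k\}\subseteq[n]$ satisfies: for all $i,j\in[k]$, $\pi(i)<\pi(j)$ if and only if $\Pi(a_i)<\Pi(a_j)$; if $k>n$ we set $d(\pi,\Pi)=0$. A sequence $(\Pi_i)_{i\in\mathbb{N}}$ of permutations is quasirandom if for every permutation $\pi$ the limit $\lim_{i\to\infty} d(\pi,\Pi_i)$ exists and equals $1/|\pi|!$. A set $S$ of permutations is forcing if every sequence $(\Pi_i)_{i\in\mathbb{N}}$ of permutations with $\lim_{i\to\infty}d(\pi,\Pi_i)=1/|\pi|!$ for all $\pi\in S$ is quasirandom. *)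

theory Defs
  imports Complex_Main
begin

text \<open>A k-permutation \<pi> of [k] is represented by the list [\<pi>(1), ..., \<pi>(k)]
  (so \<pi>(i) = \<pi> ! (i - 1)); its order is the length of the list.
  Orders are positive natural numbers.\<close>

definition is_perm :: "nat list \<Rightarrow> bool" where
  "is_perm \<pi> \<longleftrightarrow> length \<pi> \<ge> 1 \<and> distinct \<pi> \<and> set \<pi> = {1..length \<pi>}"

definition induces :: "nat list \<Rightarrow> nat list \<Rightarrow> nat set \<Rightarrow> bool" where
  "induces \<pi> \<Pi> A \<longleftrightarrow>
     (let as = sorted_list_of_set A in
       \<forall>i < length \<pi>. \<forall>j < length \<pi>. (\<pi> ! i < \<pi> ! j \<longleftrightarrow> \<Pi> ! (as ! i) < \<Pi> ! (as ! j)))"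

definition density :: "nat list \<Rightarrow> nat list \<Rightarrow> real" where
  "density \<pi> \<Pi> =
     (if length \<pi> > length \<Pi> then 0
      else real (card {A. A \<subseteq> {0..<length \<Pi>} \<and> card A = length \<pi> \<and> induces \<pi> \<Pi> A})
           / real (length \<Pi> choose length \<pi>))"

definition quasirandom :: "(nat \<Rightarrow> nat list) \<Rightarrow> bool" where
  "quasirandom \<Pi>s \<longleftrightarrow>
     (\<forall>\<pi>. is_perm \<pi> \<longrightarrow> (\<lambda>i. density \<pi> (\<Pi>s i)) \<longlonglongrightarrow> 1 / fact (length \<pi>))"

definition forcing :: "nat list set \<Rightarrow> bool" where
  "forcing S \<longleftrightarrow>
     (\<forall>\<Pi>s. (\<forall>i. is_perm (\<Pi>s i)) \<longrightarrow>
        (\<forall>\<pi>\<in>S. (\<lambda>i. density \<pi> (\<Pi>s i)) \<longlonglongrightarrow> 1 / fact (length \<pi>)) \<longrightarrow>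
        quasirandom \<Pi>s)"

end

theory Submission
  imports "HOL-Analysis.Analysis" "HOL-Computational_Algebra.Polynomial" Defs
begin

text \<open>
  If all orders are at most 3, the constant sequence at a permutation of order 9 in which every
  pattern of order at most 3 has exactly the right density is a counterexample; it is not
  quasirandom because patterns of order 10 have density 0.

  Otherwise perturb the uniform measure on the unit square: moving mass to \<open>[0,x] \<times> [0,y]\<close> changes
  the density of \<open>\<pi>\<close> (of order \<open>k\<close>) to first order by a multiple of
  \<open>\<Sum>l. q\<^sub>l(x) q\<^bsub>\<pi>(l)\<^esub>(y) - k x y\<close>, where \<open>q\<^sub>l(x)\<close> is the probability that the \<open>l\<close>-th smallest
  of \<open>k\<close> uniform points is below \<open>x\<close>. These polynomials are linearly independent for three given
  permutations (apart from the small exceptional cases) together with a fourth one of larger order. Hence by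
  Brouwer's theorem the first three densities can be kept while the fourth one is changed.
\<close>

section \<open>Occurrences of patterns in point sets\<close>

text \<open>The first-order terms explain the number three. In the basis of products of the
  \<open>btail\<close> polynomials, the term of \<pi> is its permutation matrix minus the constant
  matrix 1/k. Four such matrices can be dependent: the terms of the rows of a Latin square of order
  4 add up to 0. In the same way the three cyclic shifts of [1,2,3] are dependent, and [1,2] and
  [2,1] have opposite terms. These are the exceptional cases behind the explicit example and the
  reduction of orders 1 and 2. No limit objects are used. A perturbed measure is a weight on the
  cells of an M by M grid, the weight becomes a point set with about M times the weight many points
  in each cell, and the point set becomes a permutation. The prescribed densities are hit exactly by
  a weight for every large M, although the map to be inverted varies with M. Brouwer's theorem suits
  this, since it asks only for estimates uniform in M and for surjectivity of the limiting linear
  part; the latter is linear independence in dual form.\<close>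

definition is_occ :: "nat list \<Rightarrow> ('a \<Rightarrow> nat) \<Rightarrow> ('a \<Rightarrow> nat) \<Rightarrow> (nat \<Rightarrow> 'a) \<Rightarrow> bool" where
  "is_occ \<pi> X Y q \<longleftrightarrow> (\<forall>i<length \<pi>. \<forall>j<length \<pi>.
     (i < j \<longrightarrow> X (q i) < X (q j)) \<and> (\<pi> ! i < \<pi> ! j \<longrightarrow> Y (q i) < Y (q j)))"

text \<open>An occurrence is a tuple of points in order of position. The coordinates may have ties,
  so the same notion serves for points in general position and for cells of a grid; strictness
  discards tuples with two points in one row or column.\<close>

definition occs :: "nat list \<Rightarrow> 'a set \<Rightarrow> ('a \<Rightarrow> nat) \<Rightarrow> ('a \<Rightarrow> nat) \<Rightarrow> (nat \<Rightarrow> 'a) set" where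
  "occs \<pi> P X Y = {q \<in> {..<length \<pi>} \<rightarrow>\<^sub>E P. is_occ \<pi> X Y q}"

lemma finite_occs [simp]: "finite P \<Longrightarrow> finite (occs \<pi> P X Y)"
  unfolding occs_def by (simp add: finite_PiE)

lemma is_occ_iff:
  assumes "is_perm \<pi>" "is_occ \<pi> X Y q" "i < length \<pi>" "j < length \<pi>"
  shows "Y (q i) < Y (q j) \<longleftrightarrow> \<pi> ! i < \<pi> ! j"
proof -
  have "\<pi> ! i \<noteq> \<pi> ! j" if "i \<noteq> j"
    using assms that by (simp add: is_perm_def nth_eq_iff_index_eq)
  with assms show ?thesis unfolding is_occ_def
    by (metis less_irrefl linorder_neqE_nat order_less_asym)
qed

text \<open>A set of indices corresponds to its increasing enumeration, which is the tuple that
  \<open>induces\<close> inspects.\<close>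

lemma card_induces_eq_card_occs:
  assumes "is_perm \<pi>"
  shows "card {A. A \<subseteq> {0..<length \<sigma>} \<and> card A = length \<pi> \<and> induces \<pi> \<sigma> A}
       = card (occs \<pi> {..<length \<sigma>} (\<lambda>i. i) (\<lambda>i. \<sigma> ! i))" (is "card ?L = card ?R")
proof -
  let ?k = "length \<pi>" and ?n = "length \<sigma>"
  let ?f = "\<lambda>A. restrict (\<lambda>i. sorted_list_of_set A ! i) {..<?k}"
  have "bij_betw ?f ?L ?R"
  proof (rule bij_betw_byWitness[where f' = "\<lambda>q. q ` {..<?k}"])
    have im: "(\<lambda>i. sorted_list_of_set A ! i) ` {..<?k} = A" if "A \<in> ?L" for A
    proof -
      have "finite A" using that finite_subset by blast
      then have "A = set (sorted_list_of_set A)" "length (sorted_list_of_set A) = ?k"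
        using that by auto
      then show ?thesis using nth_image[of ?k "sorted_list_of_set A"]
        by (simp add: lessThan_atLeast0)
    qed
    then show "\<forall>A\<in>?L. ?f A ` {..<?k} = A" by simp
    have sl: "sorted_list_of_set (q ` {..<?k}) = map q [0..<?k]" if "q \<in> ?R" for q
    proof -
      have "sorted_wrt (<) (map q [0..<?k])"
        using that by (auto simp: sorted_wrt_iff_nth_less occs_def is_occ_def)
      then have "sorted_list_of_set (set (map q [0..<?k])) = map q [0..<?k]"
        unfolding strict_sorted_iff by (intro sorted_list_of_set.idem_if_sorted_distinct) auto
      then show ?thesis by (simp add: lessThan_atLeast0)
    qed
    show "\<forall>q\<in>?R. ?f (q ` {..<?k}) = q"
      by (auto simp: sl occs_def PiE_def extensional_def restrict_def intro!: ext)
    show "?f ` ?L \<subseteq> ?R"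
    proof (rule image_subsetI)
      fix A assume A: "A \<in> ?L"
      then have fin: "finite A" using finite_subset by blast
      have "sorted_wrt (<) (sorted_list_of_set A)" by simp
      then have "sorted_list_of_set A ! i < sorted_list_of_set A ! j" if "i < j" "j < ?k" for i j
        using that A by (intro sorted_wrt_nth_less) auto
      moreover have "sorted_list_of_set A ! i \<in> {..<?n}" if "i < ?k" for i
      proof -
        have "sorted_list_of_set A ! i \<in> A" using im[OF A] that by blast
        then show ?thesis using A by auto
      qed
      ultimately show "?f A \<in> ?R"
        using A by (auto simp: occs_def is_occ_def induces_def Let_def)
    qed
    show "(\<lambda>q. q ` {..<?k}) ` ?R \<subseteq> ?L"
    proof (rule image_subsetI)
      fix q assume q: "q \<in> ?R"
      have "strict_mono_on {..<?k} q" using q by (auto simp: occs_def is_occ_def strict_mono_on_def)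
      then have "card (q ` {..<?k}) = ?k"
        by (simp add: card_image strict_mono_on_imp_inj_on)
      moreover have "q ` {..<?k} \<subseteq> {0..<?n}" using q unfolding occs_def by (auto dest!: PiE_mem)
      moreover have occ: "is_occ \<pi> (\<lambda>i. i) (\<lambda>i. \<sigma> ! i) q" using q by (simp add: occs_def)
      have "induces \<pi> \<sigma> (q ` {..<?k})"
        by (simp add: induces_def sl[OF q] is_occ_iff[OF assms occ])
      ultimately show "q ` {..<?k} \<in> ?L" by blast
    qed
  qed
  then show ?thesis by (rule bij_betw_same_card)
qed

text \<open>Only the relative order of the coordinates matters: sort the points by X and read off
  the ranks of their Y coordinates.\<close>

lemma ex_perm_of_point_set:
  assumes P: "finite P" "P \<noteq> {}" and X: "inj_on X P" and Y: "inj_on Y P"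
  obtains \<sigma> where "is_perm \<sigma>" "length \<sigma> = card P"
    "\<And>\<pi>. card (occs \<pi> {..<length \<sigma>} (\<lambda>i. i) (\<lambda>i. \<sigma> ! i)) = card (occs \<pi> P X Y)"
proof -
  let ?n = "card P"
  obtain h where h: "bij_betw h {..<?n} (X ` P)" "strict_mono_on {..<?n} h"
    using ex_bij_betw_strict_mono_card[of "X ` P"] P(1) card_image[OF X] by auto
  define e where "e i = inv_into P X (h i)" for i
  have e: "bij_betw e {..<?n} P"
    using bij_betw_trans[OF h(1) bij_betw_inv_into[of X P "X ` P"]] X
    by (simp add: e_def[abs_def] comp_def bij_betw_def)
  have Xe: "X (e i) = h i" if "i < ?n" for i
  proof -
    have "h i \<in> X ` P" using h(1) that by (auto simp: bij_betw_def)
    then show ?thesis by (simp add: e_def f_inv_into_f)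
  qed
  have Xe_less: "X (e i) < X (e j) \<longleftrightarrow> i < j" if "i < ?n" "j < ?n" for i j
    using that h(2) by (simp add: Xe strict_mono_on_less)
  \<comment> \<open>Counting with \<open>\<le>\<close> lets the ranks start at 1, as
    \<open>is_perm\<close> demands.\<close>
  define rk where "rk p = card {p'\<in>P. Y p' \<le> Y p}" for p
  have rk_less: "rk p < rk p' \<longleftrightarrow> Y p < Y p'" if "p \<in> P" "p' \<in> P" for p p'
  proof
    assume "Y p < Y p'"
    then have "{a\<in>P. Y a \<le> Y p} \<subseteq> {a\<in>P. Y a \<le> Y p'}"
      "p' \<notin> {a\<in>P. Y a \<le> Y p}" "p' \<in> {a\<in>P. Y a \<le> Y p'}" using that by auto
    then have "{a\<in>P. Y a \<le> Y p} \<subset> {a\<in>P. Y a \<le> Y p'}" by blast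
    then show "rk p < rk p'" unfolding rk_def using P by (intro psubset_card_mono) auto
  next
    assume "rk p < rk p'"
    moreover have "rk p' \<le> rk p" if "Y p' \<le> Y p"
      unfolding rk_def using P that by (intro card_mono) auto
    ultimately show "Y p < Y p'" by linarith
  qed
  have rk_inj: "inj_on rk P"
    using rk_less Y by (intro inj_onI) (metis inj_onD less_irrefl linorder_neqE_nat)
  define \<sigma> where "\<sigma> = map (\<lambda>i. rk (e i)) [0..<?n]"
  have len: "length \<sigma> = ?n" by (simp add: \<sigma>_def)
  have inj: "inj_on (\<lambda>i. rk (e i)) {..<?n}"
    using comp_inj_on[of e "{..<?n}" rk] e rk_inj by (simp add: bij_betw_def comp_def)
  have set: "set \<sigma> = rk ` P" 
    using e by (simp add: \<sigma>_def bij_betw_def lessThan_atLeast0 flip: image_image[of rk e])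
  have "rk ` P \<subseteq> {1..?n}"
  proof (rule image_subsetI)
    fix p assume p: "p \<in> P"
    have "rk p \<le> ?n" unfolding rk_def using P by (intro card_mono) auto
    moreover have "rk p \<noteq> 0" unfolding rk_def using P p by auto
    ultimately show "rk p \<in> {1..?n}" by simp
  qed
  then have "rk ` P = {1..?n}"
    using rk_inj by (intro card_subset_eq) (auto simp: card_image)
  moreover have "distinct \<sigma>" using inj by (simp add: \<sigma>_def distinct_map lessThan_atLeast0)
  moreover have "?n \<ge> 1" using P by (simp add: Suc_le_eq card_gt_0_iff)
  ultimately have perm: "is_perm \<sigma>" using set len by (simp add: is_perm_def)
  have "card (occs \<pi> {..<length \<sigma>} (\<lambda>i. i) (\<lambda>i. \<sigma> ! i)) = card (occs \<pi> P X Y)" for \<pi>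
  proof -
    let ?k = "length \<pi>"
    let ?F = "\<lambda>a. restrict (\<lambda>i. e (a i)) {..<?k}"
    let ?G = "\<lambda>q. restrict (\<lambda>i. inv_into {..<?n} e (q i)) {..<?k}"
    have ie: "inv_into {..<?n} e (e i) = i" if "i < ?n" for i
      using e that by (simp add: bij_betw_def)
    have ei: "e (inv_into {..<?n} e p) = p" "inv_into {..<?n} e p < ?n" if "p \<in> P" for p
      using e that inv_into_into[of p e "{..<?n}"] by (auto simp: bij_betw_def f_inv_into_f)
    have eP: "e i \<in> P" if "i < ?n" for i using e that by (auto simp: bij_betw_def)
    have occ: "is_occ \<pi> (\<lambda>i. i) (\<lambda>i. \<sigma> ! i) a \<longleftrightarrow> is_occ \<pi> X Y (?F a)" if "\<And>i. i < ?k \<Longrightarrow> a i < ?n" for a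
      using that Xe_less rk_less eP by (simp add: is_occ_def \<sigma>_def)
    have "bij_betw ?F (occs \<pi> {..<length \<sigma>} (\<lambda>i. i) (\<lambda>i. \<sigma> ! i)) (occs \<pi> P X Y)"
    proof (rule bij_betw_byWitness[where f' = ?G])
      show "\<forall>a\<in>occs \<pi> {..<length \<sigma>} (\<lambda>i. i) (\<lambda>i. \<sigma> ! i). ?G (?F a) = a"
        by (auto simp: len occs_def ie PiE_iff extensional_def intro!: ext)
      show "\<forall>q\<in>occs \<pi> P X Y. ?F (?G q) = q"
        by (auto simp: len occs_def ei PiE_iff extensional_def intro!: ext)
      show "?F ` occs \<pi> {..<length \<sigma>} (\<lambda>i. i) (\<lambda>i. \<sigma> ! i) \<subseteq> occs \<pi> P X Y"
      proof (rule image_subsetI)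
        fix a assume "a \<in> occs \<pi> {..<length \<sigma>} (\<lambda>i. i) (\<lambda>i. \<sigma> ! i)"
        then have "\<And>i. i < ?k \<Longrightarrow> a i < ?n" "is_occ \<pi> (\<lambda>i. i) (\<lambda>i. \<sigma> ! i) a"
          by (auto simp: occs_def len)
        then show "?F a \<in> occs \<pi> P X Y" using occ eP by (auto simp: occs_def)
      qed
      show "?G ` occs \<pi> P X Y \<subseteq> occs \<pi> {..<length \<sigma>} (\<lambda>i. i) (\<lambda>i. \<sigma> ! i)"
      proof (rule image_subsetI)
        fix q assume q: "q \<in> occs \<pi> P X Y"
        then have lt: "\<And>i. i < ?k \<Longrightarrow> ?G q i < ?n" using ei by (auto simp: occs_def)
        have "?F (?G q) = q"
          using q by (auto simp: len occs_def ei PiE_iff extensional_def intro!: ext)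
        then have "is_occ \<pi> (\<lambda>i. i) (\<lambda>i. \<sigma> ! i) (?G q)"
          using occ[of "?G q", OF lt] q by (simp add: occs_def)
        then show "?G q \<in> occs \<pi> {..<length \<sigma>} (\<lambda>i. i) (\<lambda>i. \<sigma> ! i)"
          using lt by (auto simp: occs_def len)
      qed
    qed
    then show ?thesis by (rule bij_betw_same_card)
  qed
  with perm len that show thesis by blast
qed

section \<open>Effect of ties between coordinates\<close>

text \<open>Choose all points except the one with index l' freely; the tie then leaves at most R
  choices for it.\<close>

lemma card_collisions_le:
  assumes P: "finite P" and R: "\<And>a. card {p\<in>P. u p = a} \<le> R" and l: "l < k" "l' < k" "l \<noteq> l'"
  shows "card {q \<in> {..<k} \<rightarrow>\<^sub>E P. u (q l) = u (q l')} \<le> R * card P ^ (k - 1)"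
proof -
  let ?I = "{..<k} - {l'}"
  let ?D = "SIGMA r:?I \<rightarrow>\<^sub>E P. {p\<in>P. u p = u (r l)}"
  have sub: "{q \<in> {..<k} \<rightarrow>\<^sub>E P. u (q l) = u (q l')} \<subseteq> (\<lambda>(r, y). r(l' := y)) ` ?D"
  proof
    fix q assume q: "q \<in> {q \<in> {..<k} \<rightarrow>\<^sub>E P. u (q l) = u (q l')}"
    have qP: "q \<in> {..<k} \<rightarrow>\<^sub>E P" using q by simp
    have "(restrict q ?I)(l' := q l') = q"
    proof
      fix x show "((restrict q ?I)(l' := q l')) x = q x"
        using PiE_arb[OF qP, of x] by simp
    qed
    moreover have "(restrict q ?I, q l') \<in> ?D"
      using q l PiE_mem[OF qP] by auto
    ultimately show "q \<in> (\<lambda>(r, y). r(l' := y)) ` ?D"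
      by (intro image_eqI[where x = "(restrict q ?I, q l')"]) simp_all
  qed
  have fin: "finite (?I \<rightarrow>\<^sub>E P)" using P by (simp add: finite_PiE)
  have "card {q \<in> {..<k} \<rightarrow>\<^sub>E P. u (q l) = u (q l')} \<le> card ?D"
    using fin P by (intro surj_card_le[OF _ sub] finite_SigmaI) simp_all
  also have "\<dots> = (\<Sum>r\<in>?I \<rightarrow>\<^sub>E P. card {p\<in>P. u p = u (r l)})"
    using fin P by (intro card_SigmaI) simp_all
  also have "\<dots> \<le> (\<Sum>r\<in>?I \<rightarrow>\<^sub>E P. R)" by (rule sum_mono) (rule R)
  also have "\<dots> = R * card P ^ (k - 1)"
    using l by (simp add: card_PiE)
  finally show ?thesis .
qed

text \<open>X and Y refine u and v. A tuple can be an occurrence for the finer coordinates only if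
  two of its points tie in u or in v, and there are at most \<open>length \<pi> ^ 2\<close> pairs of
  indices for each.\<close>

lemma occs_coarsening_le:
  assumes "is_perm \<pi>" and P: "finite P"
    and R: "\<And>a. card {p\<in>P. u p = a} \<le> R" "\<And>a. card {p\<in>P. v p = a} \<le> R"
    and XY: "\<And>p p'. p \<in> P \<Longrightarrow> p' \<in> P \<Longrightarrow> u p < u p' \<Longrightarrow> X p < X p'"
      "\<And>p p'. p \<in> P \<Longrightarrow> p' \<in> P \<Longrightarrow> v p < v p' \<Longrightarrow> Y p < Y p'"
  shows "card (occs \<pi> P u v) \<le> card (occs \<pi> P X Y)"
    and "card (occs \<pi> P X Y) \<le> card (occs \<pi> P u v) + 2 * length \<pi> ^ 2 * R * card P ^ (length \<pi> - 1)"
proof -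
  let ?k = "length \<pi>"
  have sub: "occs \<pi> P u v \<subseteq> occs \<pi> P X Y"
  proof
    fix q assume q: "q \<in> occs \<pi> P u v"
    then have "q i \<in> P" if "i < ?k" for i using that unfolding occs_def by (auto dest!: PiE_mem)
    with q XY show "q \<in> occs \<pi> P X Y" unfolding occs_def is_occ_def by blast
  qed
  then show "card (occs \<pi> P u v) \<le> card (occs \<pi> P X Y)" using P by (intro card_mono) auto
  define I where "I = {(l, l'). l < ?k \<and> l' < ?k \<and> l \<noteq> l'}"
  define C where "C w l l' = {q \<in> {..<?k} \<rightarrow>\<^sub>E P. w (q l) = (w (q l') :: nat)}" for w l l'
  have I: "finite I" "card I \<le> ?k ^ 2"
  proof -
    have "I \<subseteq> {..<?k} \<times> {..<?k}" by (auto simp: I_def)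
    then show "finite I" "card I \<le> ?k ^ 2"
      using finite_subset card_mono[of "{..<?k} \<times> {..<?k}" I] by (auto simp: power2_eq_square)
  qed
  have sub2: "occs \<pi> P X Y \<subseteq> occs \<pi> P u v \<union> (\<Union>(l,l')\<in>I. C u l l' \<union> C v l l')"
  proof
    fix q assume q: "q \<in> occs \<pi> P X Y"
    show "q \<in> occs \<pi> P u v \<union> (\<Union>(l,l')\<in>I. C u l l' \<union> C v l l')"
    proof (rule ccontr)
      assume *: "\<not> ?thesis"
      have qP: "q \<in> {..<?k} \<rightarrow>\<^sub>E P" "\<And>i. i < ?k \<Longrightarrow> q i \<in> P"
        using q unfolding occs_def by (auto dest!: PiE_mem)
      have ne: "u (q l) \<noteq> u (q l')" "v (q l) \<noteq> v (q l')" if "l < ?k" "l' < ?k" "l \<noteq> l'" for l l'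
      proof -
        have "(l, l') \<in> I" using that by (simp add: I_def)
        then have "q \<notin> C u l l' \<union> C v l l'" using * by blast
        then show "u (q l) \<noteq> u (q l')" "v (q l) \<noteq> v (q l')" using qP(1) by (simp_all add: C_def)
      qed
      have "is_occ \<pi> u v q"
        unfolding is_occ_def
      proof (intro allI impI conjI)
        fix i j assume ij: "i < ?k" "j < ?k"
        { assume "i < j"
          then have "X (q i) < X (q j)" using q ij by (auto simp: occs_def is_occ_def)
          then have "\<not> u (q j) < u (q i)" using XY(1)[of "q j" "q i"] qP(2) ij by auto
          with ne(1)[of i j] ij \<open>i < j\<close> show "u (q i) < u (q j)" by auto }
        { assume "\<pi> ! i < \<pi> ! j"
          then have "Y (q i) < Y (q j)" using q ij by (auto simp: occs_def is_occ_def)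
          then have "\<not> v (q j) < v (q i)" using XY(2)[of "q j" "q i"] qP(2) ij by auto
          moreover have "i \<noteq> j" using \<open>\<pi> ! i < \<pi> ! j\<close> by auto
          ultimately show "v (q i) < v (q j)" using ne(2)[of i j] ij by auto }
      qed
      then have "q \<in> occs \<pi> P u v" using qP(1) by (simp add: occs_def)
      with * show False by blast
    qed
  qed
  have finC: "finite (C w l l')" for w l l' using P by (simp add: C_def finite_PiE)
  have "card (occs \<pi> P X Y) \<le> card (occs \<pi> P u v) + card (\<Union>(l,l')\<in>I. C u l l' \<union> C v l l')"
    using sub2 P finC I(1)
    by (intro order.trans[OF card_mono card_Un_le]) auto
  also have "card (\<Union>(l,l')\<in>I. C u l l' \<union> C v l l') \<le> (\<Sum>(l,l')\<in>I. card (C u l l' \<union> C v l l'))"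
    using card_UN_le[OF I(1), of "\<lambda>(l,l'). C u l l' \<union> C v l l'"] by (simp add: case_prod_unfold)
  also have "\<dots> \<le> (\<Sum>z\<in>I. 2 * (R * card P ^ (?k - 1)))"
  proof (rule sum_mono, clarify)
    fix l l' assume "(l, l') \<in> I"
    then show "card (C u l l' \<union> C v l l') \<le> 2 * (R * card P ^ (?k - 1))"
      using card_collisions_le[OF P R(1), of l ?k l'] card_collisions_le[OF P R(2), of l ?k l']
        card_Un_le[of "C u l l'" "C v l l'"] unfolding I_def C_def by simp
  qed
  also have "\<dots> \<le> ?k ^ 2 * (2 * (R * card P ^ (?k - 1)))"
    using I(2) by simp
  finally show "card (occs \<pi> P X Y) \<le> card (occs \<pi> P u v) + 2 * ?k ^ 2 * R * card P ^ (?k - 1)"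
    by (simp add: algebra_simps)
qed

text \<open>Ties are broken arbitrarily; the error term bounds the influence of the choice on every
  density.\<close>

lemma ex_perm_of_coarse_point_set:
  fixes u v :: "'a \<Rightarrow> nat"
  assumes P: "finite P" "P \<noteq> {}"
    and R: "\<And>a. card {p\<in>P. u p = a} \<le> R" "\<And>a. card {p\<in>P. v p = a} \<le> R"
  obtains \<sigma> where "is_perm \<sigma>" "length \<sigma> = card P"
    "\<And>\<pi>. is_perm \<pi> \<Longrightarrow> length \<pi> \<le> card P \<Longrightarrow>
       \<bar>Defs.density \<pi> \<sigma> - real (card (occs \<pi> P u v)) / real (card P choose length \<pi>)\<bar>
       \<le> 2 * real (length \<pi>) ^ 2 * real R * real (card P) ^ (length \<pi> - 1) / real (card P choose length \<pi>)"
proof -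
  obtain h where h: "bij_betw h P {..<card P}"
    using P(1) bij_betw_iff_card[of P "{..<card P}"] by auto
  \<comment> \<open>Lexicographic order encoded in one number: the coarse coordinate first, then an
    injective label below \<open>card P\<close>.\<close>
  define X where "X p = u p * card P + h p" for p
  define Y where "Y p = v p * card P + h p" for p
  have refine: "w p * card P + h p < w p' * card P + h p'" if "p \<in> P" "p' \<in> P" "w p < w p'" for w p p'
  proof -
    have "h p < card P" using h that by (auto simp: bij_betw_def)
    moreover have "Suc (w p) * card P \<le> w p' * card P" using that by (intro mult_right_mono) auto
    ultimately show ?thesis by simp
  qed
  have inj: "inj_on (\<lambda>p. w p * card P + h p) P" for w
  proof (rule inj_onI)
    fix p p' assume pp: "p \<in> P" "p' \<in> P" and eq: "w p * card P + h p = w p' * card P + h p'"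
    then have "w p = w p'" using refine[of p p' w] refine[of p' p w] by (metis less_irrefl linorder_neqE_nat)
    then have "h p = h p'" using eq by simp
    then show "p = p'" using h pp by (auto simp: bij_betw_def inj_on_def)
  qed
  obtain \<sigma> where \<sigma>: "is_perm \<sigma>" "length \<sigma> = card P"
    "\<And>\<pi>. card (occs \<pi> {..<length \<sigma>} (\<lambda>i. i) (\<lambda>i. \<sigma> ! i)) = card (occs \<pi> P X Y)"
    using ex_perm_of_point_set[OF P inj[of u] inj[of v]] unfolding X_def Y_def by blast
  have "\<bar>Defs.density \<pi> \<sigma> - real (card (occs \<pi> P u v)) / real (card P choose length \<pi>)\<bar>
       \<le> 2 * real (length \<pi>) ^ 2 * real R * real (card P) ^ (length \<pi> - 1) / real (card P choose length \<pi>)"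
    if \<pi>: "is_perm \<pi>" "length \<pi> \<le> card P" for \<pi>
  proof -
    have d: "Defs.density \<pi> \<sigma> = real (card (occs \<pi> P X Y)) / real (card P choose length \<pi>)"
      unfolding Defs.density_def card_induces_eq_card_occs[OF \<pi>(1)] using \<pi> \<sigma> by simp
    have c: "card (occs \<pi> P u v) \<le> card (occs \<pi> P X Y)"
      "card (occs \<pi> P X Y) \<le> card (occs \<pi> P u v) + 2 * length \<pi> ^ 2 * R * card P ^ (length \<pi> - 1)"
      using occs_coarsening_le[OF \<pi>(1) P(1) R, of X Y] refine unfolding X_def Y_def by blast+
    have "\<bar>real (card (occs \<pi> P X Y)) - real (card (occs \<pi> P u v))\<bar>
      \<le> 2 * real (length \<pi>) ^ 2 * real R * real (card P) ^ (length \<pi> - 1)"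
      using c[folded of_nat_le_iff[where 'a = real]] by (simp add: abs_le_iff)
    then show ?thesis unfolding d
      by (simp add: divide_right_mono flip: diff_divide_distrib)
  qed
  with \<sigma> that show thesis by blast
qed

section \<open>First-order perturbations of pattern densities\<close>

text \<open>\<open>btail k l x\<close> is the probability that at least \<open>l + 1\<close> of \<open>k\<close> independent uniform points of \<open>[0,1]\<close>
  are below \<open>x\<close>.\<close>

definition btail :: "nat \<Rightarrow> nat \<Rightarrow> real \<Rightarrow> real" where
  "btail k l x = (\<Sum>r\<in>{l<..k}. Bernstein k r x)"

text \<open>Exchange of summation: the tails collect the partial sums of v as Bernstein
  coefficients. All later identities for \<open>btail\<close> are moments of the binomial
  distribution through this formula.\<close>

lemma sum_btail_weighted:
  "(\<Sum>l<k. v l * btail k l x) = (\<Sum>r\<le>k. (\<Sum>l<r. v l) * Bernstein k r x)"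
proof -
  have "(\<Sum>l<k. v l * btail k l x) = (\<Sum>l<k. \<Sum>r\<in>{l<..k}. v l * Bernstein k r x)"
    by (simp add: btail_def sum_distrib_left)
  also have "\<dots> = (\<Sum>r\<le>k. \<Sum>l<r. v l * Bernstein k r x)"
    by (subst sum.Sigma, simp, simp, subst sum.Sigma, simp, simp,
        rule sum.reindex_bij_witness[of _ "\<lambda>(r, l). (l, r)" "\<lambda>(l, r). (r, l)"]) auto
  finally show ?thesis by (simp add: sum_distrib_right)
qed

lemma sum_btail: "(\<Sum>l<k. btail k l x) = real k * x"
  using sum_btail_weighted[of "\<lambda>_. 1" k x] by (simp add: sum_k_Bernstein)

text \<open>Together with \<open>sum_btail\<close> this gives the coordinates of x - x^2 in the
  basis \<open>btail k l\<close>, which are needed when a permutation of order 2 meets longer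
  ones.\<close>

lemma sum_linear_btail: "(\<Sum>l<k. real l * btail k l x) = real k * (real k - 1) / 2 * x\<^sup>2"
proof -
  have g: "(\<Sum>l<r. real l) = real r * (real r - 1) / 2" for r
    by (induction r) (simp_all add: field_simps)
  have "(\<Sum>l<k. real l * btail k l x) = (\<Sum>r\<le>k. real r * (real r - 1) * Bernstein k r x) / 2"
    unfolding sum_btail_weighted g sum_divide_distrib by (intro sum.cong) auto
  then show ?thesis by (simp only: sum_kk_Bernstein) simp
qed

text \<open>Reflecting the points turns below 1 - x into above x, and at least l + 1 points above x
  means at most k - 1 - l below.\<close>

lemma btail_reflect:
  assumes "l < k" shows "btail k l (1 - x) = 1 - btail k (k - 1 - l) x"
proof -
  have "btail k l (1 - x) = (\<Sum>r\<in>{..k - 1 - l}. Bernstein k r x)"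
    unfolding btail_def using assms
    by (intro sum.reindex_bij_witness[of _ "\<lambda>r. k - r" "\<lambda>r. k - r"])
       (auto simp: Bernstein_def binomial_symmetric[symmetric])
  moreover have "(\<Sum>r\<le>k. Bernstein k r x) = (\<Sum>r\<in>{..k - 1 - l}. Bernstein k r x) + btail k (k - 1 - l) x"
    unfolding btail_def using assms
    by (subst sum.union_disjoint[symmetric]) (auto intro!: sum.cong simp del: sum_Bernstein)
  ultimately show ?thesis by simp
qed

text \<open>The substitution x = t / (1 + t) turns the Bernstein expansion into an ordinary
  polynomial in t up to the factor (1 + t)^k. It vanishes for all t > 0, so all partial sums of v
  vanish, and v is their difference.\<close>

lemma btail_independent:
  assumes "\<And>x. 0 < x \<Longrightarrow> x < 1 \<Longrightarrow> (\<Sum>l<k. v l * btail k l x) = 0" and "l < k"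
  shows "v l = 0"
proof -
  define V where "V r = (\<Sum>l<r. v l)" for r
  define c where "c r = real (k choose r) * V r" for r
  have "(\<Sum>r\<le>k. c r * t ^ r) = 0" if "t > 0" for t
  proof -
    have "(\<Sum>r\<le>k. V r * Bernstein k r (t / (1 + t))) = 0"
      using assms(1)[of "t / (1 + t)"] that sum_btail_weighted[of v k] by (simp add: V_def)
    moreover have "V r * Bernstein k r (t / (1 + t)) = c r * t ^ r / (1 + t) ^ k" if "r \<le> k" for r
    proof -
      have 1: "1 - t / (1 + t) = 1 / (1 + t)" using \<open>t > 0\<close> by (simp add: field_simps)
      have "(1 + t) ^ k = (1 + t) ^ r * (1 + t) ^ (k - r)" using that by (simp flip: power_add)
      then show ?thesis using \<open>t > 0\<close> by (simp add: Bernstein_def 1 c_def power_divide)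
    qed
    ultimately have "(\<Sum>r\<le>k. c r * t ^ r / (1 + t) ^ k) = 0" by simp
    then show ?thesis using that by (simp flip: sum_divide_distrib)
  qed
  then have "{0<..} \<subseteq> {t. (\<Sum>r\<le>k. c r * t ^ r) = 0}" by auto
  moreover have "infinite {0::real<..}" by (rule infinite_Ioi)
  ultimately have "infinite {t. (\<Sum>r\<le>k. c r * t ^ r) = 0}" using finite_subset by blast
  then have "c r = 0" if "r \<le> k" for r using that unfolding polyfun_finite_roots by blast
  then have "V r = 0" if "r \<le> k" for r using that by (simp add: c_def)
  then have "V (Suc l) = 0" "V l = 0" using \<open>l < k\<close> by auto
  then show ?thesis by (simp add: V_def)
qed

lemma btail_matrix_independent:
  assumes "\<And>x y. 0 < x \<Longrightarrow> x < 1 \<Longrightarrow> 0 < y \<Longrightarrow> y < 1 \<Longrightarrow>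
      (\<Sum>l<k. \<Sum>j<k. a l j * btail k l x * btail k j y) = 0"
    and "l < k" "j < k"
  shows "a l j = 0"
proof (rule btail_independent[where v = "\<lambda>j. a l j", OF _ \<open>j < k\<close>])
  fix y :: real assume y: "0 < y" "y < 1"
  show "(\<Sum>j<k. a l j * btail k j y) = 0"
  proof (rule btail_independent[where v = "\<lambda>l. \<Sum>j<k. a l j * btail k j y", OF _ \<open>l < k\<close>])
    fix x :: real assume "0 < x" "x < 1"
    with assms(1)[of x y] y show "(\<Sum>l<k. (\<Sum>j<k. a l j * btail k j y) * btail k l x) = 0"
      by (simp add: sum_distrib_left sum_distrib_right mult_ac)
  qed
qed

section \<open>Leading coefficients of the tail polynomials\<close>

definition btail_poly :: "nat \<Rightarrow> nat \<Rightarrow> real poly" where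
  "btail_poly k l = (\<Sum>r\<in>{l<..k}. smult (real (k choose r)) (monom 1 r * [:1, -1:] ^ (k - r)))"

lemma poly_btail_poly: "poly (btail_poly k l) x = btail k l x"
  by (simp add: btail_poly_def btail_def Bernstein_def poly_sum poly_monom mult.assoc)

lemma degree_linear_power: "degree ([:1, -1:] ^ n :: real poly) = n"
  by (simp add: degree_power_eq)

lemma degree_btail_poly: "degree (btail_poly k l) \<le> k"
proof -
  have "degree (monom 1 r * [:1, -1:] ^ (k - r) :: real poly) \<le> k" if "r \<le> k" for r
    using degree_mult_le[of "monom 1 r" "[:1, -1:] ^ (k - r) :: real poly"] that
    by (simp add: degree_linear_power degree_monom_eq)
  then show ?thesis unfolding btail_poly_def
    by (intro degree_sum_le) (auto intro!: order.trans[OF degree_smult_le])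
qed

text \<open>Each Bernstein polynomial contributes a signed binomial coefficient. The full
  alternating sum is 0, so the tail is minus the alternating sum up to l, which has a closed
  form.\<close>

lemma coeff_btail_poly:
  assumes "l < k"
  shows "coeff (btail_poly k l) k = - ((-1) ^ (k + l) * real ((k - 1) choose l))"
proof -
  have lc: "coeff (monom 1 r * [:1, -1:] ^ (k - r) :: real poly) k = (-1) ^ k * (-1) ^ r" if "r \<le> k" for r
  proof -
    have "coeff ([:1, -1:] ^ n :: real poly) n = (-1) ^ n" for n
      using lead_coeff_power[of "[:1, -1:] :: real poly" n] by (simp add: degree_linear_power)
    then have "coeff (monom 1 r * [:1, -1:] ^ (k - r) :: real poly) k = (-1) ^ (k - r)"
      using that by (simp add: coeff_monom_mult)
    also have "\<dots> = (-1) ^ k * (-1) ^ r" using that by (auto simp: minus_one_power_iff)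
    finally show ?thesis .
  qed
  have "coeff (btail_poly k l) k = (-1) ^ k * (\<Sum>r\<in>{l<..k}. (-1) ^ r * real (k choose r))"
    unfolding btail_poly_def coeff_sum sum_distrib_left by (intro sum.cong) (simp_all add: lc)
  moreover have "(\<Sum>r\<le>k. (-1) ^ r * real (k choose r)) = 0"
    using choose_alternating_sum[of k] assms by simp
  moreover have "(\<Sum>r\<le>k. (-1) ^ r * real (k choose r))
      = (\<Sum>r\<le>l. (-1) ^ r * real (k choose r)) + (\<Sum>r\<in>{l<..k}. (-1) ^ r * real (k choose r))"
    using assms by (subst sum.union_disjoint[symmetric]) (auto intro!: sum.cong)
  moreover have "(\<Sum>r\<le>l. (-1) ^ r * real (k choose r)) = (-1) ^ l * real ((k - 1) choose l)"
    using gbinomial_sum_lower_neg[of "real k" l] assms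
    by (simp add: binomial_gbinomial mult.commute of_nat_diff)
  ultimately have "coeff (btail_poly k l) k = (-1) ^ k * - ((-1) ^ l * real ((k - 1) choose l))"
    by (metis add_eq_0_iff)
  then show ?thesis by (simp add: power_add)
qed

text \<open>Up to a constant factor, \<open>pert \<pi> x y\<close> is the derivative of the density of \<open>\<pi>\<close> at the uniform
  measure in the direction of the zero-marginal part of the indicator of \<open>[0,x] \<times> [0,y]\<close>.\<close>

definition pert :: "nat list \<Rightarrow> real \<Rightarrow> real \<Rightarrow> real" where
  "pert \<pi> x y = (\<Sum>l<length \<pi>. btail (length \<pi>) l x * btail (length \<pi>) (\<pi> ! l - 1) y) - real (length \<pi>) * x * y"

text \<open>The inverse permutation with everything counted from 0: \<open>pos \<pi> j\<close> is
  the index of the value j + 1.\<close>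

definition pos :: "nat list \<Rightarrow> nat \<Rightarrow> nat" where
  "pos \<pi> j = inv_into {..<length \<pi>} (\<lambda>l. \<pi> ! l - 1) j"

lemma bij_betw_perm:
  assumes "is_perm \<pi>" shows "bij_betw (\<lambda>l. \<pi> ! l - 1) {..<length \<pi>} {..<length \<pi>}"
proof -
  have "bij_betw ((!) \<pi>) {..<length \<pi>} {1..length \<pi>}"
    using assms by (auto simp: is_perm_def intro: bij_betw_nth)
  moreover have "bij_betw (\<lambda>i. i - 1) {1..length \<pi>} {..<length \<pi>}"
    by (rule bij_betw_byWitness[where f' = Suc]) auto
  ultimately show ?thesis using bij_betw_trans by (fastforce simp: comp_def)
qed

lemma perm_nth:
  assumes "is_perm \<pi>" "l < length \<pi>" shows "\<pi> ! l \<ge> 1" "\<pi> ! l \<le> length \<pi>"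
proof -
  have "\<pi> ! l \<in> set \<pi>" using assms by simp
  then show "\<pi> ! l \<ge> 1" "\<pi> ! l \<le> length \<pi>" using assms(1) by (auto simp: is_perm_def)
qed

lemma pos_less: "is_perm \<pi> \<Longrightarrow> j < length \<pi> \<Longrightarrow> pos \<pi> j < length \<pi>"
  and nth_pos: "is_perm \<pi> \<Longrightarrow> j < length \<pi> \<Longrightarrow> \<pi> ! pos \<pi> j = Suc j"
  and pos_nth: "is_perm \<pi> \<Longrightarrow> l < length \<pi> \<Longrightarrow> pos \<pi> (\<pi> ! l - 1) = l"
proof -
  show 1: "pos \<pi> j < length \<pi>" if "is_perm \<pi>" "j < length \<pi>"
    using bij_betw_perm[OF that(1)] that(2) inv_into_into[of j "\<lambda>l. \<pi> ! l - 1" "{..<length \<pi>}"]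
    by (auto simp: pos_def bij_betw_def)
  show "\<pi> ! pos \<pi> j = Suc j" if "is_perm \<pi>" "j < length \<pi>"
  proof -
    have "\<pi> ! pos \<pi> j - 1 = j"
      using bij_betw_perm[OF that(1)] that(2) f_inv_into_f[of j "\<lambda>l. \<pi> ! l - 1" "{..<length \<pi>}"]
      by (auto simp: pos_def bij_betw_def)
    then show ?thesis using perm_nth(1)[OF that(1) 1[OF that]] by simp
  qed
  show "pos \<pi> (\<pi> ! l - 1) = l" if "is_perm \<pi>" "l < length \<pi>"
    using bij_betw_perm[OF that(1)] that(2) unfolding pos_def bij_betw_def
    by (metis inv_into_f_f lessThan_iff)
qed

lemma bij_betw_pos: "is_perm \<pi> \<Longrightarrow> bij_betw (pos \<pi>) {..<length \<pi>} {..<length \<pi>}"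
  unfolding pos_def[abs_def] by (rule bij_betw_inv_into[OF bij_betw_perm])

lemma pert_pos:
  assumes "is_perm \<pi>" "length \<pi> = k"
  shows "pert \<pi> x y = (\<Sum>j<k. btail k (pos \<pi> j) x * btail k j y) - real k * x * y"
proof -
  have "(\<Sum>l<k. btail k l x * btail k (\<pi> ! l - 1) y)
      = (\<Sum>j<k. btail k (pos \<pi> j) x * btail k (\<pi> ! pos \<pi> j - 1) y)"
    using sum.reindex_bij_betw[OF bij_betw_pos[OF assms(1)],
        of "\<lambda>l. btail k l x * btail k (\<pi> ! l - 1) y"] assms(2) by simp
  also have "\<dots> = (\<Sum>j<k. btail k (pos \<pi> j) x * btail k j y)"
    using nth_pos[OF assms(1)] assms(2) by (intro sum.cong) auto
  finally show ?thesis by (simp add: pert_def assms(2))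
qed

text \<open>Since the \<open>btail k l x\<close> sum to k x, the term k x y is the constant matrix
  1/k in the product basis. Relations between perturbations of one order thereby become relations
  between permutation matrices.\<close>

lemma pert_matrix:
  assumes "is_perm \<pi>" "length \<pi> = k"
  shows "pert \<pi> x y = (\<Sum>l<k. \<Sum>j<k. (of_bool (\<pi> ! l = Suc j) - 1 / real k) * btail k l x * btail k j y)"
proof -
  have k: "k \<noteq> 0" using assms by (auto simp: is_perm_def)
  have "(\<Sum>l<k. \<Sum>j<k. (1 / real k) * btail k l x * btail k j y) = (1 / real k) * ((\<Sum>l<k. btail k l x) * (\<Sum>j<k. btail k j y))"
    by (subst sum_product) (simp add: sum_distrib_left sum_divide_distrib mult.assoc)
  also have "\<dots> = real k * x * y" using k by (simp add: sum_btail)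
  finally have 1: "(\<Sum>l<k. \<Sum>j<k. (1 / real k) * btail k l x * btail k j y) = real k * x * y" .
  have 2: "(\<Sum>j<k. of_bool (\<pi> ! l = Suc j) * btail k l x * btail k j y) = btail k l x * btail k (\<pi> ! l - 1) y"
    if l: "l < k" for l
  proof -
    have "(\<Sum>j<k. of_bool (\<pi> ! l = Suc j) * btail k l x * btail k j y)
        = (\<Sum>j<k. if j = \<pi> ! l - 1 then btail k l x * btail k j y else 0)"
    proof (intro sum.cong refl)
      fix j
      have "\<pi> ! l = Suc j \<longleftrightarrow> j = \<pi> ! l - 1"
        using perm_nth(1)[OF assms(1), of l] l assms(2) by auto
      then show "of_bool (\<pi> ! l = Suc j) * btail k l x * btail k j y
          = (if j = \<pi> ! l - 1 then btail k l x * btail k j y else 0)" by simp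
    qed
    moreover have "\<pi> ! l - 1 < k" using perm_nth[OF assms(1)] l assms(2) k by fastforce
    ultimately show ?thesis by simp
  qed
  show ?thesis
    by (simp add: left_diff_distrib sum_subtractf 1[simplified] 2 pert_def assms(2))
qed

text \<open>Up to marginals the indicator of [0,1-x] times [0,y] is minus that of [1-x,1] times
  [0,y], and reflecting the square reverses the pattern.\<close>

lemma pert_rev:
  assumes "is_perm \<pi>" shows "pert \<pi> (1 - x) y = - pert (rev \<pi>) x y"
proof -
  let ?k = "length \<pi>"
  have s: "(\<Sum>l<?k. btail ?k (\<pi> ! l - 1) y) = real ?k * y"
    using sum.reindex_bij_betw[OF bij_betw_perm[OF assms], of "\<lambda>j. btail ?k j y"] unfolding sum_btail .
  have "(\<Sum>l<?k. btail ?k l (1 - x) * btail ?k (\<pi> ! l - 1) y)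
      = (\<Sum>l<?k. btail ?k (\<pi> ! l - 1) y - btail ?k (?k - 1 - l) x * btail ?k (\<pi> ! l - 1) y)"
    by (intro sum.cong) (simp_all add: btail_reflect algebra_simps)
  also have "\<dots> = real ?k * y - (\<Sum>l<?k. btail ?k (?k - 1 - l) x * btail ?k (\<pi> ! l - 1) y)"
    unfolding sum_subtractf s ..
  also have "(\<Sum>l<?k. btail ?k (?k - 1 - l) x * btail ?k (\<pi> ! l - 1) y)
      = (\<Sum>l<?k. btail ?k l x * btail ?k (rev \<pi> ! l - 1) y)"
    by (intro sum.reindex_bij_witness[of _ "\<lambda>l. ?k - 1 - l" "\<lambda>l. ?k - 1 - l"]) (auto simp: rev_nth)
  finally show ?thesis by (simp add: pert_def algebra_simps)
qed

lemma is_perm_rev: "is_perm (rev \<pi>) \<longleftrightarrow> is_perm \<pi>"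
  by (simp add: is_perm_def)

lemma perm_neq_rev:
  assumes "is_perm \<pi>" "length \<pi> \<ge> 2" shows "rev \<pi> \<noteq> \<pi>"
proof
  assume *: "rev \<pi> = \<pi>"
  have "\<pi> ! 0 = \<pi> ! (length \<pi> - 1)" using assms(2) by (subst *[symmetric]) (simp add: rev_nth)
  then have "0 = length \<pi> - 1"
    using assms unfolding is_perm_def by (subst (asm) nth_eq_iff_index_eq) auto
  then show False using assms(2) by simp
qed

section \<open>Linear independence of the first-order changes\<close>

text \<open>In dual form this says that suitable perturbations of the uniform weight change the
  densities in every direction; see \<open>realizable_UNIV\<close>.\<close>

definition pert_independent :: "nat list set \<Rightarrow> bool" where
  "pert_independent I \<longleftrightarrow>
     (\<forall>a. (\<forall>x\<in>{0<..<1}. \<forall>y\<in>{0<..<1}. (\<Sum>\<pi>\<in>I. a \<pi> * pert \<pi> x y) = 0) \<longrightarrow> (\<forall>\<pi>\<in>I. a \<pi> = 0))"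

text \<open>The coefficient of \<open>x^k\<close> in \<open>btail k l\<close> is \<open>\<plusminus> (k - 1 choose l)\<close>, so comparing leading coefficients in \<open>x\<close>
  leaves a linear relation between the \<open>btail k j y\<close>, hence one relation for each \<open>j\<close>.\<close>

lemma pert_top_coeff:
  assumes I: "finite I" "\<And>\<pi>. \<pi> \<in> I \<Longrightarrow> is_perm \<pi> \<and> length \<pi> \<le> k" and k: "k \<ge> 2"
    and van: "\<And>x y. 0 < x \<Longrightarrow> x < 1 \<Longrightarrow> 0 < y \<Longrightarrow> y < 1 \<Longrightarrow> (\<Sum>\<pi>\<in>I. a \<pi> * pert \<pi> x y) = 0"
    and j: "j < k"
  shows "(\<Sum>\<pi>\<in>{\<pi>\<in>I. length \<pi> = k}. a \<pi> * ((-1) ^ pos \<pi> j * real ((k - 1) choose pos \<pi> j))) = 0"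
    (is "?v j = 0")
proof -
  let ?w = "\<lambda>l. coeff (btail_poly k l) k"
  define v where "v j = (\<Sum>\<pi>\<in>{\<pi>\<in>I. length \<pi> = k}. a \<pi> * ?w (pos \<pi> j))" for j
  have "v j = 0"
  proof (rule btail_independent[OF _ j, of v])
    fix y :: real assume y: "0 < y" "y < 1"
    define Q where "Q \<pi> = (\<Sum>l<length \<pi>. smult (btail (length \<pi>) (\<pi> ! l - 1) y) (btail_poly (length \<pi>) l))
        - [:0, real (length \<pi>) * y:]" for \<pi>
    have Q: "poly (Q \<pi>) x = pert \<pi> x y" for \<pi> x
      by (simp add: Q_def pert_def poly_sum poly_btail_poly mult.commute mult.left_commute)
    define R where "R = (\<Sum>\<pi>\<in>I. smult (a \<pi>) (Q \<pi>))"
    have "{0<..<1} \<subseteq> {x. poly R x = 0}" using van y by (auto simp: R_def poly_sum Q)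
    moreover have "infinite {0::real<..<1}" by simp
    ultimately have "R = 0" using poly_roots_finite finite_subset by blast
    then have "0 = coeff R k" by simp
    also have "\<dots> = (\<Sum>\<pi>\<in>I. a \<pi> * coeff (Q \<pi>) k)" by (simp add: R_def coeff_sum)
    also have "\<dots> = (\<Sum>\<pi>\<in>I. if length \<pi> = k then a \<pi> * (\<Sum>j<k. ?w (pos \<pi> j) * btail k j y) else 0)"
    proof (intro sum.cong refl)
      fix \<pi> assume \<pi>: "\<pi> \<in> I"
      \<comment> \<open>The bilinear term of \<open>pert\<close> has degree 1 in x, hence does not
        reach the coefficient of x^k because k \<ge> 2.\<close>
      have k0: "coeff [:0, real (length \<pi>) * y:] k = 0" for \<pi> :: "nat list"
        using k by (auto simp: coeff_pCons numeral_2_eq_2 Suc_le_eq split: nat.split)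
      show "a \<pi> * coeff (Q \<pi>) k = (if length \<pi> = k then a \<pi> * (\<Sum>j<k. ?w (pos \<pi> j) * btail k j y) else 0)"
      proof (cases "length \<pi> = k")
        case True
        have "coeff (Q \<pi>) k = (\<Sum>l<k. ?w l * btail k (\<pi> ! l - 1) y)"
          using k0[of \<pi>] True by (simp add: Q_def coeff_sum mult.commute)
        also have "\<dots> = (\<Sum>j<k. ?w (pos \<pi> j) * btail k (\<pi> ! pos \<pi> j - 1) y)"
          using sum.reindex_bij_betw[OF bij_betw_pos, of \<pi> "\<lambda>l. ?w l * btail k (\<pi> ! l - 1) y"] I(2)[OF \<pi>] True by simp
        also have "\<dots> = (\<Sum>j<k. ?w (pos \<pi> j) * btail k j y)"
          using nth_pos[of \<pi>] I(2)[OF \<pi>] True by (intro sum.cong) auto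
        finally show ?thesis using True by simp
      next
        case False
        then have "coeff (btail_poly (length \<pi>) l) k = 0" for l
          using I(2)[OF \<pi>] degree_btail_poly[of "length \<pi>" l] by (intro coeff_eq_0) linarith
        then show ?thesis using False by (simp add: Q_def coeff_sum k0)
      qed
    qed
    also have "\<dots> = (\<Sum>\<pi>\<in>{\<pi>\<in>I. length \<pi> = k}. a \<pi> * (\<Sum>j<k. ?w (pos \<pi> j) * btail k j y))"
      using I(1) by (simp add: sum.inter_filter)
    also have "\<dots> = (\<Sum>j<k. v j * btail k j y)"
      unfolding v_def sum_distrib_left sum_distrib_right
      by (subst sum.swap) (simp add: mult.assoc)
    finally show "(\<Sum>j<k. v j * btail k j y) = 0" by simp
  qed
  moreover have "v j = - ((-1) ^ k) * ?v j"
    unfolding v_def sum_distrib_left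
    using I(2) j by (intro sum.cong refl) (auto simp: coeff_btail_poly pos_less power_add)
  ultimately show ?thesis by simp
qed

text \<open>A strictly longest permutation is alone in the relation between top coefficients. Its
  binomial coefficient there is nonzero, so its own coefficient vanishes.\<close>

lemma pert_independent_insert:
  assumes I: "finite I" "\<And>\<pi>. \<pi> \<in> I \<Longrightarrow> is_perm \<pi> \<and> length \<pi> < length \<tau>"
    and \<tau>: "is_perm \<tau>" "length \<tau> \<ge> 2" and ind: "pert_independent I"
  shows "pert_independent (insert \<tau> I)"
  unfolding pert_independent_def
proof (intro allI impI)
  fix a assume van: "\<forall>x\<in>{0<..<1}. \<forall>y\<in>{0<..<1}. (\<Sum>\<pi>\<in>insert \<tau> I. a \<pi> * pert \<pi> x y) = 0"
  let ?k = "length \<tau>"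
  have "{\<pi> \<in> insert \<tau> I. length \<pi> = ?k} = {\<tau>}" using I(2) by fastforce
  have "a \<tau> * ((-1) ^ pos \<tau> 0 * real ((?k - 1) choose pos \<tau> 0)) = 0"
  proof -
    have "is_perm \<pi> \<and> length \<pi> \<le> ?k" if "\<pi> \<in> insert \<tau> I" for \<pi>
      using that I(2)[of \<pi>] \<tau>(1) by auto
    moreover have "(\<Sum>\<pi>\<in>insert \<tau> I. a \<pi> * pert \<pi> x y) = 0" if "0 < x" "x < 1" "0 < y" "y < 1" for x y
      using van that by simp
    moreover have "0 < ?k" using \<tau>(2) by linarith
    ultimately have "(\<Sum>\<pi>\<in>{\<pi>\<in>insert \<tau> I. length \<pi> = ?k}.
        a \<pi> * ((-1) ^ pos \<pi> 0 * real ((?k - 1) choose pos \<pi> 0))) = 0"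
      by (intro pert_top_coeff[OF _ _ \<tau>(2)]) (use I(1) in auto)
    then show ?thesis using \<open>{\<pi> \<in> insert \<tau> I. length \<pi> = ?k} = {\<tau>}\<close> by simp
  qed
  moreover have "pos \<tau> 0 \<le> ?k - 1" using pos_less[OF \<tau>(1), of 0] \<tau>(2) by linarith
  ultimately have a: "a \<tau> = 0" by (simp add: binomial_eq_0_iff)
  moreover have "\<tau> \<notin> I" using I(2) by auto
  ultimately have "\<forall>x\<in>{0<..<1}. \<forall>y\<in>{0<..<1}. (\<Sum>\<pi>\<in>I. a \<pi> * pert \<pi> x y) = 0"
    using van I(1) by simp
  with ind a show "\<forall>\<pi>\<in>insert \<tau> I. a \<pi> = 0" unfolding pert_independent_def by auto
qed

lemma pert_sum_matrix_entries:
  assumes I: "\<And>\<pi>. \<pi> \<in> I \<Longrightarrow> is_perm \<pi> \<and> length \<pi> = k"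
    and van: "\<And>x y. 0 < x \<Longrightarrow> x < 1 \<Longrightarrow> 0 < y \<Longrightarrow> y < 1 \<Longrightarrow> (\<Sum>\<pi>\<in>I. a \<pi> * pert \<pi> x y) = 0"
    and lj: "l < k" "j < k"
  shows "(\<Sum>\<pi>\<in>I. a \<pi> * (of_bool (\<pi> ! l = Suc j) - 1 / real k)) = 0"
proof (rule btail_matrix_independent[OF _ lj, of "\<lambda>l j. \<Sum>\<pi>\<in>I. a \<pi> * (of_bool (\<pi> ! l = Suc j) - 1 / real k)"])
  fix x y :: real assume xy: "0 < x" "x < 1" "0 < y" "y < 1"
  have "(\<Sum>l<k. \<Sum>j<k. (\<Sum>\<pi>\<in>I. a \<pi> * (of_bool (\<pi> ! l = Suc j) - 1 / real k)) * btail k l x * btail k j y)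
     = (\<Sum>l<k. \<Sum>j<k. \<Sum>\<pi>\<in>I. a \<pi> * ((of_bool (\<pi> ! l = Suc j) - 1 / real k) * btail k l x * btail k j y))"
    by (simp add: sum_distrib_right mult.assoc)
  also have "\<dots> = (\<Sum>l<k. \<Sum>\<pi>\<in>I. \<Sum>j<k. a \<pi> * ((of_bool (\<pi> ! l = Suc j) - 1 / real k) * btail k l x * btail k j y))"
    by (intro sum.cong refl sum.swap)
  also have "\<dots> = (\<Sum>\<pi>\<in>I. \<Sum>l<k. \<Sum>j<k. a \<pi> * ((of_bool (\<pi> ! l = Suc j) - 1 / real k) * btail k l x * btail k j y))"
    by (rule sum.swap)
  also have "\<dots> = (\<Sum>\<pi>\<in>I. a \<pi> * pert \<pi> x y)"
    using I by (intro sum.cong refl) (simp add: pert_matrix[of _ k] sum_distrib_left)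
  finally show "(\<Sum>l<k. \<Sum>j<k. (\<Sum>\<pi>\<in>I. a \<pi> * (of_bool (\<pi> ! l = Suc j) - 1 / real k)) * btail k l x * btail k j y) = 0"
    using van[OF xy] by simp
qed

text \<open>Comparing matrix entries controls the sum of \<open>a \<pi>\<close> over all \<pi> with
  a given value at a given position. The bound \<open>card I < k\<close> rules out Latin squares,
  whose terms cancel. The bound 3 rules out relations P1 - P2 - P3 + P4 = 0 of permutation matrices,
  which arise from applying two disjoint swaps independently.\<close>

lemma pert_independent_same_length:
  assumes I: "finite I" "\<And>\<pi>. \<pi> \<in> I \<Longrightarrow> is_perm \<pi> \<and> length \<pi> = k" and card: "card I \<le> 3" "card I < k"
  shows "pert_independent I"
  unfolding pert_independent_def
proof (intro allI impI)
  fix a assume van: "\<forall>x\<in>{0<..<1}. \<forall>y\<in>{0<..<1}. (\<Sum>\<pi>\<in>I. a \<pi> * pert \<pi> x y) = 0"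
  have entry: "(\<Sum>\<pi>\<in>I. a \<pi> * of_bool (\<pi> ! l = Suc j)) = (\<Sum>\<pi>\<in>I. a \<pi>) / real k" if "l < k" "j < k" for l j
    using pert_sum_matrix_entries[of I k a l j] I(2) van that
    by (simp add: right_diff_distrib sum_subtractf sum_divide_distrib)
  \<comment> \<open>Fewer than k permutations cannot show all k values at position 0. At a missing
    value the left side of \<open>entry\<close> is an empty sum.\<close>
  have sum0: "(\<Sum>\<pi>\<in>I. a \<pi>) = 0"
  proof -
    have "card ((\<lambda>\<pi>. \<pi> ! 0 - 1) ` I) < card {..<k}"
      using card(2) card_image_le[OF I(1), of "\<lambda>\<pi>. \<pi> ! 0 - 1"] by simp
    then have "\<not> {..<k} \<subseteq> (\<lambda>\<pi>. \<pi> ! 0 - 1) ` I"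
      using card_mono[OF finite_imageI[OF I(1)], of "{..<k}" "\<lambda>\<pi>. \<pi> ! 0 - 1"] by linarith
    then obtain j where j: "j < k" "\<And>\<pi>. \<pi> \<in> I \<Longrightarrow> \<pi> ! 0 - 1 \<noteq> j" by auto
    have "(\<Sum>\<pi>\<in>I. a \<pi> * of_bool (\<pi> ! 0 = Suc j)) = 0"
      using j(2) by (intro sum.neutral) force
    then show ?thesis using entry[of 0 j] j(1) by simp
  qed
  \<comment> \<open>At a position l where p and q differ, a permutation alone with its value has
    coefficient 0. So p and q would both need a companion there, but at most one further permutation
    exists and it cannot agree with both.\<close>
  have pair: "a p = 0 \<or> a q = 0" if pq: "p \<in> I" "q \<in> I" "p \<noteq> q" for p q
  proof -
    obtain l where l: "l < k" "p ! l \<noteq> q ! l"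
      using pq I(2) nth_equalityI[of p q] by metis
    have col: "(\<Sum>\<pi>\<in>I. a \<pi> * of_bool (\<pi> ! l = r ! l)) = 0" if r: "r \<in> I" for r
    proof -
      have "r ! l \<ge> 1" "r ! l \<le> k" using perm_nth[of r l] I(2)[OF r] l by auto
      then show ?thesis using entry[of l "r ! l - 1"] l sum0 by simp
    qed
    have alone: "a r = 0" if "r \<in> I" "\<And>\<pi>. \<pi> \<in> I \<Longrightarrow> \<pi> \<noteq> r \<Longrightarrow> \<pi> ! l \<noteq> r ! l" for r
    proof -
      have "(\<Sum>\<pi>\<in>I. a \<pi> * of_bool (\<pi> ! l = r ! l)) = (\<Sum>\<pi>\<in>I. if \<pi> = r then a \<pi> else 0)"
        using that by (intro sum.cong) auto
      then show ?thesis using col[OF that(1)] that(1) I(1) by simp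
    qed
    have "card (I - {p, q}) \<le> 1" using card(1) pq by (simp add: card_Diff_subset)
    then have third: "r = r'" if "r \<in> I - {p, q}" "r' \<in> I - {p, q}" for r r'
      using that I(1) by (metis card_le_Suc0_iff_eq finite_Diff One_nat_def)
    show ?thesis
    proof (rule ccontr)
      assume "\<not> ?thesis"
      then have n: "a p \<noteq> 0" "a q \<noteq> 0" by auto
      obtain r where r: "r \<in> I" "r \<noteq> p" "r ! l = p ! l" using alone[OF pq(1)] n(1) by blast
      obtain r' where r': "r' \<in> I" "r' \<noteq> q" "r' ! l = q ! l" using alone[OF pq(2)] n(2) by blast
      have "r = r'" using r r' l by (intro third) auto
      then show False using r r' l by simp
    qed
  qed
  show "\<forall>\<pi>\<in>I. a \<pi> = 0"
  proof (rule ccontr)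
    assume "\<not> ?thesis"
    then obtain p where p: "p \<in> I" "a p \<noteq> 0" by auto
    then have "(\<Sum>\<pi>\<in>I. a \<pi>) = (\<Sum>\<pi>\<in>I. if \<pi> = p then a \<pi> else 0)"
      using pair by (intro sum.cong) auto
    then show False using sum0 p I(1) by simp
  qed
qed

text \<open>Fold both indices into the lower half of the row by symmetry; there the binomial
  coefficients increase strictly.\<close>

lemma binomial_eq_imp:
  assumes "n choose a = n choose b" "a \<le> n" "b \<le> n"
  shows "a = b \<or> a + b = (n::nat)"
proof -
  have *: "c = d" if "n choose c = n choose d" "2 * c \<le> n" "2 * d \<le> n" for c d
    using that binomial_strict_mono[of c d n] binomial_strict_mono[of d c n] by (metis less_irrefl linorder_neqE_nat)
  define f where "f c = (if 2 * c \<le> n then c else n - c)" for c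
  have "n choose f c = n choose c" "2 * f c \<le> n" if "c \<le> n" for c
    using that binomial_symmetric[of c n] by (auto simp: f_def)
  then have "f a = f b" using * assms by metis
  then show ?thesis using assms by (auto simp: f_def split: if_splits)
qed

text \<open>Order 2 is special: the perturbation is a product of a function of x and a function of
  y, and reversal only changes its sign (e is 2 or -2).\<close>

lemma pert_length_2:
  assumes "is_perm r" "length r = 2"
  obtains e where "e \<noteq> 0" "\<And>x y. pert r x y = e * (x - x\<^sup>2) * (y - y\<^sup>2)"
proof -
  have b: "btail 2 0 x = 2 * x - x\<^sup>2" "btail 2 1 x = x\<^sup>2" for x
  proof -
    have "{0<..2} = {1, 2::nat}" "{1<..2} = {2::nat}" by auto
    then show "btail 2 0 x = 2 * x - x\<^sup>2" "btail 2 1 x = x\<^sup>2"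
      by (simp_all add: btail_def Bernstein_def power2_eq_square algebra_simps)
  qed
  have two: "{..<2} = {0, 1::nat}" by auto
  have p: "pert r x y = btail 2 0 x * btail 2 (r ! 0 - 1) y + btail 2 1 x * btail 2 (r ! 1 - 1) y - 2 * x * y" for x y
    unfolding pert_def assms(2) two by simp
  obtain u v where r: "r = [u, v]" using assms(2) by (auto simp: length_Suc_conv eval_nat_numeral)
  have "u = 1 \<or> u = 2" "v = 1 \<or> v = 2" "u \<noteq> v"
    using assms(1) perm_nth[OF assms(1), of 0] perm_nth[OF assms(1), of 1] by (auto simp: r is_perm_def)
  then have "r = [1, 2] \<or> r = [2, 1]" using r by auto
  then consider "r = [1, 2]" | "r = [2, 1]" by blast
  then show thesis
  proof cases
    case 1
    have "pert r x y = 2 * (x - x\<^sup>2) * (y - y\<^sup>2)" for x y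
      using p[of x y] by (simp add: 1 b b[unfolded One_nat_def] algebra_simps)
    then show ?thesis using that[of 2] by simp
  next
    case 2
    have "pert r x y = -2 * (x - x\<^sup>2) * (y - y\<^sup>2)" for x y
      using p[of x y] by (simp add: 2 b b[unfolded One_nat_def] algebra_simps)
    then show ?thesis using that[of "-2"] by simp
  qed
qed

text \<open>The matrix entries recover the permutation. Unlike
  \<open>pert_independent_same_length\<close>, this also compares the two permutations of order
  2.\<close>

lemma pert_inject:
  assumes "is_perm \<pi>" "is_perm \<rho>" "length \<pi> = k" "length \<rho> = k"
    and eq: "\<And>x y. 0 < x \<Longrightarrow> x < 1 \<Longrightarrow> 0 < y \<Longrightarrow> y < 1 \<Longrightarrow> pert \<pi> x y = pert \<rho> x y"
  shows "\<pi> = \<rho>"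
proof (rule ccontr)
  assume ne: "\<pi> \<noteq> \<rho>"
  then obtain l where l: "l < k" "\<pi> ! l \<noteq> \<rho> ! l"
    using assms nth_equalityI[of \<pi> \<rho>] by metis
  have j: "\<pi> ! l \<ge> 1" "\<pi> ! l \<le> k" using perm_nth[OF assms(1), of l] assms(3) l by auto
  define a where "a \<tau> = (if \<tau> = \<pi> then 1 else -1 :: real)" for \<tau>
  have "(\<Sum>\<tau>\<in>{\<pi>, \<rho>}. a \<tau> * (of_bool (\<tau> ! l = Suc (\<pi> ! l - 1)) - 1 / real k)) = 0"
    using assms ne l j by (intro pert_sum_matrix_entries) (auto simp: a_def)
  then show False using ne l j by (simp add: a_def)
qed

text \<open>The leading coefficients force \<open>\<bar>a p\<bar> = \<bar>a q\<bar>\<close> and, since binomial coefficients are unimodal, that each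
  \<open>pos q j\<close> is \<open>pos p j\<close> or its reflection. The contribution of \<open>p\<close> and \<open>q\<close> is therefore odd or even under
  \<open>x \<mapsto> 1 - x\<close>, which is impossible for \<open>r\<close>, unless \<open>r\<close> has order 2, where it would be a product matrix
  with too many nonzero entries in its first row.\<close>

lemma pert_independent_mixed:
  assumes p: "is_perm p" "length p = k" and q: "is_perm q" "length q = k" and "p \<noteq> q"
    and r: "is_perm r" "2 \<le> length r" "length r < k" and k: "k \<ge> 4"
  shows "pert_independent {p, q, r}"
  unfolding pert_independent_def
proof (intro allI impI)
  fix a assume *: "\<forall>x\<in>{0<..<1}. \<forall>y\<in>{0<..<1}. (\<Sum>\<pi>\<in>{p, q, r}. a \<pi> * pert \<pi> x y) = 0"
  have pr: "p \<noteq> r" "q \<noteq> r" using p q r by auto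
  have van: "a p * pert p x y + a q * pert q x y + a r * pert r x y = 0"
    if "0 < x" "x < 1" "0 < y" "y < 1" for x y
    using * that pr \<open>p \<noteq> q\<close> by (simp add: add.assoc)
  have pos_lt: "pos p j < k" "pos q j < k" if "j < k" for j
    using pos_less[OF p(1), of j] pos_less[OF q(1), of j] p(2) q(2) that by auto
  let ?c = "\<lambda>\<pi> j. real ((k - 1) choose pos \<pi> j)"
  have top: "a p * ((-1) ^ pos p j * ?c p j) + a q * ((-1) ^ pos q j * ?c q j) = 0" if "j < k" for j
  proof -
    have "{\<pi> \<in> {p, q, r}. length \<pi> = k} = {p, q}" using assms by auto
    moreover have "is_perm \<pi> \<and> length \<pi> \<le> k" if "\<pi> \<in> {p, q, r}" for \<pi> using that p q r by auto
    ultimately show ?thesis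
      using pert_top_coeff[of "{p, q, r}" k a j] that k van pr \<open>p \<noteq> q\<close>
      by (simp add: add.assoc)
  qed
  have c_pos: "?c p j > 0" "?c q j > 0" if "j < k" for j
    using pos_less[OF p(1)] pos_less[OF q(1)] p q that by (auto simp: zero_less_binomial_iff less_Suc_eq_le[symmetric])
  have abs_top: "\<bar>a p\<bar> * ?c p j = \<bar>a q\<bar> * ?c q j" if "j < k" for j
    using arg_cong[OF top[OF that, unfolded add_eq_0_iff], of abs]
    by (simp add: abs_mult power_abs)
  \<comment> \<open>Summing \<open>abs_top\<close> over all values j removes the dependence on the
    permutations, since \<open>pos p\<close> and \<open>pos q\<close> both run through all
    positions.\<close>
  have abs_eq: "\<bar>a p\<bar> = \<bar>a q\<bar>"
  proof -
    let ?C = "\<Sum>l<k. real ((k - 1) choose l)"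
    have s: "(\<Sum>j<k. ?c p j) = ?C" "(\<Sum>j<k. ?c q j) = ?C"
      using sum.reindex_bij_betw[OF bij_betw_pos[OF p(1)], of "\<lambda>l. real ((k - 1) choose l)"]
        sum.reindex_bij_betw[OF bij_betw_pos[OF q(1)], of "\<lambda>l. real ((k - 1) choose l)"] p q by auto
    have "\<bar>a p\<bar> * ?C = (\<Sum>j<k. \<bar>a p\<bar> * ?c p j)" unfolding s(1)[symmetric] sum_distrib_left ..
    also have "\<dots> = (\<Sum>j<k. \<bar>a q\<bar> * ?c q j)" using abs_top by (intro sum.cong) auto
    also have "\<dots> = \<bar>a q\<bar> * ?C" unfolding s(2)[symmetric] sum_distrib_left ..
    finally have "\<bar>a p\<bar> * ?C = \<bar>a q\<bar> * ?C" .
    moreover have "?C > 0" using k by (intro sum_pos) (auto simp: zero_less_binomial_iff lessThan_empty_iff)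
    ultimately show ?thesis by simp
  qed
  have r_only: "a p = 0 \<and> a q = 0 \<and> a r = 0" if "a p = 0"
  proof -
    have aq: "a q = 0" using abs_eq that by simp
    have "pert_independent {r}"
      using r by (intro pert_independent_same_length[of _ "length r"]) auto
    moreover have "\<forall>x\<in>{0<..<1}. \<forall>y\<in>{0<..<1}. (\<Sum>\<pi>\<in>{r}. a \<pi> * pert \<pi> x y) = 0"
      using van that aq by auto
    ultimately show ?thesis using that aq unfolding pert_independent_def by blast
  qed
  have pq_only: "a p = 0" if "a r = 0"
  proof -
    have "pert_independent {p, q}"
      using p q k \<open>p \<noteq> q\<close> by (intro pert_independent_same_length[of _ k]) auto
    moreover have "\<forall>x\<in>{0<..<1}. \<forall>y\<in>{0<..<1}. (\<Sum>\<pi>\<in>{p, q}. a \<pi> * pert \<pi> x y) = 0"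
      using van that \<open>p \<noteq> q\<close> by auto
    ultimately show ?thesis unfolding pert_independent_def by blast
  qed
  have "a p = 0"
  proof (rule ccontr)
    assume ap: "a p \<noteq> 0"
    then have ar: "a r \<noteq> 0" using pq_only by blast
    have r_rev: "is_perm (rev r)" "length (rev r) = length r" "rev r \<noteq> r"
      using r perm_neq_rev by (auto simp: is_perm_rev)
    have reflected: "pos q j = pos p j \<or> pos p j + pos q j = k - 1" if "j < k" for j
    proof -
      have "?c p j = ?c q j" using abs_top[OF that] ap unfolding abs_eq[symmetric] by simp
      then have "(k - 1) choose pos p j = (k - 1) choose pos q j" by simp
      then show ?thesis
        using binomial_eq_imp[of "k - 1" "pos p j" "pos q j"] pos_less[OF p(1)] pos_less[OF q(1)] p q that
        by fastforce
    qed
    consider "a q = a p" | "a q = - a p" using abs_eq by (auto simp: abs_eq_iff)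
    then show False
    proof cases
      case 1
      \<comment> \<open>With equal coefficients an agreement of positions would double the top
        coefficient instead of cancelling it. So every position is reflected, q is the reversal of
        p, and the sum of their terms is odd.\<close>
      have posq: "pos q j = k - 1 - pos p j" if "j < k" for j
      proof -
        have "pos q j \<noteq> pos p j"
        proof
          assume "pos q j = pos p j"
          then have "2 * a p * ((-1) ^ pos p j * ?c p j) = 0" using top[OF that] 1 by simp
          then show False using ap c_pos(1)[OF that] by simp
        qed
        then show ?thesis using reflected[OF that] by auto
      qed
      have p_rev: "pert p (1 - x) y = - pert q x y" "pert q (1 - x) y = - pert p x y" for x y
      proof -
        have f: "btail k (pos p j) (1 - x) = 1 - btail k (pos q j) x"
          "btail k (pos q j) (1 - x) = 1 - btail k (pos p j) x" if "j < k" for j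
        proof -
          show "btail k (pos p j) (1 - x) = 1 - btail k (pos q j) x"
            "btail k (pos q j) (1 - x) = 1 - btail k (pos p j) x"
            using btail_reflect[of "pos p j" k x] btail_reflect[of "pos q j" k x] posq[OF that] pos_lt[OF that]
            by auto
        qed
        show "pert p (1 - x) y = - pert q x y" "pert q (1 - x) y = - pert p x y"
          by (simp_all add: pert_pos[OF p] pert_pos[OF q] f left_diff_distrib sum_subtractf sum_btail algebra_simps)
      qed
      have "pert r x y = pert (rev r) x y" if xy: "0 < x" "x < 1" "0 < y" "y < 1" for x y
      proof -
        have "a p * pert p x y + a p * pert q x y + a r * pert r x y = 0" using van[OF xy] 1 by simp
        moreover have "- (a p * pert q x y) - a p * pert p x y - a r * pert (rev r) x y = 0"
          using van[of "1 - x" y] xy 1 by (simp add: p_rev pert_rev[OF r(1)])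
        ultimately have "a r * pert r x y = a r * pert (rev r) x y" by linarith
        then show ?thesis using ar by simp
      qed
      then show False using pert_inject[OF r(1) r_rev(1), of "length r"] r_rev by auto
    next
      case 2
      \<comment> \<open>With opposite coefficients each value j contributes either nothing or a
        difference of two mutually reflected tails, in which the constants 1 cancel.\<close>
      have pq_rev: "pert p (1 - x) y - pert q (1 - x) y = pert p x y - pert q x y" for x y
      proof -
        have f: "btail k (pos p j) (1 - x) - btail k (pos q j) (1 - x) = btail k (pos p j) x - btail k (pos q j) x"
          if "j < k" for j
        proof -
          note l = pos_lt[OF that]
          from reflected[OF that] show ?thesis
          proof
            assume "pos p j + pos q j = k - 1"
            then have "k - 1 - pos p j = pos q j" "k - 1 - pos q j = pos p j" by auto
            then show ?thesis using btail_reflect[OF l(1), of x] btail_reflect[OF l(2), of x] by simp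
          qed simp
        qed
        have "pert p x y - pert q x y = (\<Sum>j<k. (btail k (pos p j) x - btail k (pos q j) x) * btail k j y)" for x
          by (simp add: pert_pos[OF p] pert_pos[OF q] left_diff_distrib sum_subtractf)
        then show ?thesis using f by simp
      qed
      have rr: "pert r x y + pert (rev r) x y = 0" if xy: "0 < x" "x < 1" "0 < y" "y < 1" for x y
      proof -
        have "a p * (pert p x y - pert q x y) + a r * pert r x y = 0"
          using van[OF xy] 2 by (simp add: algebra_simps)
        moreover have "a p * (pert p (1 - x) y - pert q (1 - x) y) + a r * pert r (1 - x) y = 0"
          using van[of "1 - x" y] xy 2 by (simp add: algebra_simps)
        then have "a p * (pert p x y - pert q x y) - a r * pert (rev r) x y = 0"
          unfolding pq_rev pert_rev[OF r(1)] by simp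
        ultimately have "a r * (pert r x y + pert (rev r) x y) = 0" by (simp add: distrib_left)
        then show ?thesis using ar by simp
      qed
      \<comment> \<open>For orders at least 3 the relation \<open>rr\<close> contradicts the
        independence of r and its reversal; for order 2 it holds identically, so parity gives no
        contradiction.\<close>
      have len_r: "length r = 2"
      proof (rule ccontr)
        assume "length r \<noteq> 2"
        then have "pert_independent {r, rev r}"
          using r r_rev by (intro pert_independent_same_length[of _ "length r"]) auto
        moreover have "\<forall>x\<in>{0<..<1}. \<forall>y\<in>{0<..<1}. (\<Sum>\<pi>\<in>{r, rev r}. 1 * pert \<pi> x y) = 0"
          using rr r_rev(3) by simp
        ultimately have "\<forall>\<pi>\<in>{r, rev r}. (1::real) = 0"
          unfolding pert_independent_def by (elim allE[of _ "\<lambda>_. 1"]) blast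
        then have "(1::real) = 0" by (rule bspec[where x = r]) simp
        then show False by simp
      qed
      obtain e where e: "e \<noteq> 0" "\<And>x y. pert r x y = e * (x - x\<^sup>2) * (y - y\<^sup>2)"
        using pert_length_2[OF r(1) len_r] by blast
      \<comment> \<open>Coordinates of x - x^2 in the basis \<open>btail k l\<close>: the first part
        produces x and the second x^2.\<close>
      define d where "d l = 1 / real k - 2 / (real k * (real k - 1)) * real l" for l :: nat
      have d: "(\<Sum>l<k. d l * btail k l x) = x - x\<^sup>2" for x
      proof -
        have "(\<Sum>l<k. d l * btail k l x) = 1 / real k * (\<Sum>l<k. btail k l x)
            - 2 / (real k * (real k - 1)) * (\<Sum>l<k. real l * btail k l x)"
          by (simp add: d_def left_diff_distrib sum_subtractf sum_distrib_left mult.assoc)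
        also have "\<dots> = x - x\<^sup>2" using k by (simp add: sum_btail sum_linear_btail field_simps)
        finally show ?thesis .
      qed
      have entry: "a p * (of_bool (p ! l = Suc j) - of_bool (q ! l = Suc j)) + a r * e * d l * d j = 0"
        if "l < k" "j < k" for l j
      proof (rule btail_matrix_independent[OF _ that])
        fix x y :: real assume xy: "0 < x" "x < 1" "0 < y" "y < 1"
        let ?M = "\<lambda>m. \<Sum>l<k. \<Sum>j<k. m l j * btail k l x * btail k j y"
        have "pert r x y = e * ((x - x\<^sup>2) * (y - y\<^sup>2))" by (simp add: e(2))
        also have "(x - x\<^sup>2) * (y - y\<^sup>2) = ?M (\<lambda>l j. d l * d j)"
          unfolding d[symmetric] sum_product by (intro sum.cong refl) (simp add: mult_ac)
        finally have "pert r x y = e * ?M (\<lambda>l j. d l * d j)" .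
        moreover have "a p * (pert p x y - pert q x y) + a r * pert r x y = 0"
          using van[OF xy] 2 by (simp add: algebra_simps)
        ultimately have "a p * (pert p x y - pert q x y) + a r * e * ?M (\<lambda>l j. d l * d j) = 0"
          by simp
        moreover have "pert p x y - pert q x y = ?M (\<lambda>l j. of_bool (p ! l = Suc j) - of_bool (q ! l = Suc j))"
          by (simp add: pert_matrix[OF p] pert_matrix[OF q] flip: sum_subtractf left_diff_distrib)
        moreover have "?M (\<lambda>l j. a p * (of_bool (p ! l = Suc j) - of_bool (q ! l = Suc j)) + a r * e * d l * d j)
            = a p * ?M (\<lambda>l j. of_bool (p ! l = Suc j) - of_bool (q ! l = Suc j)) + a r * e * ?M (\<lambda>l j. d l * d j)"
          by (simp add: sum_distrib_left distrib_right sum.distrib mult.assoc)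
        ultimately show "?M (\<lambda>l j. a p * (of_bool (p ! l = Suc j) - of_bool (q ! l = Suc j)) + a r * e * d l * d j) = 0"
          by simp
      qed
      \<comment> \<open>In row 0 the matrices of p and q have a single entry 1 each, while the
        product \<open>d 0 * d j\<close> vanishes only if 2 j = k - 1. Since k \<ge> 4, some column
        avoids these at most three.\<close>
      define J where "J = {p ! 0 - 1, q ! 0 - 1, (k - 1) div 2}"
      have "card J \<le> 3" unfolding J_def by (simp add: card_insert_if)
      then have "\<not> {..<k} \<subseteq> J" using k card_mono[of J "{..<k}"] by (auto simp: J_def)
      then obtain j where j: "j < k" "j \<notin> J" by auto
      then have "p ! 0 \<noteq> Suc j" "q ! 0 \<noteq> Suc j" "2 * j \<noteq> k - 1" by (auto simp: J_def)
      then have "d 0 * d j = 0" using entry[of 0 j] j k ar e(1) by simp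
      moreover have "d 0 \<noteq> 0" using k by (simp add: d_def)
      moreover have "d j \<noteq> 0"
      proof
        assume "d j = 0"
        then have "real k * (real k - 1 - 2 * real j) = 0" using k by (simp add: d_def field_simps)
        then have "real k - 1 = 2 * real j" using k by simp
        then show False using \<open>2 * j \<noteq> k - 1\<close> k by linarith
      qed
      ultimately show False by simp
    qed
  qed
  then show "\<forall>\<pi>\<in>{p, q, r}. a \<pi> = 0" using r_only by auto
qed

text \<open>The bounds on the orders keep out the small dependent families: [1,2] with [2,1] by
  \<open>length q \<ge> 3\<close>, and the cyclic shifts of [1,2,3] by
  \<open>length p \<ge> 4\<close>.\<close>

lemma pert_independent_three:
  assumes "is_perm p" "is_perm q" "is_perm r" "p \<noteq> q" "p \<noteq> r" "q \<noteq> r"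
    and len: "length p \<ge> length q" "length q \<ge> length r" "length r \<ge> 2" "length q \<ge> 3" "length p \<ge> 4"
  shows "pert_independent {p, q, r}"
proof -
  have ind_qr: "pert_independent {q, r}"
  proof (cases "length q = length r")
    case True
    then show ?thesis using assms by (intro pert_independent_same_length[of _ "length q"]) auto
  next
    case False
    have "pert_independent {r}" using assms by (intro pert_independent_same_length[of _ "length r"]) auto
    then show ?thesis using assms False by (intro pert_independent_insert[of "{r}" q]) auto
  qed
  consider "length p > length q" | "length p = length q" "length q > length r" | "length p = length r"
    using len by linarith
  then show ?thesis
  proof cases
    case 1
    then show ?thesis using assms ind_qr by (intro pert_independent_insert[of "{q, r}" p]) auto
  next
    case 2
    then show ?thesis using assms by (intro pert_independent_mixed[of _ "length p"]) auto
  next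
    case 3
    then have "length q = length p" using len by simp
    moreover have "card {p, q, r} = 3" using assms by simp
    ultimately show ?thesis using assms 3 by (intro pert_independent_same_length[of _ "length p"]) auto
  qed
qed

section \<open>Increasing sequences in the grid\<close>

definition inc :: "nat \<Rightarrow> nat \<Rightarrow> (nat \<Rightarrow> nat) set" where
  "inc k M = {u \<in> {..<k} \<rightarrow>\<^sub>E {..<M}. strict_mono_on {..<k} u}"

lemma finite_inc [simp]: "finite (inc k M)"
  by (simp add: inc_def finite_PiE)

text \<open>An occurrence in the full grid is determined by its sorted columns and its sorted rows,
  chosen independently, and \<pi> prescribes how to match them. This makes sums over occurrences
  factorise.\<close>

lemma bij_betw_inc_occs:
  assumes "is_perm \<pi>" "length \<pi> = k"
  shows "bij_betw (\<lambda>(u, v). restrict (\<lambda>l. (u l, v (\<pi> ! l - 1))) {..<k})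
           (inc k M \<times> inc k M) (occs \<pi> ({..<M} \<times> {..<M}) fst snd)"
proof (rule bij_betw_byWitness[where f' = "\<lambda>p. (restrict (\<lambda>l. fst (p l)) {..<k}, restrict (\<lambda>j. snd (p (pos \<pi> j))) {..<k})"])
  let ?f = "\<lambda>(u, v). restrict (\<lambda>l. (u l, v (\<pi> ! l - 1))) {..<k}"
  let ?g = "\<lambda>p. (restrict (\<lambda>l. fst (p l)) {..<k}, restrict (\<lambda>j. snd (p (pos \<pi> j))) {..<k})"
  have nth: "\<pi> ! l \<ge> 1" "\<pi> ! l - 1 < k" "pos \<pi> (\<pi> ! l - 1) = l" if "l < k" for l
    using perm_nth[OF assms(1), of l] pos_nth[OF assms(1), of l] that assms(2) by auto
  have pos: "pos \<pi> j < k" "\<pi> ! pos \<pi> j = Suc j" if "j < k" for j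
    using pos_less[OF assms(1)] nth_pos[OF assms(1)] that assms(2) by auto
  have rext: "restrict h {..<k} = h'" if "\<And>l. l < k \<Longrightarrow> h l = h' l" "h' \<in> {..<k} \<rightarrow>\<^sub>E B" for h h' :: "nat \<Rightarrow> 'b" and B
  proof
    fix l show "restrict h {..<k} l = h' l"
      using that(1)[of l] PiE_arb[OF that(2), of l] by (cases "l < k") simp_all
  qed
  show "\<forall>uv\<in>inc k M \<times> inc k M. ?g (?f uv) = uv"
  proof
    fix uv assume "uv \<in> inc k M \<times> inc k M"
    then obtain u v where uv: "uv = (u, v)" "u \<in> {..<k} \<rightarrow>\<^sub>E {..<M}" "v \<in> {..<k} \<rightarrow>\<^sub>E {..<M}"
      by (auto simp: inc_def)
    show "?g (?f uv) = uv"
      unfolding uv(1) using pos by (auto intro!: rext[OF _ uv(2)] rext[OF _ uv(3)])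
  qed
  show "\<forall>p\<in>occs \<pi> ({..<M} \<times> {..<M}) fst snd. ?f (?g p) = p"
  proof
    fix p assume "p \<in> occs \<pi> ({..<M} \<times> {..<M}) fst snd"
    then have p: "p \<in> {..<k} \<rightarrow>\<^sub>E {..<M} \<times> {..<M}" by (simp add: occs_def assms(2))
    show "?f (?g p) = p"
      using nth by (auto intro!: rext[OF _ p])
  qed
  show "?f ` (inc k M \<times> inc k M) \<subseteq> occs \<pi> ({..<M} \<times> {..<M}) fst snd"
  proof (rule image_subsetI)
    fix uv assume "uv \<in> inc k M \<times> inc k M"
    then obtain u v where uv: "uv = (u, v)" "u \<in> inc k M" "v \<in> inc k M" by auto
    then have mem: "u l < M" "v l < M" if "l < k" for l
      using that unfolding inc_def by (auto dest!: PiE_mem)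
    have lt: "u i < u j" "v i < v j" if "i < j" "j < k" for i j
      using uv that by (auto simp: inc_def strict_mono_on_def)
    have "is_occ \<pi> fst snd (?f uv)"
      unfolding is_occ_def
    proof (intro allI impI conjI)
      fix i j assume ij: "i < length \<pi>" "j < length \<pi>"
      show "fst (?f uv i) < fst (?f uv j)" if "i < j" using that ij lt assms(2) uv(1) by simp
      show "snd (?f uv i) < snd (?f uv j)" if "\<pi> ! i < \<pi> ! j"
        using that ij lt(2)[of "\<pi> ! i - 1" "\<pi> ! j - 1"] nth[of i] nth[of j] assms(2) uv(1) by auto
    qed
    moreover have "?f uv \<in> {..<k} \<rightarrow>\<^sub>E {..<M} \<times> {..<M}"
      using mem nth uv(1) by (simp add: PiE_iff)
    ultimately show "?f uv \<in> occs \<pi> ({..<M} \<times> {..<M}) fst snd" by (simp add: occs_def assms(2))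
  qed
  show "?g ` occs \<pi> ({..<M} \<times> {..<M}) fst snd \<subseteq> inc k M \<times> inc k M"
  proof (rule image_subsetI)
    fix p assume "p \<in> occs \<pi> ({..<M} \<times> {..<M}) fst snd"
    then have p: "p \<in> {..<k} \<rightarrow>\<^sub>E {..<M} \<times> {..<M}" "is_occ \<pi> fst snd p" by (auto simp: occs_def assms(2))
    have mem: "p l \<in> {..<M} \<times> {..<M}" if "l < k" for l using PiE_mem[OF p(1)] that by simp
    have lt: "fst (p i) < fst (p j)" if "i < j" "j < k" for i j
      using p(2) that assms(2) by (simp add: is_occ_def)
    have lt2: "snd (p (pos \<pi> i)) < snd (p (pos \<pi> j))" if "i < j" "j < k" for i j
      using p(2) that pos[of i] pos[of j] assms(2) unfolding is_occ_def
      by (metis Suc_less_eq order_less_trans)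
    have "fst (p l) < M" "snd (p l) < M" if "l < k" for l using mem[OF that] by auto
    then show "?g p \<in> inc k M \<times> inc k M"
      using lt lt2 pos by (simp add: inc_def strict_mono_on_def PiE_iff)
  qed
qed

lemma sum_occs_grid:
  assumes "is_perm \<pi>" "length \<pi> = k"
  shows "(\<Sum>p\<in>occs \<pi> ({..<M} \<times> {..<M}) fst snd. \<Phi> p)
       = (\<Sum>u\<in>inc k M. \<Sum>v\<in>inc k M. \<Phi> (restrict (\<lambda>l. (u l, v (\<pi> ! l - 1))) {..<k}))"
  using sum.reindex_bij_betw[OF bij_betw_inc_occs[OF assms, of M], of \<Phi>]
  by (simp add: sum.cartesian_product case_prod_unfold)

text \<open>An increasing sequence is recovered from its image, because the entry with index i is
  the one with exactly i smaller entries.\<close>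

lemma bij_betw_inc_subsets:
  "bij_betw (\<lambda>u. u ` {..<k}) (inc k M) {U. U \<subseteq> {..<M} \<and> card U = k}"
proof -
  have inj: "inj_on u {..<k}" if "u \<in> inc k M" for u
    using that by (simp add: inc_def strict_mono_on_imp_inj_on)
  have card_less: "card {j\<in>{..<k}. u j < u i} = i" if "u \<in> inc k M" "i < k" for u i
  proof -
    have "u j < u i \<longleftrightarrow> j < i" if "j < k" for j
      using \<open>u \<in> inc k M\<close> \<open>i < k\<close> that strict_mono_on_less[of "{..<k}" u j i] by (simp add: inc_def)
    then have "{j\<in>{..<k}. u j < u i} = {..<i}" using that by auto
    then show ?thesis by simp
  qed
  show ?thesis
    unfolding bij_betw_def
  proof (intro conjI inj_onI equalityI subsetI)
    fix u v assume u: "u \<in> inc k M" and v: "v \<in> inc k M" and eq: "u ` {..<k} = v ` {..<k}"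
    show "u = v"
    proof
      fix i show "u i = v i"
      proof (cases "i < k")
        case True
        then have "u i \<in> v ` {..<k}" unfolding eq[symmetric] by simp
        then obtain j where j: "j < k" "u i = v j" by auto
        have "card {x\<in>u ` {..<k}. x < u i} = card (u ` {j\<in>{..<k}. u j < u i})"
          by (rule arg_cong[of _ _ card]) auto
        also have "\<dots> = i"
          using card_less[OF u True] inj[OF u] by (subst card_image) (auto intro: inj_on_subset)
        finally have 1: "card {x\<in>u ` {..<k}. x < u i} = i" .
        have "card {x\<in>v ` {..<k}. x < v j} = card (v ` {i\<in>{..<k}. v i < v j})"
          by (rule arg_cong[of _ _ card]) auto
        also have "\<dots> = j"
          using card_less[OF v j(1)] inj[OF v] by (subst card_image) (auto intro: inj_on_subset)
        finally have "i = j" using 1 eq j(2) by simp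
        then show ?thesis using j by simp
      next
        case False
        then show ?thesis using u v PiE_arb[of u "{..<k}" "\<lambda>_. {..<M}" i] PiE_arb[of v "{..<k}" "\<lambda>_. {..<M}" i]
          by (simp add: inc_def)
      qed
    qed
  next
    fix U assume "U \<in> (\<lambda>u. u ` {..<k}) ` inc k M"
    then obtain u where u: "u \<in> inc k M" "U = u ` {..<k}" by blast
    then show "U \<in> {U. U \<subseteq> {..<M} \<and> card U = k}"
      using inj[OF u(1)] unfolding inc_def by (auto simp: card_image dest!: PiE_mem)
  next
    fix U assume "U \<in> {U. U \<subseteq> {..<M} \<and> card U = k}"
    then have U: "U \<subseteq> {..<M}" "card U = k" "finite U" using finite_subset by auto
    then obtain h where h: "bij_betw h {..<k} U" "strict_mono_on {..<k} h"
      using ex_bij_betw_strict_mono_card[of U] by auto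
    have hU: "h ` {..<k} = U" using h(1) by (simp add: bij_betw_def)
    have "restrict h {..<k} \<in> inc k M"
      using h(2) hU U(1) by (auto simp: inc_def strict_mono_on_def)
    moreover have "U = restrict h {..<k} ` {..<k}" using hU by simp
    ultimately show "U \<in> (\<lambda>u. u ` {..<k}) ` inc k M" by blast
  qed
qed

lemma card_inc: "card (inc k M) = M choose k"
  using bij_betw_same_card[OF bij_betw_inc_subsets[of k M]] n_subsets[of "{..<M}" k] by simp

lemma card_subsets_meeting:
  assumes "finite A" "finite B" "A \<inter> B = {}"
  shows "card {U. U \<subseteq> A \<union> B \<and> card U = k \<and> card (U \<inter> A) = r} = (if r \<le> k then (card A choose r) * (card B choose (k - r)) else 0)"
proof (cases "r \<le> k")
  case True
  have "bij_betw (\<lambda>(V, W). V \<union> W) ({V. V \<subseteq> A \<and> card V = r} \<times> {W. W \<subseteq> B \<and> card W = k - r})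
          {U. U \<subseteq> A \<union> B \<and> card U = k \<and> card (U \<inter> A) = r}"
  proof (rule bij_betw_byWitness[where f' = "\<lambda>U. (U \<inter> A, U \<inter> B)"])
    show "\<forall>a\<in>{V. V \<subseteq> A \<and> card V = r} \<times> {W. W \<subseteq> B \<and> card W = k - r}.
        (\<lambda>U. (U \<inter> A, U \<inter> B)) (case a of (V, W) \<Rightarrow> V \<union> W) = a"
      using assms(3) by auto
    show "\<forall>U\<in>{U. U \<subseteq> A \<union> B \<and> card U = k \<and> card (U \<inter> A) = r}. (case (U \<inter> A, U \<inter> B) of (V, W) \<Rightarrow> V \<union> W) = U"
      by auto
    show "(\<lambda>(V, W). V \<union> W) ` ({V. V \<subseteq> A \<and> card V = r} \<times> {W. W \<subseteq> B \<and> card W = k - r})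
        \<subseteq> {U. U \<subseteq> A \<union> B \<and> card U = k \<and> card (U \<inter> A) = r}"
    proof clarsimp
      fix V W assume VW: "V \<subseteq> A" "r = card V" "W \<subseteq> B" "card W = k - card V"
      have "finite V" "finite W" "V \<inter> W = {}" using VW assms finite_subset by blast+
      then have "card (V \<union> W) = k" using VW True by (simp add: card_Un_disjoint)
      moreover have "(V \<union> W) \<inter> A = V" using VW assms(3) by auto
      ultimately show "V \<subseteq> A \<union> B \<and> W \<subseteq> A \<union> B \<and> card (V \<union> W) = k \<and> card ((V \<union> W) \<inter> A) = card V"
        using VW by auto
    qed
    show "(\<lambda>U. (U \<inter> A, U \<inter> B)) ` {U. U \<subseteq> A \<union> B \<and> card U = k \<and> card (U \<inter> A) = r}
        \<subseteq> {V. V \<subseteq> A \<and> card V = r} \<times> {W. W \<subseteq> B \<and> card W = k - r}"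
    proof clarsimp
      fix U assume U: "U \<subseteq> A \<union> B"
      have "U = (U \<inter> A) \<union> (U \<inter> B)" "(U \<inter> A) \<inter> (U \<inter> B) = {}" using U assms by auto
      then have "card U = card (U \<inter> A) + card (U \<inter> B)"
        using assms by (metis card_Un_disjoint finite_Int)
      then show "card (U \<inter> B) = card U - card (U \<inter> A)" by simp
    qed
  qed
  then show ?thesis
    using True assms bij_betw_same_card n_subsets[of A r] n_subsets[of B "k - r"]
    by (fastforce simp: card_cartesian_product)
next
  case False
  have "card (U \<inter> A) \<le> card U" if "U \<subseteq> A \<union> B" for U
    using that assms finite_subset[of U "A \<union> B"] by (intro card_mono) auto
  then have "{U. U \<subseteq> A \<union> B \<and> card U = k \<and> card (U \<inter> A) = r} = {}" using False by auto
  then show ?thesis using False by (simp only: card.empty if_False)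
qed

text \<open>The entry with index l is below X if and only if more than l entries are. Splitting by
  their number r gives a hypergeometric tail, the discrete form of \<open>btail\<close>.\<close>

lemma card_inc_below:
  assumes "l < k" "X \<le> M"
  shows "card {u\<in>inc k M. u l < X} = (\<Sum>r\<in>{l<..k}. (X choose r) * ((M - X) choose (k - r)))"
proof -
  have iff: "u l < X \<longleftrightarrow> l < card (u ` {..<k} \<inter> {..<X})" if u: "u \<in> inc k M" for u
  proof
    have inj: "inj_on u {..<k}" using u by (simp add: inc_def strict_mono_on_imp_inj_on)
    have less: "u i < u j \<longleftrightarrow> i < j" if "i < k" "j < k" for i j
      using u that strict_mono_on_less[of "{..<k}" u i j] by (simp add: inc_def)
    { assume "u l < X"
      have "u i < X" if "i \<le> l" for i
        using less[of i l] assms(1) that \<open>u l < X\<close> by (cases "i = l") auto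
      then have "u ` {..l} \<subseteq> u ` {..<k} \<inter> {..<X}" using assms(1) by auto
      then have "card (u ` {..l}) \<le> card (u ` {..<k} \<inter> {..<X})" by (intro card_mono) auto
      moreover have "inj_on u {..l}" using inj assms(1) by (auto intro: inj_on_subset)
      ultimately show "l < card (u ` {..<k} \<inter> {..<X})" by (simp add: card_image) }
    { assume l: "l < card (u ` {..<k} \<inter> {..<X})"
      show "u l < X"
      proof (rule ccontr)
        assume "\<not> u l < X"
        have "i < l" if "i < k" "u i < X" for i
          using less[OF that(1) assms(1)] that \<open>\<not> u l < X\<close> by auto
        then have "u ` {..<k} \<inter> {..<X} \<subseteq> u ` {..<l}" by auto
        then have "card (u ` {..<k} \<inter> {..<X}) \<le> card (u ` {..<l})" by (intro card_mono) auto
        also have "\<dots> \<le> l" using card_image_le[of "{..<l}" u] by simp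
        finally show False using l by simp
      qed }
  qed
  let ?S = "\<lambda>r. {U. U \<subseteq> {..<X} \<union> {X..<M} \<and> card U = k \<and> card (U \<inter> {..<X}) = r}"
  have un: "{..<X} \<union> {X..<M} = {..<M}" using assms(2) by auto
  have "bij_betw (\<lambda>u. u ` {..<k}) {u\<in>inc k M. u l < X} {U\<in>{U. U \<subseteq> {..<M} \<and> card U = k}. l < card (U \<inter> {..<X})}"
  proof (rule bij_betw_subset[OF bij_betw_inc_subsets[of k M], rotated])
    show "(\<lambda>u. u ` {..<k}) ` {u \<in> inc k M. u l < X} = {U \<in> {U. U \<subseteq> {..<M} \<and> card U = k}. l < card (U \<inter> {..<X})}"
      (is "?f ` _ = {U \<in> ?P. _}")
    proof -
      have im: "?f ` inc k M = ?P" using bij_betw_inc_subsets[of k M] by (simp add: bij_betw_def)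
      show ?thesis
      proof (intro equalityI subsetI)
        fix U assume "U \<in> ?f ` {u \<in> inc k M. u l < X}"
        then obtain u where u: "u \<in> inc k M" "u l < X" "U = ?f u" by blast
        have "U \<in> ?f ` inc k M" using u by simp
        then have "U \<in> ?P" unfolding im .
        then show "U \<in> {U \<in> ?P. l < card (U \<inter> {..<X})}" using iff[OF u(1)] u(2,3) by simp
      next
        fix U assume U: "U \<in> {U \<in> ?P. l < card (U \<inter> {..<X})}"
        then have "U \<in> ?f ` inc k M" unfolding im by simp
        then obtain u where u: "u \<in> inc k M" "U = ?f u" by blast
        then have "u l < X" using iff[OF u(1)] U by simp
        then show "U \<in> ?f ` {u \<in> inc k M. u l < X}" using u by blast
      qed
    qed
  qed auto
  then have "card {u\<in>inc k M. u l < X} = card {U\<in>{U. U \<subseteq> {..<M} \<and> card U = k}. l < card (U \<inter> {..<X})}"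
    by (rule bij_betw_same_card)
  also have "{U\<in>{U. U \<subseteq> {..<M} \<and> card U = k}. l < card (U \<inter> {..<X})} = (\<Union>r\<in>{l<..k}. ?S r)"
  proof -
    have "card (U \<inter> {..<X}) \<le> card U" if "U \<subseteq> {..<M}" for U
      using that finite_subset[of U "{..<M}"] by (intro card_mono) auto
    then show ?thesis unfolding un by auto
  qed
  also have "card \<dots> = (\<Sum>r\<in>{l<..k}. card (?S r))"
  proof (rule card_UN_disjoint)
    show "\<forall>r\<in>{l<..k}. finite (?S r)"
      unfolding un by (auto intro: finite_subset[of _ "Pow {..<M}"])
  qed auto
  also have "\<dots> = (\<Sum>r\<in>{l<..k}. (X choose r) * ((M - X) choose (k - r)))"
    by (intro sum.cong refl, subst card_subsets_meeting) auto
  finally show ?thesis .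
qed

section \<open>Asymptotics of the counts\<close>

text \<open>The scale D is left general because it is M for coordinates of the grid and M^3 for the
  number of points of the final permutations.\<close>

lemma tendsto_binomial_scaled:
  assumes D: "filterlim D at_top F" and n: "((\<lambda>i. real (n i) / D i) \<longlongrightarrow> x) F"
  shows "((\<lambda>i. real (n i choose k) / D i ^ k) \<longlongrightarrow> x ^ k / fact k) F"
proof -
  have inv: "((\<lambda>i. real j / D i) \<longlongrightarrow> 0) F" for j
    by (rule tendsto_divide_0[OF tendsto_const filterlim_at_top_imp_at_infinity[OF D]])
  have "((\<lambda>i. (\<Prod>j=0..<k. real (n i) / D i - real j / D i) / fact k) \<longlongrightarrow> (\<Prod>j=0..<k. x - 0) / fact k) F"
    by (intro tendsto_intros n inv) simp
  also have "(\<lambda>i. (\<Prod>j=0..<k. real (n i) / D i - real j / D i) / fact k) = (\<lambda>i. real (n i choose k) / D i ^ k)"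
    by (simp add: binomial_gbinomial gbinomial_prod_rev prod_dividef mult.commute flip: diff_divide_distrib)
  finally show ?thesis by simp
qed

lemma tendsto_floor_scaled:
  assumes "0 \<le> x" shows "(\<lambda>M. real (nat \<lfloor>x * real M\<rfloor>) / real M) \<longlonglongrightarrow> x"
proof (rule real_tendsto_sandwich)
  show "\<forall>\<^sub>F M in sequentially. x - 1 / real M \<le> real (nat \<lfloor>x * real M\<rfloor>) / real M"
  proof (rule eventually_mono[OF eventually_gt_at_top[of 0]])
    fix M :: nat assume "0 < M"
    have "x * real M - 1 \<le> real (nat \<lfloor>x * real M\<rfloor>)" by linarith
    then have "(x * real M - 1) / real M \<le> real (nat \<lfloor>x * real M\<rfloor>) / real M" by (rule divide_right_mono) simp
    then show "x - 1 / real M \<le> real (nat \<lfloor>x * real M\<rfloor>) / real M" using \<open>0 < M\<close> by (simp add: diff_divide_distrib)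
  qed
  show "\<forall>\<^sub>F M in sequentially. real (nat \<lfloor>x * real M\<rfloor>) / real M \<le> x"
  proof (rule eventually_mono[OF eventually_gt_at_top[of 0]])
    fix M :: nat assume "0 < M"
    have "real (nat \<lfloor>x * real M\<rfloor>) \<le> x * real M" using assms by (simp add: of_nat_nat)
    then show "real (nat \<lfloor>x * real M\<rfloor>) / real M \<le> x" using \<open>0 < M\<close> by (simp add: divide_le_eq)
  qed
  show "(\<lambda>M. x - 1 / real M) \<longlonglongrightarrow> x"
    using tendsto_diff[OF tendsto_const lim_1_over_n, of x] by simp
qed simp

text \<open>The hypergeometric tail tends to the binomial one, term by term; the factor 1 / k! is
  that of the number of increasing sequences.\<close>

lemma tendsto_card_inc_below:
  assumes x: "0 \<le> x" "x \<le> 1" and "l < k"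
  shows "(\<lambda>M. real (card {u\<in>inc k M. u l < nat \<lfloor>x * real M\<rfloor>}) / real M ^ k) \<longlonglongrightarrow> btail k l x / fact k"
proof -
  define X where "X M = nat \<lfloor>x * real M\<rfloor>" for M :: nat
  have XM: "X M \<le> M" for M
  proof -
    have "x * real M \<le> real M" using x mult_right_mono[of x 1 "real M"] by simp
    then show ?thesis unfolding X_def by linarith
  qed
  have lim: "filterlim real at_top sequentially" by (rule filterlim_real_sequentially)
  have X1: "(\<lambda>M. real (X M) / real M) \<longlonglongrightarrow> x" unfolding X_def by (rule tendsto_floor_scaled[OF x(1)])
  have "\<forall>\<^sub>F M in sequentially. 1 - real (X M) / real M = real (M - X M) / real M"
    by (rule eventually_mono[OF eventually_gt_at_top[of 0]]) (use XM in \<open>simp add: of_nat_diff diff_divide_distrib\<close>)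
  with tendsto_diff[OF tendsto_const[of 1] X1] have X2: "(\<lambda>M. real (M - X M) / real M) \<longlonglongrightarrow> 1 - x"
    by (rule Lim_transform_eventually)
  have "(\<lambda>M. \<Sum>r\<in>{l<..k}. (real (X M choose r) / real M ^ r) * (real ((M - X M) choose (k - r)) / real M ^ (k - r)))
      \<longlonglongrightarrow> (\<Sum>r\<in>{l<..k}. (x ^ r / fact r) * ((1 - x) ^ (k - r) / fact (k - r)))"
    by (intro tendsto_intros tendsto_binomial_scaled[OF lim] X1 X2)
  also have "(\<lambda>M. \<Sum>r\<in>{l<..k}. (real (X M choose r) / real M ^ r) * (real ((M - X M) choose (k - r)) / real M ^ (k - r)))
      = (\<lambda>M. real (card {u\<in>inc k M. u l < X M}) / real M ^ k)"
  proof
    fix M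
    show "(\<Sum>r\<in>{l<..k}. (real (X M choose r) / real M ^ r) * (real ((M - X M) choose (k - r)) / real M ^ (k - r)))
      = real (card {u\<in>inc k M. u l < X M}) / real M ^ k"
      unfolding card_inc_below[OF \<open>l < k\<close> XM] of_nat_sum sum_divide_distrib
      by (intro sum.cong refl) (simp flip: power_add)
  qed
  also have "(\<Sum>r\<in>{l<..k}. (x ^ r / fact r) * ((1 - x) ^ (k - r) / fact (k - r))) = btail k l x / fact k"
    unfolding btail_def Bernstein_def sum_divide_distrib
    by (intro sum.cong refl) (simp add: binomial_fact)
  finally show ?thesis unfolding X_def .
qed

section \<open>Perturbing the uniform weight on a grid\<close>

abbreviation grid :: "nat \<Rightarrow> (nat \<times> nat) set" where
  "grid M \<equiv> {..<M} \<times> {..<M}"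

text \<open>For total weight M^2 there are about M^(2k) / k! weighted choices of k points. Hence k!
  \<open>weight\<close> / M^(2k) stands for the density; for constant weight 1 it tends to 1 /
  k!.\<close>

definition weight :: "nat list \<Rightarrow> nat \<Rightarrow> (nat \<times> nat \<Rightarrow> real) \<Rightarrow> real" where
  "weight \<pi> M f = (\<Sum>p\<in>occs \<pi> (grid M) fst snd. \<Prod>l<length \<pi>. f (p l))"

text \<open>The derivative of \<open>weight\<close> at the constant weight 1 in direction g.\<close>

definition weight_lin :: "nat list \<Rightarrow> nat \<Rightarrow> (nat \<times> nat \<Rightarrow> real) \<Rightarrow> real" where
  "weight_lin \<pi> M g = (\<Sum>p\<in>occs \<pi> (grid M) fst snd. \<Sum>l<length \<pi>. g (p l))"

lemma card_occs_grid: "is_perm \<pi> \<Longrightarrow> card (occs \<pi> (grid M) fst snd) = (M choose length \<pi>) ^ 2"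
  using bij_betw_same_card[OF bij_betw_inc_occs[of \<pi> "length \<pi>" M]]
  by (simp add: card_cartesian_product card_inc power2_eq_square)

lemma card_occs_grid_le:
  assumes "is_perm \<pi>" shows "real (card (occs \<pi> (grid M) fst snd)) \<le> real M ^ (2 * length \<pi>)"
proof -
  have "(M choose length \<pi>) \<le> M ^ length \<pi>"
    by (metis binomial_eq_0 binomial_le_pow not_le zero_le)
  then have "real (M choose length \<pi>) ^ 2 \<le> (real M ^ length \<pi>) ^ 2"
    by (intro power_mono) (simp_all flip: of_nat_power)
  then show ?thesis by (simp add: card_occs_grid[OF assms] power_mult[symmetric] mult.commute)
qed

lemma occs_grid_mem:
  assumes "p \<in> occs \<pi> (grid M) fst snd" "l < length \<pi>" shows "p l \<in> grid M"
  using assms unfolding occs_def by (auto dest!: PiE_mem)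

lemma weight_lin_linear:
  "weight_lin \<pi> M (\<lambda>z. g z + h z) = weight_lin \<pi> M g + weight_lin \<pi> M h"
  "weight_lin \<pi> M (\<lambda>z. c * g z) = c * weight_lin \<pi> M g"
  "weight_lin \<pi> M (\<lambda>z. 0) = 0"
  by (simp_all add: weight_lin_def sum.distrib sum_distrib_left)

lemma weight_lin_sum:
  "finite A \<Longrightarrow> weight_lin \<pi> M (\<lambda>z. \<Sum>t\<in>A. g t z) = (\<Sum>t\<in>A. weight_lin \<pi> M (g t))"
  by (induction A rule: finite_induct) (simp_all add: weight_lin_linear)

text \<open>The induction multiplies the old error by at most 2 and adds k s^2, so the crude
  constant 3^k suffices because k \<le> 3^k.\<close>

lemma prod_one_plus_approx:
  fixes x :: "nat \<Rightarrow> real"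
  assumes "\<And>l. l < k \<Longrightarrow> \<bar>x l\<bar> \<le> s" "0 \<le> s" "s \<le> 1"
  shows "\<bar>(\<Prod>l<k. 1 + x l) - 1 - (\<Sum>l<k. x l)\<bar> \<le> 3 ^ k * s\<^sup>2"
  using assms(1)
proof (induction k)
  case (Suc k)
  let ?P = "\<Prod>l<k. 1 + x l" and ?S = "\<Sum>l<k. x l"
  have IH: "\<bar>?P - 1 - ?S\<bar> \<le> 3 ^ k * s\<^sup>2" using Suc by simp
  have xk: "\<bar>x k\<bar> \<le> s" using Suc.prems by simp
  have S: "\<bar>?S\<bar> \<le> real k * s"
  proof -
    have "(\<Sum>l<k. \<bar>x l\<bar>) \<le> (\<Sum>l<k. s)" using Suc.prems by (intro sum_mono) simp
    then have "(\<Sum>l<k. \<bar>x l\<bar>) \<le> real k * s" by simp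
    then show ?thesis by (rule order.trans[OF sum_abs])
  qed
  have "(\<Prod>l<Suc k. 1 + x l) - 1 - (\<Sum>l<Suc k. x l) = (?P - 1 - ?S) * (1 + x k) + x k * ?S"
    by (simp add: algebra_simps)
  also have "\<bar>\<dots>\<bar> \<le> \<bar>?P - 1 - ?S\<bar> * \<bar>1 + x k\<bar> + \<bar>x k\<bar> * \<bar>?S\<bar>"
    using abs_triangle_ineq[of "(?P - 1 - ?S) * (1 + x k)" "x k * ?S"] by (simp add: abs_mult)
  also have "\<dots> \<le> (3 ^ k * s\<^sup>2) * 2 + s * (real k * s)"
    using IH xk S assms(2,3) by (intro add_mono mult_mono) auto
  also have "\<dots> = (2 * 3 ^ k + real k) * s\<^sup>2" by (simp add: power2_eq_square algebra_simps)
  also have "\<dots> \<le> 3 ^ Suc k * s\<^sup>2"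
  proof (rule mult_right_mono)
    have "real k \<le> 3 ^ k" using of_nat_less_two_power[of k, where 'a = real] power_mono[of "2::real" 3 k] by linarith
    then show "2 * 3 ^ k + real k \<le> 3 ^ Suc k" by simp
  qed simp
  finally show ?case .
qed simp

lemma weight_approx:
  assumes \<pi>: "is_perm \<pi>" and h: "\<And>z. z \<in> grid M \<Longrightarrow> \<bar>h z\<bar> \<le> s" and s: "0 \<le> s" "s \<le> 1"
  shows "\<bar>weight \<pi> M (\<lambda>z. 1 + h z) - real (M choose length \<pi>) ^ 2 - weight_lin \<pi> M h\<bar>
    \<le> real M ^ (2 * length \<pi>) * (3 ^ length \<pi> * s\<^sup>2)"
proof -
  let ?O = "occs \<pi> (grid M) fst snd" and ?k = "length \<pi>"
  have "weight \<pi> M (\<lambda>z. 1 + h z) - real (M choose ?k) ^ 2 - weight_lin \<pi> M h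
      = (\<Sum>p\<in>?O. (\<Prod>l<?k. 1 + h (p l)) - 1 - (\<Sum>l<?k. h (p l)))"
    using card_occs_grid[OF \<pi>, of M] by (simp add: weight_def weight_lin_def sum_subtractf)
  also have "\<bar>\<dots>\<bar> \<le> (\<Sum>p\<in>?O. \<bar>(\<Prod>l<?k. 1 + h (p l)) - 1 - (\<Sum>l<?k. h (p l))\<bar>)"
    by (rule sum_abs)
  also have "\<dots> \<le> (\<Sum>p\<in>?O. 3 ^ ?k * s\<^sup>2)"
    by (intro sum_mono prod_one_plus_approx s h occs_grid_mem)
  also have "\<dots> = real (card ?O) * (3 ^ ?k * s\<^sup>2)" by simp
  also have "\<dots> \<le> real M ^ (2 * ?k) * (3 ^ ?k * s\<^sup>2)"
    by (intro mult_right_mono card_occs_grid_le \<pi>) simp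
  finally show ?thesis .
qed

text \<open>The indicator of [0,x] times [0,y] on the grid with both factors centred, so that moving
  along it preserves the total weight.\<close>

definition bump :: "real \<Rightarrow> real \<Rightarrow> nat \<Rightarrow> nat \<times> nat \<Rightarrow> real" where
  "bump x y M z = (of_bool (fst z < nat \<lfloor>x * real M\<rfloor>) - real (nat \<lfloor>x * real M\<rfloor>) / real M)
               * (of_bool (snd z < nat \<lfloor>y * real M\<rfloor>) - real (nat \<lfloor>y * real M\<rfloor>) / real M)"

lemma floor_scaled_le:
  assumes "0 \<le> x" "x \<le> 1" shows "nat \<lfloor>x * real M\<rfloor> \<le> M"
proof -
  have "x * real M \<le> real M" using assms mult_right_mono[of x 1 "real M"] by simp
  then show ?thesis by linarith
qed

lemma abs_bump_le:
  assumes "0 \<le> x" "x \<le> 1" "0 \<le> y" "y \<le> 1" shows "\<bar>bump x y M z\<bar> \<le> 1"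
proof -
  have r: "0 \<le> real (nat \<lfloor>x * real M\<rfloor>) / real M" "real (nat \<lfloor>x * real M\<rfloor>) / real M \<le> 1"
    if "0 \<le> x" "x \<le> 1" for x
    using floor_scaled_le[OF that, of M] by (auto simp: divide_le_eq_1)
  have "\<bar>of_bool b - t\<bar> \<le> 1" if "0 \<le> t" "t \<le> 1" for b and t :: real using that by auto
  then have "\<bar>of_bool b - real (nat \<lfloor>x * real M\<rfloor>) / real M\<bar> \<le> 1" if "0 \<le> x" "x \<le> 1" for b x
    using r that by blast
  then have "\<bar>bump x y M z\<bar> \<le> 1 * 1"
    unfolding bump_def abs_mult using assms by (intro mult_mono) auto
  then show ?thesis by simp
qed

lemma sum_bump:
  assumes "0 \<le> x" "x \<le> 1" shows "(\<Sum>z\<in>grid M. bump x y M z) = 0"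
proof (cases "M = 0")
  case False
  let ?X = "nat \<lfloor>x * real M\<rfloor>"
  have "(\<Sum>i<M. of_bool (i < ?X)) = real ?X"
  proof -
    have "{i\<in>{..<M}. i < ?X} = {..<?X}" using floor_scaled_le[OF assms, of M] by auto
    then show ?thesis by (simp add: of_bool_def sum.inter_filter[symmetric])
  qed
  then have 0: "(\<Sum>i<M. of_bool (i < ?X) - real ?X / real M) = 0" using False by (simp add: sum_subtractf)
  have "(\<Sum>z\<in>grid M. bump x y M z) = (\<Sum>i<M. of_bool (i < ?X) - real ?X / real M)
      * (\<Sum>j<M. of_bool (j < nat \<lfloor>y * real M\<rfloor>) - real (nat \<lfloor>y * real M\<rfloor>) / real M)"
    unfolding sum_product sum.cartesian_product bump_def by (simp add: case_prod_unfold)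
  then show ?thesis using 0 by simp
qed simp

text \<open>The indicator contributes the tail and the centring contributes - x for each of the
  about M^k / k! sequences.\<close>

lemma tendsto_bump_marginal:
  assumes x: "0 \<le> x" "x \<le> 1" and "l < k"
  shows "(\<lambda>M. (\<Sum>u\<in>inc k M. of_bool (u l < nat \<lfloor>x * real M\<rfloor>) - real (nat \<lfloor>x * real M\<rfloor>) / real M) / real M ^ k)
    \<longlonglongrightarrow> (btail k l x - x) / fact k"
proof -
  let ?X = "\<lambda>M. nat \<lfloor>x * real M\<rfloor>"
  have one: "(\<lambda>M. real M / real M) \<longlonglongrightarrow> 1"
    by (rule Lim_transform_eventually[OF tendsto_const])
       (auto intro: eventually_mono[OF eventually_gt_at_top[of 0]])
  have "(\<lambda>M. real (card {u\<in>inc k M. u l < ?X M}) / real M ^ k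
        - real (?X M) / real M * (real (M choose k) / real M ^ k))
      \<longlonglongrightarrow> btail k l x / fact k - x * (1 ^ k / fact k)"
    by (intro tendsto_intros tendsto_card_inc_below assms tendsto_floor_scaled
        tendsto_binomial_scaled filterlim_real_sequentially one)
  also have "(\<lambda>M. real (card {u\<in>inc k M. u l < ?X M}) / real M ^ k
        - real (?X M) / real M * (real (M choose k) / real M ^ k))
     = (\<lambda>M. (\<Sum>u\<in>inc k M. of_bool (u l < ?X M) - real (?X M) / real M) / real M ^ k)"
    by (simp add: sum_subtractf card_inc of_bool_def sum.inter_filter[symmetric] diff_divide_distrib fun_eq_iff)
  finally show ?thesis by (simp add: diff_divide_distrib)
qed

text \<open>The sum over occurrences factorises into a column part and a row part. Expanding the
  centred product, the two mixed terms give - k x y each and the constant term + k x y, which leaves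
  the - k x y of \<open>pert\<close>.\<close>

lemma tendsto_weight_lin_bump:
  assumes \<pi>: "is_perm \<pi>" "length \<pi> = k" and x: "0 \<le> x" "x \<le> 1" and y: "0 \<le> y" "y \<le> 1"
  shows "(\<lambda>M. fact k * weight_lin \<pi> M (bump x y M) / real M ^ (2 * k)) \<longlonglongrightarrow> pert \<pi> x y / fact k"
proof -
  define A where "A x M l = (\<Sum>u\<in>inc k M. of_bool (u l < nat \<lfloor>x * real M\<rfloor>) - real (nat \<lfloor>x * real M\<rfloor>) / real M)"
    for x M l
  have lin: "weight_lin \<pi> M (bump x y M) = (\<Sum>l<k. A x M l * A y M (\<pi> ! l - 1))" for M
  proof -
    have "weight_lin \<pi> M (bump x y M) = (\<Sum>u\<in>inc k M. \<Sum>v\<in>inc k M. \<Sum>l<k. bump x y M (u l, v (\<pi> ! l - 1)))"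
      unfolding weight_lin_def sum_occs_grid[OF \<pi>] using \<pi>(2) by (intro sum.cong refl) auto
    also have "\<dots> = (\<Sum>u\<in>inc k M. \<Sum>l<k. \<Sum>v\<in>inc k M. bump x y M (u l, v (\<pi> ! l - 1)))"
      by (intro sum.cong refl sum.swap)
    also have "\<dots> = (\<Sum>l<k. \<Sum>u\<in>inc k M. \<Sum>v\<in>inc k M. bump x y M (u l, v (\<pi> ! l - 1)))"
      by (rule sum.swap)
    also have "\<dots> = (\<Sum>l<k. A x M l * A y M (\<pi> ! l - 1))"
      unfolding A_def sum_product bump_def by simp
    finally show ?thesis .
  qed
  have idx: "\<pi> ! l - 1 < k" if "l < k" for l using perm_nth[OF \<pi>(1), of l] \<pi>(2) that by auto
  have A: "(\<lambda>M. A x M l / real M ^ k) \<longlonglongrightarrow> (btail k l x - x) / fact k" if "0 \<le> x" "x \<le> 1" "l < k" for x l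
    unfolding A_def by (rule tendsto_bump_marginal[OF that])
  have "(\<lambda>M. fact k * (\<Sum>l<k. (A x M l / real M ^ k) * (A y M (\<pi> ! l - 1) / real M ^ k)))
      \<longlonglongrightarrow> fact k * (\<Sum>l<k. ((btail k l x - x) / fact k) * ((btail k (\<pi> ! l - 1) y - y) / fact k))"
    by (intro tendsto_intros A x y idx) auto
  also have "(\<lambda>M. fact k * (\<Sum>l<k. (A x M l / real M ^ k) * (A y M (\<pi> ! l - 1) / real M ^ k)))
      = (\<lambda>M. fact k * weight_lin \<pi> M (bump x y M) / real M ^ (2 * k))"
    unfolding lin sum_distrib_left sum_divide_distrib by (simp add: power_add mult_2 fun_eq_iff)
  also have "fact k * (\<Sum>l<k. ((btail k l x - x) / fact k) * ((btail k (\<pi> ! l - 1) y - y) / fact k))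
      = (\<Sum>l<k. (btail k l x - x) * (btail k (\<pi> ! l - 1) y - y)) / fact k"
    by (simp add: sum_distrib_left sum_divide_distrib)
  also have "(\<Sum>l<k. (btail k l x - x) * (btail k (\<pi> ! l - 1) y - y)) = pert \<pi> x y"
  proof -
    have s: "(\<Sum>l<k. btail k (\<pi> ! l - 1) y) = real k * y"
      using sum.reindex_bij_betw[OF bij_betw_perm[OF \<pi>(1)], of "\<lambda>j. btail k j y"] \<pi>(2) sum_btail[where k = k and x = y]
      by simp
    have "(\<Sum>l<k. (btail k l x - x) * (btail k (\<pi> ! l - 1) y - y))
        = (\<Sum>l<k. btail k l x * btail k (\<pi> ! l - 1) y) - y * (\<Sum>l<k. btail k l x)
          - x * (\<Sum>l<k. btail k (\<pi> ! l - 1) y) + real k * x * y"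
      by (simp add: left_diff_distrib right_diff_distrib sum_subtractf sum.distrib sum_distrib_left mult.commute mult.left_commute)
    also have "\<dots> = pert \<pi> x y" unfolding s sum_btail pert_def \<pi>(2) by (simp add: algebra_simps)
    finally show ?thesis .
  qed
  finally show ?thesis .
qed

section \<open>Solving for prescribed densities\<close>

text \<open>The limiting first-order density changes along directions that may vary with M.
  Requiring them to be bounded and of total 0 is stable under linear combinations, and it is what
  later keeps the weights near 1 and their total at M^2.\<close>

definition realizable :: "('n::finite \<Rightarrow> nat list) \<Rightarrow> (real ^ 'n) set" where
  "realizable p = {v. \<exists>G. (\<exists>B. \<forall>M z. \<bar>G M z\<bar> \<le> B) \<and> (\<forall>M. (\<Sum>z\<in>grid M. G M z) = 0) \<and>
     (\<forall>s. (\<lambda>M. fact (length (p s)) * weight_lin (p s) M (G M) / real M ^ (2 * length (p s))) \<longlonglongrightarrow> v $ s)}"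

lemma subspace_realizable: "subspace (realizable p)"
  unfolding subspace_def
proof (intro conjI ballI allI)
  show "0 \<in> realizable p"
    unfolding realizable_def
    by (intro CollectI exI[of _ "\<lambda>_ _. 0"]) (auto simp: weight_lin_linear)
  fix v assume "v \<in> realizable p"
  then obtain G B where G: "\<And>M z. \<bar>G M z\<bar> \<le> B" "\<And>M. (\<Sum>z\<in>grid M. G M z) = 0"
    "\<And>s. (\<lambda>M. fact (length (p s)) * weight_lin (p s) M (G M) / real M ^ (2 * length (p s))) \<longlonglongrightarrow> v $ s"
    by (auto simp: realizable_def)
  { fix c :: real
    have "\<bar>c * G M z\<bar> \<le> \<bar>c\<bar> * B" for M z using G(1) by (simp add: abs_mult mult_left_mono)
    moreover have "(\<Sum>z\<in>grid M. c * G M z) = 0" for M using G(2) by (simp flip: sum_distrib_left)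
    moreover have "(\<lambda>M. fact (length (p s)) * weight_lin (p s) M (\<lambda>z. c * G M z) / real M ^ (2 * length (p s)))
        \<longlonglongrightarrow> (c *\<^sub>R v) $ s" for s
      using tendsto_mult_left[OF G(3)[of s], of c] by (simp add: weight_lin_linear mult.left_commute)
    ultimately show "c *\<^sub>R v \<in> realizable p"
      unfolding realizable_def by (intro CollectI exI[of _ "\<lambda>M z. c * G M z"]) blast }
  fix w assume "w \<in> realizable p"
  then obtain H C where H: "\<And>M z. \<bar>H M z\<bar> \<le> C" "\<And>M. (\<Sum>z\<in>grid M. H M z) = 0"
    "\<And>s. (\<lambda>M. fact (length (p s)) * weight_lin (p s) M (H M) / real M ^ (2 * length (p s))) \<longlonglongrightarrow> w $ s"
    by (auto simp: realizable_def)
  have "\<bar>G M z + H M z\<bar> \<le> B + C" for M z using G(1)[of M z] H(1)[of M z] by linarith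
  moreover have "(\<Sum>z\<in>grid M. G M z + H M z) = 0" for M using G(2) H(2) by (simp add: sum.distrib)
  moreover have "(\<lambda>M. fact (length (p s)) * weight_lin (p s) M (\<lambda>z. G M z + H M z) / real M ^ (2 * length (p s)))
      \<longlonglongrightarrow> (v + w) $ s" for s
    using tendsto_add[OF G(3)[of s] H(3)[of s]] by (simp add: weight_lin_linear distrib_left add_divide_distrib)
  ultimately show "v + w \<in> realizable p"
    unfolding realizable_def by (intro CollectI exI[of _ "\<lambda>M z. G M z + H M z"]) blast
qed

text \<open>A proper subspace has a nonzero normal vector. Orthogonality to the changes caused by
  every \<open>bump x y\<close> is a linear relation between the functions \<open>pert\<close>,
  after absorbing the factorials into the coefficients.\<close>

lemma realizable_UNIV:
  fixes p :: "'n::finite \<Rightarrow> nat list"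
  assumes p: "\<And>s. is_perm (p s)" "inj p" and ind: "pert_independent (range p)"
  shows "realizable p = UNIV"
proof (rule ccontr)
  assume "realizable p \<noteq> UNIV"
  have sp: "span (realizable p) = realizable p" using subspace_realizable by simp
  then have "dim (realizable p) < DIM(real ^ 'n)"
    using \<open>realizable p \<noteq> UNIV\<close> dim_eq_full[of "realizable p"] dim_subset_UNIV[of "realizable p"]
    unfolding sp by (simp add: order_less_le)
  then obtain \<alpha> where \<alpha>: "\<alpha> \<noteq> 0" "\<And>v. v \<in> realizable p \<Longrightarrow> orthogonal \<alpha> v"
    using orthogonal_to_subspace_exists[of "realizable p"] sp by metis
  have "(\<Sum>s\<in>UNIV. \<alpha> $ s * (pert (p s) x y / fact (length (p s)))) = 0" if "0 < x" "x < 1" "0 < y" "y < 1" for x y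
  proof -
    have "(\<chi> s. pert (p s) x y / fact (length (p s))) \<in> realizable p"
      unfolding realizable_def
      using that abs_bump_le[of x y] sum_bump[of x] tendsto_weight_lin_bump[OF p(1) refl, of x y]
      by (intro CollectI exI[of _ "bump x y"]) auto
    from \<alpha>(2)[OF this] show ?thesis by (simp add: orthogonal_def inner_vec_def)
  qed
  moreover define a where "a \<pi> = \<alpha> $ (inv p \<pi>) / fact (length \<pi>)" for \<pi>
  ultimately have "\<forall>x\<in>{0<..<1}. \<forall>y\<in>{0<..<1}. (\<Sum>\<pi>\<in>range p. a \<pi> * pert \<pi> x y) = 0"
    using p(2) by (simp add: sum.reindex inv_f_f)
  then have "\<forall>\<pi>\<in>range p. a \<pi> = 0" using ind unfolding pert_independent_def by blast
  then have "\<alpha> $ s = 0" for s using p(2) by (simp add: a_def inv_f_f)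
  then show False using \<alpha>(1) by (simp add: vec_eq_iff)
qed

text \<open>Inverse function theorem at the uniform weight, uniformly in the grid size, by Brouwer's theorem.\<close>

lemma ex_weights_with_prescribed_densities:
  fixes p :: "'n::finite \<Rightarrow> nat list"
  assumes p: "\<And>s. is_perm (p s)" "inj p" and ind: "pert_independent (range p)"
  obtains \<delta> where "\<delta> > 0" "\<And>t :: real ^ 'n. (\<And>s. \<bar>t $ s\<bar> \<le> \<delta>) \<Longrightarrow>
    \<forall>\<^sub>F M in sequentially. \<exists>f. (\<forall>z. 1/2 \<le> f z \<and> f z \<le> 3/2) \<and> (\<Sum>z\<in>grid M. f z) = real M ^ 2 \<and>
      (\<forall>s. fact (length (p s)) * weight (p s) M f / real M ^ (2 * length (p s)) = 1 / fact (length (p s)) + t $ s)"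
proof -
  let ?k = "\<lambda>s. length (p s)"
  let ?n = "real CARD('n)"
  have "\<forall>\<tau>. \<exists>G B. (\<forall>M z. \<bar>G M z\<bar> \<le> B) \<and> (\<forall>M. (\<Sum>z\<in>grid M. G M z) = 0) \<and>
     (\<forall>s. (\<lambda>M. fact (?k s) * weight_lin (p s) M (G M) / real M ^ (2 * ?k s)) \<longlonglongrightarrow> axis \<tau> 1 $ s)"
    using realizable_UNIV[OF assms] unfolding realizable_def by blast
  then have "\<exists>G B. \<forall>\<tau>. (\<forall>M z. \<bar>G \<tau> M z\<bar> \<le> B \<tau>) \<and> (\<forall>M. (\<Sum>z\<in>grid M. G \<tau> M z) = 0) \<and>
     (\<forall>s. (\<lambda>M. fact (?k s) * weight_lin (p s) M (G \<tau> M) / real M ^ (2 * ?k s)) \<longlonglongrightarrow> axis \<tau> 1 $ s)"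
    unfolding choice_iff .
  then obtain G B where G: "\<And>\<tau> M z. \<bar>G \<tau> M z\<bar> \<le> B \<tau>" "\<And>\<tau> M. (\<Sum>z\<in>grid M. G \<tau> M z) = 0"
    "\<And>\<tau> s. (\<lambda>M. fact (?k s) * weight_lin (p s) M (G \<tau> M) / real M ^ (2 * ?k s)) \<longlonglongrightarrow> axis \<tau> 1 $ s"
    by blast
  define b where "b = (\<Sum>\<tau>\<in>UNIV. B \<tau>)"
  have B0: "0 \<le> B \<tau>" for \<tau> using G(1)[of \<tau> undefined undefined] by linarith
  have b0: "0 \<le> b" unfolding b_def by (intro sum_nonneg B0)
  define K where "K = (\<Sum>s\<in>UNIV. fact (?k s) * 3 ^ ?k s * b\<^sup>2)"
  have K0: "0 \<le> K" unfolding K_def by (intro sum_nonneg) auto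
  have Ks: "fact (?k s) * 3 ^ ?k s * b\<^sup>2 \<le> K" for s
    unfolding K_def by (rule member_le_sum) auto
  \<comment> \<open>Small enough for two purposes: the quadratic error is at most r * (r * K) \<le>
    r / 4, and the weights deviate from 1 by at most r * b \<le> 1/4.\<close>
  define r where "r = 1 / (4 * (K + b + 1))"
  have r0: "0 < r" using K0 b0 by (simp add: r_def)
  have "r * (4 * (K + b + 1)) = 1" using K0 b0 by (simp add: r_def)
  then have "4 * (r * K) + 4 * (r * b) + 4 * r = 1" by (simp add: algebra_simps)
  moreover have "0 \<le> r * K" "0 \<le> r * b" using r0 K0 b0 by auto
  ultimately have rK: "r * K \<le> 1/4" and rb: "r * b \<le> 1/4" using r0 by linarith+
  define h where "h M \<epsilon> z = (\<Sum>\<tau>\<in>UNIV. \<epsilon> $ \<tau> * G \<tau> M z)" for M and \<epsilon> :: "real ^ 'n" and z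
  define F where "F M s \<epsilon> = fact (?k s) * weight (p s) M (\<lambda>z. 1 + h M \<epsilon> z) / real M ^ (2 * ?k s)" for M s and \<epsilon> :: "real ^ 'n"
  define L where "L M s \<tau> = fact (?k s) * weight_lin (p s) M (G \<tau> M) / real M ^ (2 * ?k s)" for M s \<tau>
  let ?box = "{\<epsilon> :: real ^ 'n. \<forall>\<tau>. \<bar>\<epsilon> $ \<tau>\<bar> \<le> r}"
  have h_le: "\<bar>h M \<epsilon> z\<bar> \<le> r * b" if "\<epsilon> \<in> ?box" for M \<epsilon> z
  proof -
    have "\<bar>h M \<epsilon> z\<bar> \<le> (\<Sum>\<tau>\<in>UNIV. \<bar>\<epsilon> $ \<tau> * G \<tau> M z\<bar>)" unfolding h_def by (rule sum_abs)
    also have "\<dots> \<le> (\<Sum>\<tau>\<in>UNIV. r * B \<tau>)"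
      unfolding abs_mult using that G(1) r0 by (intro sum_mono mult_mono) auto
    finally show ?thesis by (simp add: b_def sum_distrib_left)
  qed
  have F_approx: "\<bar>F M s \<epsilon> - fact (?k s) * (real (M choose ?k s) / real M ^ ?k s)\<^sup>2 - (\<Sum>\<tau>\<in>UNIV. \<epsilon> $ \<tau> * L M s \<tau>)\<bar> \<le> r / 4"
    if \<epsilon>: "\<epsilon> \<in> ?box" and "M > 0" for M s \<epsilon>
  proof -
    let ?D = "real M ^ (2 * ?k s)"
    have D: "?D > 0" using \<open>M > 0\<close> by simp
    have lin: "weight_lin (p s) M (h M \<epsilon>) = (\<Sum>\<tau>\<in>UNIV. \<epsilon> $ \<tau> * weight_lin (p s) M (G \<tau> M))"
      unfolding h_def[abs_def] by (subst weight_lin_sum) (simp_all add: weight_lin_linear)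
    have "F M s \<epsilon> - fact (?k s) * (real (M choose ?k s) / real M ^ ?k s)\<^sup>2 - (\<Sum>\<tau>\<in>UNIV. \<epsilon> $ \<tau> * L M s \<tau>)
       = fact (?k s) * (weight (p s) M (\<lambda>z. 1 + h M \<epsilon> z) - real (M choose ?k s) ^ 2 - weight_lin (p s) M (h M \<epsilon>)) / ?D"
      unfolding lin F_def L_def
      by (simp add: right_diff_distrib diff_divide_distrib power_divide power_mult[symmetric] mult.commute
          sum_distrib_left sum_divide_distrib mult.left_commute)
    also have "\<bar>\<dots>\<bar> = fact (?k s) * \<bar>weight (p s) M (\<lambda>z. 1 + h M \<epsilon> z) - real (M choose ?k s) ^ 2 - weight_lin (p s) M (h M \<epsilon>)\<bar> / ?D"
      using D by (simp add: abs_mult)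
    also have "\<dots> \<le> fact (?k s) * (?D * (3 ^ ?k s * (r * b)\<^sup>2)) / ?D"
      using h_le[OF \<epsilon>] rb r0 b0 by (intro divide_right_mono mult_left_mono weight_approx p) auto
    also have "\<dots> = r * (r * (fact (?k s) * 3 ^ ?k s * b\<^sup>2))" using \<open>M > 0\<close> by (simp add: power2_eq_square)
    also have "\<dots> \<le> r * (r * K)" using Ks[of s] r0 by (intro mult_left_mono) auto
    also have "\<dots> \<le> r * (1/4)" using rK r0 by (intro mult_left_mono) auto
    finally show ?thesis by simp
  qed
  have one: "(\<lambda>M. real M / real M) \<longlonglongrightarrow> 1"
    by (rule Lim_transform_eventually[OF tendsto_const])
       (auto intro: eventually_mono[OF eventually_gt_at_top[of 0]])
  have F0: "\<forall>\<^sub>F M in sequentially. \<bar>fact (?k s) * (real (M choose ?k s) / real M ^ ?k s)\<^sup>2 - 1 / fact (?k s)\<bar> < r / 4" for s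
  proof -
    have "(\<lambda>M. fact (?k s) * (real (M choose ?k s) / real M ^ ?k s)\<^sup>2) \<longlonglongrightarrow> fact (?k s) * (1 ^ ?k s / fact (?k s))\<^sup>2"
      by (intro tendsto_intros tendsto_binomial_scaled filterlim_real_sequentially one)
    moreover have "fact (?k s) * (1 ^ ?k s / fact (?k s))\<^sup>2 = 1 / (fact (?k s) :: real)" by (simp add: power2_eq_square)
    ultimately have "(\<lambda>M. fact (?k s) * (real (M choose ?k s) / real M ^ ?k s)\<^sup>2) \<longlonglongrightarrow> 1 / fact (?k s)"
      by (simp only:)
    from tendstoD[OF this, of "r / 4"] show ?thesis using r0 by (simp add: dist_real_def)
  qed
  \<comment> \<open>The bound is divided by the number of coordinates, so that the linear error
    summed over all of them is at most r / 4.\<close>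
  have L0: "\<forall>\<^sub>F M in sequentially. \<bar>L M s \<tau> - axis \<tau> 1 $ s\<bar> < 1 / (4 * ?n)" for s \<tau>
    using tendstoD[OF G(3)[of s \<tau>], of "1 / (4 * ?n)"] by (simp add: L_def dist_real_def)
  show thesis
  proof (rule that[of "r / 4"])
    fix t :: "real ^ 'n" assume t: "\<And>s. \<bar>t $ s\<bar> \<le> r / 4"
    have "\<forall>\<^sub>F M in sequentially. M > 0 \<and> (\<forall>s. \<bar>fact (?k s) * (real (M choose ?k s) / real M ^ ?k s)\<^sup>2 - 1 / fact (?k s)\<bar> < r / 4)
       \<and> (\<forall>s \<tau>. \<bar>L M s \<tau> - axis \<tau> 1 $ s\<bar> < 1 / (4 * ?n))"
      using F0 L0 by (intro eventually_conj eventually_gt_at_top eventually_all_finite)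
    then show "\<forall>\<^sub>F M in sequentially. \<exists>f. (\<forall>z. 1/2 \<le> f z \<and> f z \<le> 3/2) \<and> (\<Sum>z\<in>grid M. f z) = real M ^ 2 \<and>
      (\<forall>s. fact (?k s) * weight (p s) M f / real M ^ (2 * ?k s) = 1 / fact (?k s) + t $ s)"
    proof (rule eventually_mono)
      fix M assume M: "M > 0 \<and> (\<forall>s. \<bar>fact (?k s) * (real (M choose ?k s) / real M ^ ?k s)\<^sup>2 - 1 / fact (?k s)\<bar> < r / 4)
       \<and> (\<forall>s \<tau>. \<bar>L M s \<tau> - axis \<tau> 1 $ s\<bar> < 1 / (4 * ?n))"
      \<comment> \<open>A fixed point has exactly the prescribed densities. The box is mapped into
        itself because the errors of the linear part, of linearisation and of the value at 0, and
        the shift t, are at most r / 4 each.\<close>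
      define \<Phi> where "\<Phi> \<epsilon> = (\<chi> s. \<epsilon> $ s - (F M s \<epsilon> - 1 / fact (?k s) - t $ s))" for \<epsilon> :: "real ^ 'n"
      have box: "?box = cbox (\<chi> s. - r) (\<chi> s. r)" by (auto simp: mem_box_cart abs_le_iff minus_le_iff)
      have "\<Phi> \<epsilon> \<in> ?box" if \<epsilon>: "\<epsilon> \<in> ?box" for \<epsilon>
      proof (clarify)
        fix s
        have "(\<Sum>\<tau>\<in>UNIV. \<epsilon> $ \<tau> * axis \<tau> 1 $ s) = (\<Sum>\<tau>\<in>UNIV. if \<tau> = s then \<epsilon> $ \<tau> else 0)"
          by (intro sum.cong) (auto simp: axis_def)
        then have "\<epsilon> $ s - (\<Sum>\<tau>\<in>UNIV. \<epsilon> $ \<tau> * L M s \<tau>) = - (\<Sum>\<tau>\<in>UNIV. \<epsilon> $ \<tau> * (L M s \<tau> - axis \<tau> 1 $ s))"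
          by (simp add: right_diff_distrib sum_subtractf)
        also have "\<bar>\<dots>\<bar> \<le> (\<Sum>\<tau>\<in>UNIV. \<bar>\<epsilon> $ \<tau> * (L M s \<tau> - axis \<tau> 1 $ s)\<bar>)" by simp
        also have "\<dots> \<le> (\<Sum>\<tau>\<in>(UNIV::'n set). r * (1 / (4 * ?n)))"
          unfolding abs_mult using \<epsilon> M r0 by (intro sum_mono mult_mono) (auto intro: less_imp_le)
        also have "\<dots> = r / 4" by simp
        finally have "\<bar>\<epsilon> $ s - (\<Sum>\<tau>\<in>UNIV. \<epsilon> $ \<tau> * L M s \<tau>)\<bar> \<le> r / 4" .
        moreover have "\<bar>fact (?k s) * (real (M choose ?k s) / real M ^ ?k s)\<^sup>2 - 1 / fact (?k s)\<bar> < r / 4"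
          using M by blast
        moreover have "M > 0" using M by blast
        moreover note F_approx[OF \<epsilon> this, of s] t[of s]
        ultimately have "\<bar>\<epsilon> $ s - (F M s \<epsilon> - 1 / fact (?k s) - t $ s)\<bar> \<le> r" by linarith
        then show "\<bar>\<Phi> \<epsilon> $ s\<bar> \<le> r" by (simp add: \<Phi>_def)
      qed
      moreover have "continuous_on ?box \<Phi>"
        unfolding \<Phi>_def F_def h_def weight_def
        by (intro continuous_intros continuous_on_vec_lambda) (use M in auto)
      moreover have "?box \<noteq> {}" using r0 by (auto intro!: exI[of _ 0])
      moreover have "compact ?box" "convex ?box" unfolding box by (rule compact_cbox, rule convex_box)
      ultimately obtain \<epsilon> where \<epsilon>: "\<epsilon> \<in> ?box" "\<Phi> \<epsilon> = \<epsilon>" using brouwer[of ?box \<Phi>] by blast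
      have "F M s \<epsilon> = 1 / fact (?k s) + t $ s" for s
        using arg_cong[OF \<epsilon>(2), of "\<lambda>v. v $ s"] by (simp add: \<Phi>_def)
      moreover have "1/2 \<le> 1 + h M \<epsilon> z \<and> 1 + h M \<epsilon> z \<le> 3/2" for z
        using h_le[OF \<epsilon>(1), of M z] rb by linarith
      moreover have "(\<Sum>z\<in>grid M. 1 + h M \<epsilon> z) = real M ^ 2"
      proof -
        have "(\<Sum>z\<in>grid M. h M \<epsilon> z) = (\<Sum>\<tau>\<in>UNIV. \<epsilon> $ \<tau> * (\<Sum>z\<in>grid M. G \<tau> M z))"
          unfolding h_def sum_distrib_left by (rule sum.swap)
        then show ?thesis using G(2) by (simp add: sum.distrib power2_eq_square)
      qed
      ultimately show "\<exists>f. (\<forall>z. 1/2 \<le> f z \<and> f z \<le> 3/2) \<and> (\<Sum>z\<in>grid M. f z) = real M ^ 2 \<and>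
        (\<forall>s. fact (?k s) * weight (p s) M f / real M ^ (2 * ?k s) = 1 / fact (?k s) + t $ s)"
        unfolding F_def by (intro exI[of _ "\<lambda>z. 1 + h M \<epsilon> z"]) blast
    qed
  qed (use r0 in simp)
qed

section \<open>Permutations from grid weights\<close>

text \<open>Copies of z share its coordinates, so forgetting the copies maps occurrences to
  occurrences, and over p each point can be replaced by any of its copies independently.\<close>

lemma card_occs_blowup:
  fixes A :: "'a set"
  assumes A: "finite A"
  shows "card (occs \<pi> (SIGMA z:A. {..<c z}) (\<lambda>q. u (fst q)) (\<lambda>q. v (fst q)))
       = (\<Sum>p\<in>occs \<pi> A u v. \<Prod>l<length \<pi>. c (p l))"
proof -
  let ?k = "length \<pi>" and ?P = "SIGMA z:A. {..<c z}"
  let ?T = "\<lambda>p. \<Pi>\<^sub>E l\<in>{..<?k}. {p l} \<times> {..<c (p l) :: nat}"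
  have fib: "restrict (\<lambda>l. fst (q l)) {..<?k} = p" if q: "q \<in> ?T p" and p: "p \<in> occs \<pi> A u v" for p q
  proof
    fix l show "restrict (\<lambda>l. fst (q l)) {..<?k} l = p l"
    proof (cases "l < ?k")
      case True
      then show ?thesis using PiE_mem[OF q, of l] by auto
    next
      case False
      have "p \<in> {..<?k} \<rightarrow>\<^sub>E A" using p by (simp add: occs_def)
      from PiE_arb[OF this, of l] False show ?thesis by simp
    qed
  qed
  have eq: "occs \<pi> ?P (\<lambda>q. u (fst q)) (\<lambda>q. v (fst q)) = (\<Union>p\<in>occs \<pi> A u v. ?T p)"
  proof (intro equalityI subsetI)
    fix q assume "q \<in> occs \<pi> ?P (\<lambda>q. u (fst q)) (\<lambda>q. v (fst q))"
    then have q: "q \<in> {..<?k} \<rightarrow>\<^sub>E ?P" "is_occ \<pi> (\<lambda>q. u (fst q)) (\<lambda>q. v (fst q)) q"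
      by (auto simp: occs_def)
    define p where "p = restrict (\<lambda>l. fst (q l)) {..<?k}"
    have mem: "fst (q l) \<in> A" "snd (q l) < c (fst (q l))" if "l < ?k" for l
      using PiE_mem[OF q(1), of l] that by auto
    have "p \<in> {..<?k} \<rightarrow>\<^sub>E A" using mem by (simp add: p_def)
    moreover have "is_occ \<pi> u v p" using q(2) by (simp add: is_occ_def p_def)
    ultimately have "p \<in> occs \<pi> A u v" by (simp add: occs_def)
    moreover have "q \<in> ?T p"
    proof (rule PiE_I)
      fix l assume "l \<in> {..<?k}"
      then show "q l \<in> {p l} \<times> {..<c (p l)}" using mem[of l] by (simp add: p_def mem_Times_iff)
    next
      fix l assume "l \<notin> {..<?k}"
      then show "q l = undefined" using PiE_arb[OF q(1)] by simp
    qed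
    ultimately show "q \<in> (\<Union>p\<in>occs \<pi> A u v. ?T p)" by blast
  next
    fix q assume "q \<in> (\<Union>p\<in>occs \<pi> A u v. ?T p)"
    then obtain p where p: "p \<in> occs \<pi> A u v" "q \<in> ?T p" by blast
    have pA: "p \<in> {..<?k} \<rightarrow>\<^sub>E A" "is_occ \<pi> u v p" using p(1) by (simp_all add: occs_def)
    have mem: "fst (q l) = p l" "snd (q l) < c (p l)" "p l \<in> A" if "l < ?k" for l
      using PiE_mem[OF p(2), of l] PiE_mem[OF pA(1), of l] that by auto
    have "q \<in> {..<?k} \<rightarrow>\<^sub>E ?P"
    proof (rule PiE_I)
      fix l assume "l \<in> {..<?k}"
      then show "q l \<in> ?P" using mem[of l] by (auto simp: mem_Sigma_iff intro!: SigmaI[of "fst (q l)" _ "snd (q l)", simplified])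
    next
      fix l assume "l \<notin> {..<?k}"
      then show "q l = undefined" using PiE_arb[OF p(2)] by simp
    qed
    moreover have "is_occ \<pi> (\<lambda>q. u (fst q)) (\<lambda>q. v (fst q)) q"
      using pA(2) mem(1) by (simp add: is_occ_def)
    ultimately show "q \<in> occs \<pi> ?P (\<lambda>q. u (fst q)) (\<lambda>q. v (fst q))" by (simp add: occs_def)
  qed
  have "card (\<Union>p\<in>occs \<pi> A u v. ?T p) = (\<Sum>p\<in>occs \<pi> A u v. card (?T p))"
  proof (rule card_UN_disjoint)
    show "finite (occs \<pi> A u v)" using A by simp
    show "\<forall>p\<in>occs \<pi> A u v. finite (?T p)" by (simp add: finite_PiE)
    show "\<forall>p\<in>occs \<pi> A u v. \<forall>p'\<in>occs \<pi> A u v. p \<noteq> p' \<longrightarrow> ?T p \<inter> ?T p' = {}"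
    proof (intro ballI impI)
      fix p p' assume p: "p \<in> occs \<pi> A u v" "p' \<in> occs \<pi> A u v" "p \<noteq> p'"
      have False if "q \<in> ?T p" "q \<in> ?T p'" for q
        using fib[OF that(1) p(1)] fib[OF that(2) p(2)] p(3) by simp
      then show "?T p \<inter> ?T p' = {}" by blast
    qed
  qed
  then show ?thesis unfolding eq by (simp add: card_PiE card_cartesian_product)
qed

text \<open>Dividing by 2 M puts all factors into [0,1], where products differ by at most the sum of
  the differences of their factors, here 1 / (2 M) each. Undoing the scaling costs the factor
  2^k.\<close>

lemma weight_round:
  assumes \<pi>: "is_perm \<pi>" and M: "M > 0"
    and f: "\<And>z. 0 \<le> f z \<and> f z \<le> 2" and c: "\<And>z. \<bar>real (c z) - real M * f z\<bar> \<le> 1" "\<And>z. real (c z) \<le> 2 * real M"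
  shows "\<bar>weight \<pi> M (\<lambda>z. real (c z)) / real M ^ (3 * length \<pi>) - weight \<pi> M f / real M ^ (2 * length \<pi>)\<bar>
      \<le> 2 ^ length \<pi> * real (length \<pi>) / (2 * real M)"
proof -
  let ?k = "length \<pi>" and ?O = "occs \<pi> (grid M) fst snd" and ?D = "2 * real M"
  have D: "?D > 0" using M by simp
  have prod_diff: "\<bar>(\<Prod>l<?k. real (c (p l)) / ?D) - (\<Prod>l<?k. f (p l) / 2)\<bar> \<le> real ?k / ?D" for p
  proof -
    have "\<bar>(\<Prod>l<?k. real (c (p l)) / ?D) - (\<Prod>l<?k. f (p l) / 2)\<bar>
        \<le> (\<Sum>l<?k. \<bar>real (c (p l)) / ?D - f (p l) / 2\<bar>)"
      using norm_prod_diff[of "{..<?k}" "\<lambda>l. real (c (p l)) / ?D" "\<lambda>l. f (p l) / 2"] f c(2) D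
      by (simp add: divide_le_eq_1)
    also have "\<dots> \<le> (\<Sum>l<?k. 1 / ?D)"
    proof (rule sum_mono)
      fix l
      have "real (c (p l)) / ?D - f (p l) / 2 = (real (c (p l)) - real M * f (p l)) / ?D"
        using M by (simp add: field_simps)
      then show "\<bar>real (c (p l)) / ?D - f (p l) / 2\<bar> \<le> 1 / ?D"
        using c(1)[of "p l"] D by (simp add: divide_right_mono)
    qed
    finally show ?thesis by simp
  qed
  have M3: "real M ^ (3 * ?k) = real M ^ ?k * real M ^ (2 * ?k)" by (simp flip: power_add)
  have e1: "weight \<pi> M (\<lambda>z. real (c z)) / real M ^ (3 * ?k) = 2 ^ ?k * (\<Sum>p\<in>?O. \<Prod>l<?k. real (c (p l)) / ?D) / real M ^ (2 * ?k)"
    unfolding weight_def M3 using M by (simp add: prod_dividef power_mult_distrib sum_divide_distrib[symmetric])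
  have e2: "weight \<pi> M f / real M ^ (2 * ?k) = 2 ^ ?k * (\<Sum>p\<in>?O. \<Prod>l<?k. f (p l) / 2) / real M ^ (2 * ?k)"
    unfolding weight_def by (simp add: prod_dividef sum_divide_distrib[symmetric])
  have "\<bar>(\<Sum>p\<in>?O. \<Prod>l<?k. real (c (p l)) / ?D) - (\<Sum>p\<in>?O. \<Prod>l<?k. f (p l) / 2)\<bar> \<le> (\<Sum>p\<in>?O. real ?k / ?D)"
    unfolding sum_subtractf[symmetric] by (rule order.trans[OF sum_abs]) (intro sum_mono prod_diff)
  also have "\<dots> = real (card ?O) * (real ?k / ?D)" by simp
  also have "\<dots> \<le> real M ^ (2 * ?k) * (real ?k / ?D)"
    using D by (intro mult_right_mono card_occs_grid_le[OF \<pi>]) simp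
  finally have s: "\<bar>(\<Sum>p\<in>?O. \<Prod>l<?k. real (c (p l)) / ?D) - (\<Sum>p\<in>?O. \<Prod>l<?k. f (p l) / 2)\<bar> \<le> real M ^ (2 * ?k) * (real ?k / ?D)" .
  have "\<bar>weight \<pi> M (\<lambda>z. real (c z)) / real M ^ (3 * ?k) - weight \<pi> M f / real M ^ (2 * ?k)\<bar>
     = 2 ^ ?k * \<bar>(\<Sum>p\<in>?O. \<Prod>l<?k. real (c (p l)) / ?D) - (\<Sum>p\<in>?O. \<Prod>l<?k. f (p l) / 2)\<bar> / real M ^ (2 * ?k)"
    unfolding e1 e2 by (simp add: abs_mult flip: right_diff_distrib diff_divide_distrib)
  also have "\<dots> \<le> 2 ^ ?k * (real M ^ (2 * ?k) * (real ?k / ?D)) / real M ^ (2 * ?k)"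
    by (intro divide_right_mono mult_left_mono s) auto
  also have "\<dots> = 2 ^ ?k * real ?k / ?D" using M by simp
  finally show ?thesis .
qed

text \<open>Rounding \<open>M f\<close> to integers and placing that many points into each cell of the grid.
  Occurrences with two points in one row or column are negligible, so the order inside a cell is irrelevant.\<close>

lemma ex_perm_of_weight:
  assumes M: "M \<ge> 2" and f: "\<And>z. 1/2 \<le> f z \<and> f z \<le> 3/2" and tot: "(\<Sum>z\<in>grid M. f z) = real M ^ 2"
  obtains \<sigma> W n where "is_perm \<sigma>" "length \<sigma> = n" "\<bar>real n - real M ^ 3\<bar> \<le> real M ^ 2"
    "\<And>\<pi>. is_perm \<pi> \<Longrightarrow> length \<pi> \<le> n \<Longrightarrow>
      \<bar>Defs.density \<pi> \<sigma> - W \<pi> / real (n choose length \<pi>)\<bar>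
        \<le> 4 * real (length \<pi>) ^ 2 * real M ^ 2 * real n ^ (length \<pi> - 1) / real (n choose length \<pi>)"
    "\<And>\<pi>. is_perm \<pi> \<Longrightarrow> \<bar>W \<pi> / real M ^ (3 * length \<pi>) - weight \<pi> M f / real M ^ (2 * length \<pi>)\<bar>
        \<le> 2 ^ length \<pi> * real (length \<pi>) / (2 * real M)"
proof -
  define c where "c z = nat \<lfloor>real M * f z\<rfloor>" for z
  have c: "\<bar>real (c z) - real M * f z\<bar> \<le> 1" "real (c z) \<le> 2 * real M" "c z > 0" for z
  proof -
    have "real M * (1/2) \<le> real M * f z" "real M * f z \<le> real M * (3/2)"
      using f[of z] by (intro mult_left_mono; simp)+
    moreover have "1 \<le> real M * (1/2)" "real M * (3/2) \<le> 2 * real M" using M by simp_all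
    ultimately have "1 \<le> real M * f z" "real M * f z \<le> 2 * real M" by linarith+
    then show "\<bar>real (c z) - real M * f z\<bar> \<le> 1" "real (c z) \<le> 2 * real M" "c z > 0"
      unfolding c_def by linarith+
  qed
  define P where "P = (SIGMA z:grid M. {..<c z})"
  define u where "u q = fst (fst q)" for q :: "(nat \<times> nat) \<times> nat"
  define v where "v q = snd (fst q)" for q :: "(nat \<times> nat) \<times> nat"
  have finP: "finite P" by (simp add: P_def)
  have "((0, 0), 0) \<in> P" using M c(3)[of "(0, 0)"] by (simp add: P_def)
  then have neP: "P \<noteq> {}" by blast
  have c_le: "c z \<le> 2 * M" for z using c(2)[of z] by linarith
  \<comment> \<open>A row or column consists of M cells with at most 2 M points each. Its 2 M^2
    points are few compared with about M^3 in total.\<close>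
  have slice: "card (SIGMA z:I. {..<c z}) \<le> 2 * M ^ 2" if "finite I" "card I \<le> M" for I :: "(nat \<times> nat) set"
  proof -
    have "card (SIGMA z:I. {..<c z}) = (\<Sum>z\<in>I. c z)" using that by simp
    also have "\<dots> \<le> (\<Sum>z\<in>I. 2 * M)" by (intro sum_mono c_le)
    also have "\<dots> \<le> 2 * M ^ 2" using that by (simp add: power2_eq_square)
    finally show ?thesis .
  qed
  have R: "card {q\<in>P. u q = a} \<le> 2 * M ^ 2" "card {q\<in>P. v q = a} \<le> 2 * M ^ 2" for a
  proof -
    have "card {q\<in>P. u q = a} \<le> card (SIGMA z:{a} \<times> {..<M}. {..<c z})"
      by (intro card_mono) (auto simp: P_def u_def)
    then show "card {q\<in>P. u q = a} \<le> 2 * M ^ 2" using slice[of "{a} \<times> {..<M}"] by (simp add: card_cartesian_product)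
    have "card {q\<in>P. v q = a} \<le> card (SIGMA z:{..<M} \<times> {a}. {..<c z})"
      by (intro card_mono) (auto simp: P_def v_def)
    then show "card {q\<in>P. v q = a} \<le> 2 * M ^ 2" using slice[of "{..<M} \<times> {a}"] by (simp add: card_cartesian_product)
  qed
  obtain \<sigma> where \<sigma>: "is_perm \<sigma>" "length \<sigma> = card P"
    "\<And>\<pi>. is_perm \<pi> \<Longrightarrow> length \<pi> \<le> card P \<Longrightarrow>
       \<bar>Defs.density \<pi> \<sigma> - real (card (occs \<pi> P u v)) / real (card P choose length \<pi>)\<bar>
       \<le> 2 * real (length \<pi>) ^ 2 * real (2 * M ^ 2) * real (card P) ^ (length \<pi> - 1) / real (card P choose length \<pi>)"
    using ex_perm_of_coarse_point_set[OF finP neP R] by blast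
  define W where "W \<pi> = weight \<pi> M (\<lambda>z. real (c z))" for \<pi>
  have W: "real (card (occs \<pi> P u v)) = W \<pi>" for \<pi>
    unfolding W_def weight_def P_def u_def v_def
    using card_occs_blowup[of "grid M" \<pi> c fst snd] by simp
  show thesis
  proof (rule that[OF \<sigma>(1,2)])
    have "real (card P) - real M ^ 3 = (\<Sum>z\<in>grid M. real (c z) - real M * f z)"
      using tot by (simp add: P_def sum_subtractf sum_distrib_left[symmetric] power_numeral_reduce)
    also have "\<bar>\<dots>\<bar> \<le> (\<Sum>z\<in>grid M. 1)" by (rule order.trans[OF sum_abs]) (intro sum_mono c)
    finally show "\<bar>real (card P) - real M ^ 3\<bar> \<le> real M ^ 2" by (simp add: card_cartesian_product power2_eq_square)
  next
    fix \<pi> assume "is_perm \<pi>" "length \<pi> \<le> card P"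
    from \<sigma>(3)[OF this] show "\<bar>Defs.density \<pi> \<sigma> - W \<pi> / real (card P choose length \<pi>)\<bar>
        \<le> 4 * real (length \<pi>) ^ 2 * real M ^ 2 * real (card P) ^ (length \<pi> - 1) / real (card P choose length \<pi>)"
      by (simp add: W mult_ac)
  next
    fix \<pi> assume \<pi>: "is_perm \<pi>"
    have f2: "0 \<le> f z \<and> f z \<le> 2" for z using f[of z] by linarith
    show "\<bar>W \<pi> / real M ^ (3 * length \<pi>) - weight \<pi> M f / real M ^ (2 * length \<pi>)\<bar>
        \<le> 2 ^ length \<pi> * real (length \<pi>) / (2 * real M)"
      unfolding W_def using M c by (intro weight_round \<pi> f2) auto
  qed
qed

text \<open>With n about M^3 both errors are of order 1/M: rounding by the bound on W, and ties
  because M^2 n^(k-1) is compared with n^k.\<close>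

lemma ex_perm_seq_of_weights:
  assumes f: "\<And>M z. 1/2 \<le> f M z \<and> f M z \<le> 3/2" and tot: "\<And>M. (\<Sum>z\<in>grid M. f M z) = real M ^ 2"
  obtains \<sigma> where "\<And>M. is_perm (\<sigma> M)"
    "\<And>\<pi> L. is_perm \<pi> \<Longrightarrow> (\<lambda>M. fact (length \<pi>) * weight \<pi> M (f M) / real M ^ (2 * length \<pi>)) \<longlonglongrightarrow> L
      \<Longrightarrow> (\<lambda>M. Defs.density \<pi> (\<sigma> M)) \<longlonglongrightarrow> L"
proof -
  define good where "good M \<sigma> W n \<longleftrightarrow> is_perm \<sigma> \<and> (M \<ge> 2 \<longrightarrow> length \<sigma> = n \<and> \<bar>real n - real M ^ 3\<bar> \<le> real M ^ 2 \<and>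
    (\<forall>\<pi>. is_perm \<pi> \<longrightarrow> length \<pi> \<le> n \<longrightarrow> \<bar>Defs.density \<pi> \<sigma> - W \<pi> / real (n choose length \<pi>)\<bar>
        \<le> 4 * real (length \<pi>) ^ 2 * real M ^ 2 * real n ^ (length \<pi> - 1) / real (n choose length \<pi>)) \<and>
    (\<forall>\<pi>. is_perm \<pi> \<longrightarrow> \<bar>W \<pi> / real M ^ (3 * length \<pi>) - weight \<pi> M (f M) / real M ^ (2 * length \<pi>)\<bar>
        \<le> 2 ^ length \<pi> * real (length \<pi>) / (2 * real M)))" for M \<sigma> W n
  have "\<exists>\<sigma> W n. good M \<sigma> W n" for M
  proof (cases "M \<ge> 2")
    case True
    show ?thesis by (rule ex_perm_of_weight[OF True f tot]) (auto simp: good_def)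
  next
    case False
    \<comment> \<open>A placeholder: for M < 2 only \<open>is_perm\<close> is demanded.\<close>
    then show ?thesis by (intro exI[of _ "[1]"]) (auto simp: good_def is_perm_def)
  qed
  then have "\<forall>M. \<exists>\<sigma> W n. good M \<sigma> W n" by blast
  then have "\<exists>\<sigma> W n. \<forall>M. good M (\<sigma> M) (W M) (n M)" unfolding choice_iff .
  then obtain \<sigma> W n where g: "\<And>M. good M (\<sigma> M) (W M) (n M)" by blast
  have perm: "is_perm (\<sigma> M)" for M using g by (simp add: good_def)
  have D: "filterlim (\<lambda>M. real M ^ 3) at_top sequentially"
    by (intro filterlim_pow_at_top filterlim_real_sequentially) simp
  have inv: "(\<lambda>M. 1 / real M) \<longlonglongrightarrow> 0" by (rule lim_1_over_n)
  have n1: "(\<lambda>M. real (n M) / real M ^ 3) \<longlonglongrightarrow> 1"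
  proof (rule LIM_zero_cancel, rule Lim_null_comparison[OF _ inv])
    show "\<forall>\<^sub>F M in sequentially. norm (real (n M) / real M ^ 3 - 1) \<le> 1 / real M"
    proof (rule eventually_mono[OF eventually_ge_at_top[of 2]])
      fix M :: nat assume M: "2 \<le> M"
      have "real (n M) / real M ^ 3 - 1 = (real (n M) - real M ^ 3) / real M ^ 3"
        using M by (simp add: diff_divide_distrib)
      then have "norm (real (n M) / real M ^ 3 - 1) = \<bar>real (n M) - real M ^ 3\<bar> / real M ^ 3" by simp
      also have "\<dots> \<le> real M ^ 2 / real M ^ 3"
        using g[of M] M by (intro divide_right_mono) (simp_all add: good_def)
      also have "\<dots> = 1 / real M" using M by (simp add: power2_eq_square power3_eq_cube)
      finally show "norm (real (n M) / real M ^ 3 - 1) \<le> 1 / real M" .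
    qed
  qed
  show thesis
  proof (rule that[OF perm])
    fix \<pi> L assume \<pi>: "is_perm \<pi>"
      and L: "(\<lambda>M. fact (length \<pi>) * weight \<pi> M (f M) / real M ^ (2 * length \<pi>)) \<longlonglongrightarrow> L"
    let ?k = "length \<pi>"
    have k: "?k \<ge> 1" using \<pi> by (simp add: is_perm_def)
    have C: "(\<lambda>M. real (n M choose ?k) / (real M ^ 3) ^ ?k) \<longlonglongrightarrow> 1 / fact ?k"
      using tendsto_binomial_scaled[OF D n1, of ?k] by simp
    have "(\<lambda>M. W M \<pi> / real M ^ (3 * ?k) - weight \<pi> M (f M) / real M ^ (2 * ?k)) \<longlonglongrightarrow> 0"
    proof (rule Lim_null_comparison)
      show "\<forall>\<^sub>F M in sequentially. norm (W M \<pi> / real M ^ (3 * ?k) - weight \<pi> M (f M) / real M ^ (2 * ?k))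
          \<le> (2 ^ ?k * real ?k / 2) * (1 / real M)"
        using \<pi> g by (intro eventually_mono[OF eventually_ge_at_top[of 2]]) (simp add: good_def)
      show "(\<lambda>M. (2 ^ ?k * real ?k / 2) * (1 / real M)) \<longlonglongrightarrow> 0"
        using tendsto_mult_left[OF inv, of "2 ^ ?k * real ?k / 2"] by simp
    qed
    moreover have "(\<lambda>M. weight \<pi> M (f M) / real M ^ (2 * ?k)) \<longlonglongrightarrow> L / fact ?k"
      using tendsto_divide[OF L tendsto_const[of "fact ?k"]] by simp
    ultimately have W: "(\<lambda>M. W M \<pi> / (real M ^ 3) ^ ?k) \<longlonglongrightarrow> L / fact ?k"
      using tendsto_add by (fastforce simp: power_mult)
    have "(\<lambda>M. (W M \<pi> / (real M ^ 3) ^ ?k) / (real (n M choose ?k) / (real M ^ 3) ^ ?k)) \<longlonglongrightarrow> (L / fact ?k) / (1 / fact ?k)"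
      by (intro tendsto_divide W C) simp
    moreover have "\<forall>\<^sub>F M in sequentially. (W M \<pi> / (real M ^ 3) ^ ?k) / (real (n M choose ?k) / (real M ^ 3) ^ ?k)
        = W M \<pi> / real (n M choose ?k)"
      by (rule eventually_mono[OF eventually_gt_at_top[of 0]]) simp
    ultimately have WC: "(\<lambda>M. W M \<pi> / real (n M choose ?k)) \<longlonglongrightarrow> L"
      by (simp add: Lim_transform_eventually)
    have "(\<lambda>M. Defs.density \<pi> (\<sigma> M) - W M \<pi> / real (n M choose ?k)) \<longlonglongrightarrow> 0"
    proof (rule Lim_null_comparison)
      \<comment> \<open>The tie estimate is available only once the permutation is at least as long
        as the pattern.\<close>
      have n_ge: "\<forall>\<^sub>F M in sequentially. real ?k \<le> real (n M)"
      proof -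
        have "\<forall>\<^sub>F M in sequentially. 1/2 < real (n M) / real M ^ 3"
          using order_tendstoD(1)[OF n1, of "1/2"] by simp
        moreover have "\<forall>\<^sub>F M in sequentially. 2 * real ?k + 1 \<le> real M ^ 3"
          using D by (simp add: filterlim_at_top)
        ultimately show ?thesis
        proof eventually_elim
          case (elim M)
          then have "0 < real M ^ 3" by linarith
          with elim(1) have "1/2 * real M ^ 3 < real (n M)" by (simp only: pos_less_divide_eq)
          then show ?case using elim by linarith
        qed
      qed
      show "\<forall>\<^sub>F M in sequentially. norm (Defs.density \<pi> (\<sigma> M) - W M \<pi> / real (n M choose ?k))
          \<le> 4 * real ?k ^ 2 * (1 / real M) * (real (n M) / real M ^ 3) ^ (?k - 1) / (real (n M choose ?k) / (real M ^ 3) ^ ?k)"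
        using n_ge eventually_ge_at_top[of 2]
      proof eventually_elim
        case (elim M)
        have "norm (Defs.density \<pi> (\<sigma> M) - W M \<pi> / real (n M choose ?k))
          \<le> 4 * real ?k ^ 2 * real M ^ 2 * real (n M) ^ (?k - 1) / real (n M choose ?k)"
          using g[of M] elim \<pi> by (simp add: good_def)
        also have "\<dots> = 4 * real ?k ^ 2 * (1 / real M) * (real (n M) / real M ^ 3) ^ (?k - 1) / (real (n M choose ?k) / (real M ^ 3) ^ ?k)"
        proof -
          have "(real M ^ 3) ^ ?k = real M ^ 3 * (real M ^ 3) ^ (?k - 1)" using k by (cases ?k) simp_all
          moreover have "real M ^ 3 = real M * real M ^ 2" by (simp add: power3_eq_cube power2_eq_square)
          moreover have "real M \<noteq> 0" "(real M ^ 3) ^ (?k - 1) \<noteq> 0" using elim by auto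
          ultimately show ?thesis by (simp add: power_divide field_simps)
        qed
        finally show ?case .
      qed
      have "(\<lambda>M. 4 * real ?k ^ 2 * (1 / real M) * (real (n M) / real M ^ 3) ^ (?k - 1) / (real (n M choose ?k) / (real M ^ 3) ^ ?k))
         \<longlonglongrightarrow> 4 * real ?k ^ 2 * 0 * 1 ^ (?k - 1) / (1 / fact ?k)"
        by (intro tendsto_intros inv n1 C) simp
      then show "(\<lambda>M. 4 * real ?k ^ 2 * (1 / real M) * (real (n M) / real M ^ 3) ^ (?k - 1) / (real (n M choose ?k) / (real M ^ 3) ^ ?k))
         \<longlonglongrightarrow> 0" by simp
    qed
    from tendsto_add[OF this WC] show "(\<lambda>M. Defs.density \<pi> (\<sigma> M)) \<longlonglongrightarrow> L" by simp
  qed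
qed

section \<open>Patterns of order at most three\<close>

lemma sorted_subseqs:
  "sorted xs \<Longrightarrow> as \<in> set (subseqs xs) \<Longrightarrow> sorted as"
proof (induction xs arbitrary: as)
  case (Cons x xs)
  have "set bs \<subseteq> set xs" if "bs \<in> set (subseqs xs)" for bs
    using that subseqs_powset[of xs] by blast
  with Cons show ?case by (fastforce simp: Let_def)
qed simp

text \<open>An executable form of the count in \<open>density\<close>: lists of indices replace
  sets, and the quantifiers range over lists, so that concrete values can be computed.\<close>

definition pattern_count :: "nat list \<Rightarrow> nat list \<Rightarrow> nat" where
  "pattern_count \<pi> \<sigma> =
   length (filter (\<lambda>as. length as = length \<pi> \<and>
      (\<forall>i\<in>set [0..<length \<pi>]. \<forall>j\<in>set [0..<length \<pi>]. \<pi> ! i < \<pi> ! j \<longleftrightarrow> \<sigma> ! (as ! i) < \<sigma> ! (as ! j)))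
      (subseqs [0..<length \<sigma>]))"

lemma card_induces_eq_pattern_count:
  "card {A. A \<subseteq> {0..<length \<sigma>} \<and> card A = length \<pi> \<and> induces \<pi> \<sigma> A} = pattern_count \<pi> \<sigma>"
  (is "card ?L = _")
proof -
  let ?n = "length \<sigma>"
  define F where "F = filter (\<lambda>as. length as = length \<pi> \<and>
      (\<forall>i\<in>set [0..<length \<pi>]. \<forall>j\<in>set [0..<length \<pi>]. \<pi> ! i < \<pi> ! j \<longleftrightarrow> \<sigma> ! (as ! i) < \<sigma> ! (as ! j)))
      (subseqs [0..<?n])"
  have srt: "sorted as" "distinct as" if "as \<in> set (subseqs [0..<?n])" for as
    using that sorted_subseqs[of "[0..<?n]" as] subseqs_distinctD[of as "[0..<?n]"] by auto
  have sl: "sorted_list_of_set (set as) = as" if "as \<in> set (subseqs [0..<?n])" for as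
    using srt[OF that] by (simp add: sorted_list_of_set.idem_if_sorted_distinct)
  have "set ` set F = ?L"
  proof (intro equalityI subsetI)
    fix A assume "A \<in> set ` set F"
    then obtain as where as: "as \<in> set F" "A = set as" by auto
    then have m: "as \<in> set (subseqs [0..<?n])" by (simp add: F_def)
    then have "A \<subseteq> {0..<?n}" using subseqs_powset[of "[0..<?n]"] as(2) by auto
    moreover have "card A = length \<pi>" using as srt(2)[OF m] by (simp add: F_def distinct_card)
    moreover have "induces \<pi> \<sigma> A" using as by (simp add: induces_def sl[OF m] F_def)
    ultimately show "A \<in> ?L" by blast
  next
    fix A assume A: "A \<in> ?L"
    then obtain as where as: "as \<in> set (subseqs [0..<?n])" "A = set as"
      using subset_subseqs[of A "[0..<?n]"] by auto
    then have "as \<in> set F"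
      using A srt(2)[OF as(1)] by (simp add: F_def induces_def sl[OF as(1)] distinct_card)
    with as show "A \<in> set ` set F" by blast
  qed
  moreover have "distinct (map set F)"
    using distinct_set_subseqs[of "[0..<?n]"] by (simp add: F_def distinct_map_filter)
  ultimately have "card ?L = length F"
    using distinct_card[of "map set F"] by simp
  then show ?thesis by (simp only: pattern_count_def F_def)
qed

lemma density_eq_pattern_count:
  "length \<pi> \<le> length \<sigma> \<Longrightarrow> Defs.density \<pi> \<sigma> = real (pattern_count \<pi> \<sigma>) / real (length \<sigma> choose length \<pi>)"
  unfolding Defs.density_def card_induces_eq_pattern_count by simp

lemma is_perm_length_le_3:
  assumes "is_perm \<pi>" "length \<pi> \<le> 3"
  shows "\<pi> \<in> {[1], [1,2], [2,1], [1,2,3], [1,3,2], [2,1,3], [2,3,1], [3,1,2], [3,2,1]}"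
proof -
  have ne: "length \<pi> \<ge> 1" and d: "distinct \<pi>" and s: "set \<pi> = {1..length \<pi>}"
    using assms(1) by (auto simp: is_perm_def)
  consider "length \<pi> = 1" | "length \<pi> = 2" | "length \<pi> = 3" using ne assms(2) by linarith
  then show ?thesis
  proof cases
    case 1
    then obtain a where p: "\<pi> = [a]" by (auto simp: length_Suc_conv)
    have "a \<in> {1..1}" using s p by auto
    with p show ?thesis by auto
  next
    case 2
    then obtain a b where p: "\<pi> = [a,b]" by (auto simp: length_Suc_conv eval_nat_numeral)
    have "a \<in> {1..2}" "b \<in> {1..2}" unfolding s[unfolded 2, symmetric] p by auto
    then have "a = 1 \<or> a = 2" "b = 1 \<or> b = 2" by auto
    with p d show ?thesis by auto
  next
    case 3
    then obtain a b c where p: "\<pi> = [a,b,c]" by (auto simp: length_Suc_conv eval_nat_numeral)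
    have "a \<in> {1..3}" "b \<in> {1..3}" "c \<in> {1..3}" unfolding s[unfolded 3, symmetric] p by auto
    then have "a = 1 \<or> a = 2 \<or> a = 3" "b = 1 \<or> b = 2 \<or> b = 3" "c = 1 \<or> c = 2 \<or> c = 3" by auto
    with p d show ?thesis by auto
  qed
qed

text \<open>Found by computer search.\<close>

definition sym9 :: "nat list" where "sym9 = [3,4,9,8,5,2,1,6,7]"

text \<open>Equal counts require 2 to divide 9 choose 2 = 36 and 6 to divide 9 choose 3 = 84. The
  reversal of \<open>sym9\<close> is its inverse, so its diagram is invariant under a quarter turn.
  This already equates the two counts of order 2, those of [1,2,3] and [3,2,1], and the other four
  of order 3.\<close>

lemma pattern_counts_sym9:
  "pattern_count [1] sym9 = 9"
  "pattern_count [1,2] sym9 = 18" "pattern_count [2,1] sym9 = 18"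
  "pattern_count [1,2,3] sym9 = 14" "pattern_count [1,3,2] sym9 = 14" "pattern_count [2,1,3] sym9 = 14"
  "pattern_count [2,3,1] sym9 = 14" "pattern_count [3,1,2] sym9 = 14" "pattern_count [3,2,1] sym9 = 14"
  unfolding pattern_count_def sym9_def by code_simp+

lemma density_sym9:
  assumes "is_perm \<pi>" "length \<pi> \<le> 3"
  shows "Defs.density \<pi> sym9 = 1 / fact (length \<pi>)"
proof -
  have l: "length sym9 = 9" by (simp add: sym9_def)
  have c: "(9::nat) choose 2 = 36" "(9::nat) choose 3 = 84" "fact 2 = (2::real)" "fact 3 = (6::real)"
    by (simp add: choose_two, simp add: numeral_eq_Suc, simp_all add: fact_numeral)
  have d: "Defs.density \<pi> sym9 = real (pattern_count \<pi> sym9) / real (9 choose length \<pi>)"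
    using assms(2) l by (subst density_eq_pattern_count) auto
  consider "length \<pi> = 1" "pattern_count \<pi> sym9 = 9" | "length \<pi> = 2" "pattern_count \<pi> sym9 = 18"
    | "length \<pi> = 3" "pattern_count \<pi> sym9 = 14"
    using is_perm_length_le_3[OF assms] pattern_counts_sym9 unfolding insert_iff empty_iff
    by (elim disjE) simp_all
  then show ?thesis by cases (simp_all add: d c)
qed

lemma not_forcing_length_le_3:
  assumes "\<forall>\<pi>\<in>S. is_perm \<pi> \<and> length \<pi> \<le> 3"
  shows "\<not> forcing S"
proof
  assume "forcing S"
  have p: "is_perm sym9" by (auto simp: is_perm_def sym9_def)
  then have "quasirandom (\<lambda>_. sym9)"
    using \<open>forcing S\<close>[unfolded forcing_def, rule_format, of "\<lambda>_. sym9"] assms density_sym9 by simp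
  moreover have "is_perm [1..<11]" by (auto simp: is_perm_def)
  ultimately have "(\<lambda>i::nat. Defs.density [1..<11] sym9) \<longlonglongrightarrow> 1 / fact 10"
    unfolding quasirandom_def by fastforce
  moreover have "Defs.density [1..<11] sym9 = 0" by (simp add: Defs.density_def sym9_def)
  ultimately show False by (simp add: LIMSEQ_const_iff)
qed

section \<open>Forcing sets\<close>

text \<open>A fourth, longer increasing permutation \<tau> stays independent of I. The target vector
  in \<open>real ^ 4\<close> is shifted by \<delta> in the coordinate of \<tau> alone, so
  quasirandomness fails exactly there among the four.\<close>

lemma ex_non_quasirandom_of_pert_independent:
  assumes I: "finite I" "card I = 3" "\<And>\<pi>. \<pi> \<in> I \<Longrightarrow> is_perm \<pi>" "pert_independent I"
  obtains \<sigma> where "\<And>M. is_perm (\<sigma> M)" "\<not> quasirandom \<sigma>"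
    "\<And>\<pi>. \<pi> \<in> I \<Longrightarrow> (\<lambda>M. Defs.density \<pi> (\<sigma> M)) \<longlonglongrightarrow> 1 / fact (length \<pi>)"
proof -
  \<comment> \<open>One \<open>Suc\<close> here and one in \<tau> give
    \<open>length \<tau> \<ge> 2\<close> and make \<tau> longer than every member of I.\<close>
  define N where "N = Suc (\<Sum>\<pi>\<in>I. length \<pi>)"
  define \<tau> where "\<tau> = [1..<Suc (Suc N)]"
  have \<tau>: "is_perm \<tau>" "length \<tau> = Suc N" by (auto simp: \<tau>_def is_perm_def)
  have short: "length \<pi> < length \<tau>" if "\<pi> \<in> I" for \<pi>
    using member_le_sum[OF that _ I(1), of length] \<tau>(2) by (simp add: N_def)
  have "pert_independent (insert \<tau> I)"
    using I short \<tau> by (intro pert_independent_insert) (auto simp: N_def)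
  have "\<tau> \<notin> I" using short by blast
  then have "card (insert \<tau> I) = CARD(4)" using I by simp
  then obtain p :: "4 \<Rightarrow> nat list" where p: "bij_betw p UNIV (insert \<tau> I)"
    using I(1) by (metis finite_insert finite_same_card_bij finite_class.finite_UNIV)
  have range: "range p = insert \<tau> I" and inj: "inj p" using p by (auto simp: bij_betw_def)
  have perm: "is_perm (p s)" for s using range I(3) \<tau>(1) by (metis insertE rangeI)
  obtain s\<^sub>0 where s0: "p s\<^sub>0 = \<tau>" using range by (metis insertI1 rangeE)
  obtain \<delta> where \<delta>: "\<delta> > 0" "\<And>t :: real ^ 4. (\<And>s. \<bar>t $ s\<bar> \<le> \<delta>) \<Longrightarrow>
    \<forall>\<^sub>F M in sequentially. \<exists>f. (\<forall>z. 1/2 \<le> f z \<and> f z \<le> 3/2) \<and> (\<Sum>z\<in>grid M. f z) = real M ^ 2 \<and>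
      (\<forall>s. fact (length (p s)) * weight (p s) M f / real M ^ (2 * length (p s)) = 1 / fact (length (p s)) + t $ s)"
    using ex_weights_with_prescribed_densities[OF perm inj] \<open>pert_independent (insert \<tau> I)\<close> unfolding range by blast
  define t :: "real ^ 4" where "t = axis s\<^sub>0 \<delta>"
  have t: "t $ s = (if s = s\<^sub>0 then \<delta> else 0)" for s by (simp add: t_def axis_def)
  define good where "good M f \<longleftrightarrow> (\<forall>s. fact (length (p s)) * weight (p s) M f / real M ^ (2 * length (p s)) = 1 / fact (length (p s)) + t $ s)" for M f
  have "\<forall>\<^sub>F M in sequentially. \<exists>f. (\<forall>z. 1/2 \<le> f z \<and> f z \<le> 3/2) \<and> (\<Sum>z\<in>grid M. f z) = real M ^ 2 \<and> good M f"
    unfolding good_def using \<delta> by (intro \<delta>(2)) (simp add: t)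
  then obtain M\<^sub>0 where M0: "\<And>M. M \<ge> M\<^sub>0 \<Longrightarrow> \<exists>f. (\<forall>z. 1/2 \<le> f z \<and> f z \<le> 3/2) \<and> (\<Sum>z\<in>grid M. f z) = real M ^ 2 \<and> good M f"
    unfolding eventually_sequentially by blast
  have "\<forall>M. \<exists>f. (\<forall>z. 1/2 \<le> f z \<and> f z \<le> 3/2) \<and> (\<Sum>z\<in>grid M. f z) = real M ^ 2 \<and> (M \<ge> M\<^sub>0 \<longrightarrow> good M f)"
  proof
    fix M show "\<exists>f. (\<forall>z. 1/2 \<le> f z \<and> f z \<le> 3/2) \<and> (\<Sum>z\<in>grid M. f z) = real M ^ 2 \<and> (M \<ge> M\<^sub>0 \<longrightarrow> good M f)"
    proof (cases "M \<ge> M\<^sub>0")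
      case True
      then show ?thesis using M0 by blast
    next
      case False
      then show ?thesis by (intro exI[of _ "\<lambda>_. 1"]) (simp add: power2_eq_square)
    qed
  qed
  then obtain f where f: "\<And>M z. 1/2 \<le> f M z \<and> f M z \<le> 3/2" "\<And>M. (\<Sum>z\<in>grid M. f M z) = real M ^ 2"
    "\<And>M. M \<ge> M\<^sub>0 \<Longrightarrow> good M (f M)"
    unfolding choice_iff by blast
  obtain \<sigma> where \<sigma>: "\<And>M. is_perm (\<sigma> M)"
    "\<And>\<pi> L. is_perm \<pi> \<Longrightarrow> (\<lambda>M. fact (length \<pi>) * weight \<pi> M (f M) / real M ^ (2 * length \<pi>)) \<longlonglongrightarrow> L
      \<Longrightarrow> (\<lambda>M. Defs.density \<pi> (\<sigma> M)) \<longlonglongrightarrow> L"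
    using ex_perm_seq_of_weights[of f] f by blast
  have lim: "(\<lambda>M. Defs.density (p s) (\<sigma> M)) \<longlonglongrightarrow> 1 / fact (length (p s)) + t $ s" for s
  proof (rule \<sigma>(2)[OF perm])
    have "\<forall>\<^sub>F M in sequentially. 1 / fact (length (p s)) + t $ s = fact (length (p s)) * weight (p s) M (f M) / real M ^ (2 * length (p s))"
      using f(3) unfolding good_def eventually_sequentially by metis
    then show "(\<lambda>M. fact (length (p s)) * weight (p s) M (f M) / real M ^ (2 * length (p s))) \<longlonglongrightarrow> 1 / fact (length (p s)) + t $ s"
      by (rule Lim_transform_eventually[OF tendsto_const])
  qed
  show thesis
  proof (rule that[OF \<sigma>(1)])
    show "\<not> quasirandom \<sigma>"
    proof
      assume "quasirandom \<sigma>"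
      then have "(\<lambda>M. Defs.density \<tau> (\<sigma> M)) \<longlonglongrightarrow> 1 / fact (length \<tau>)"
        using \<tau>(1) by (simp add: quasirandom_def)
      moreover have "(\<lambda>M. Defs.density \<tau> (\<sigma> M)) \<longlonglongrightarrow> 1 / fact (length \<tau>) + \<delta>"
        using lim[of s\<^sub>0] unfolding s0 t by simp
      ultimately have "1 / fact (length \<tau>) = 1 / fact (length \<tau>) + \<delta>" by (rule LIMSEQ_unique)
      then show False using \<delta>(1) by simp
    qed
    fix \<pi> assume \<pi>: "\<pi> \<in> I"
    then obtain s where s: "p s = \<pi>" using range by (metis insertI2 rangeE)
    then have "s \<noteq> s\<^sub>0" using s0 \<pi> \<open>\<tau> \<notin> I\<close> by auto
    then show "(\<lambda>M. Defs.density \<pi> (\<sigma> M)) \<longlonglongrightarrow> 1 / fact (length \<pi>)"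
      using lim[of s] s t by simp
  qed
qed

lemma density_21:
  assumes "length \<sigma> \<ge> 2" "distinct \<sigma>"
  shows "Defs.density [2,1] \<sigma> = 1 - Defs.density [1,2] \<sigma>"
proof -
  let ?n = "length \<sigma>"
  let ?A = "\<lambda>\<pi>. {A. A \<subseteq> {0..<?n} \<and> card A = 2 \<and> induces \<pi> \<sigma> A}"
  have key: "induces [2,1] \<sigma> A \<longleftrightarrow> \<not> induces [1,2] \<sigma> A" if A: "A \<subseteq> {0..<?n}" "card A = 2" for A
  proof -
    have "finite A" using A finite_subset by blast
    then have sl: "length (sorted_list_of_set A) = 2" "set (sorted_list_of_set A) = A" "distinct (sorted_list_of_set A)"
      using A by auto
    obtain a b where ab: "sorted_list_of_set A = [a, b]"
      using sl(1) unfolding numeral_2_eq_2 length_Suc_conv length_0_conv by blast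
    then have "a \<noteq> b" "a < ?n" "b < ?n" using sl A by auto
    then have "\<sigma> ! a \<noteq> \<sigma> ! b" using assms(2) by (simp add: nth_eq_iff_index_eq)
    then show ?thesis by (auto simp: induces_def ab less_Suc_eq All_less_Suc)
  qed
  have fin: "finite {A. A \<subseteq> {0..<?n} \<and> card A = 2}" by (auto intro: finite_subset[of _ "Pow {0..<?n}"])
  have un: "?A [1,2] \<union> ?A [2,1] = {A. A \<subseteq> {0..<?n} \<and> card A = 2}" "?A [1,2] \<inter> ?A [2,1] = {}"
    using key by auto
  have "finite (?A [1,2])" "finite (?A [2,1])" using fin by (auto elim: finite_subset[rotated])
  then have "card (?A [1,2]) + card (?A [2,1]) = ?n choose 2"
    using card_Un_disjoint[OF _ _ un(2)] un(1) n_subsets[of "{0..<?n}" 2] by simp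
  then have "real (card (?A [1,2])) + real (card (?A [2,1])) = real (?n choose 2)" by linarith
  moreover have "real (?n choose 2) \<noteq> 0" using assms(1) by simp
  ultimately show ?thesis using assms(1)
    by (simp add: Defs.density_def numeral_2_eq_2[symmetric] field_simps)
qed

lemma ex_sorted_triple:
  fixes f :: "'a \<Rightarrow> nat"
  assumes "card I = 3"
  obtains p q r where "I = {p, q, r}" "p \<noteq> q" "p \<noteq> r" "q \<noteq> r" "f p \<ge> f q" "f q \<ge> f r"
proof -
  obtain x y z where xyz: "I = {x, y, z}" "x \<noteq> y" "x \<noteq> z" "y \<noteq> z"
    using assms by (auto simp: card_3_iff)
  consider "f x \<ge> f y \<and> f y \<ge> f z" | "f x \<ge> f z \<and> f z \<ge> f y" | "f y \<ge> f x \<and> f x \<ge> f z"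
    | "f y \<ge> f z \<and> f z \<ge> f x" | "f z \<ge> f x \<and> f x \<ge> f y" | "f z \<ge> f y \<and> f y \<ge> f x" by linarith
  then show thesis
  proof cases
    case 1 then show thesis by (intro that[of x y z]) (use xyz in auto)
  next
    case 2 then show thesis by (intro that[of x z y]) (use xyz in auto)
  next
    case 3 then show thesis by (intro that[of y x z]) (use xyz in auto)
  next
    case 4 then show thesis by (intro that[of y z x]) (use xyz in auto)
  next
    case 5 then show thesis by (intro that[of z x y]) (use xyz in auto)
  next
    case 6 then show thesis by (intro that[of z y x]) (use xyz in auto)
  qed
qed

text \<open>Pads a small family with increasing permutations. Preserving additional densities only
  strengthens the counterexample, and orders at least 3 fit the hypotheses of
  \<open>pert_independent_three\<close>.\<close>

lemma ex_perm_extension: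
  assumes "finite I" "\<And>\<pi>. \<pi> \<in> I \<Longrightarrow> is_perm \<pi>" "card I \<le> m"
  shows "\<exists>J. I \<subseteq> J \<and> finite J \<and> card J = m \<and> (\<forall>\<pi>\<in>J. is_perm \<pi>) \<and> (\<forall>\<pi>\<in>J - I. length \<pi> \<ge> 3)"
proof -
  define E where "E n = [1..<n + 4]" for n :: nat
  have len: "length (E n) = n + 3" for n by (simp add: E_def)
  have "inj E" by (metis add_right_cancel injI len)
  then have "infinite (range E)" by (simp add: finite_image_iff)
  then have "infinite (range E - I)" using assms(1) by simp
  then obtain K where K: "K \<subseteq> range E - I" "finite K" "card K = m - card I"
    by (meson infinite_arbitrarily_large)
  then have "K \<inter> I = {}" by auto
  moreover have "is_perm (E n)" for n by (auto simp: E_def is_perm_def)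
  ultimately show ?thesis
    using K assms len by (intro exI[of _ "I \<union> K"]) (auto simp: card_Un_disjoint Int_commute)
qed

theorem theorem1:
  fixes S :: "nat list set"
  assumes "\<forall>\<pi>\<in>S. is_perm \<pi>"
    and "forcing S"
  shows "infinite S \<or> card S \<ge> 4"
proof (rule ccontr)
  assume "\<not> ?thesis"
  then have S: "finite S" "card S \<le> 3" by auto
  obtain \<pi>\<^sub>0 where \<pi>0: "\<pi>\<^sub>0 \<in> S" "length \<pi>\<^sub>0 \<ge> 4"
    using not_forcing_length_le_3[of S] assms by force
  text \<open>Orders 1 and 2 are handled by \<open>[1,2]\<close> alone, since \<open>[1]\<close> has density 1
    and the densities of \<open>[1,2]\<close> and \<open>[2,1]\<close> add up to 1.\<close>
  define I where "I = {\<pi>\<in>S. length \<pi> \<ge> 3} \<union> (if \<exists>\<pi>\<in>S. length \<pi> = 2 then {[1,2]} else {})"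
  \<comment> \<open>Replacing the members of order 2 by [1,2] does not enlarge the family: some
    \<rho> of order 2 in S accounts for it.\<close>
  have "card I \<le> card S"
  proof (cases "\<exists>\<pi>\<in>S. length \<pi> = 2")
    case True
    then obtain \<rho> where \<rho>: "\<rho> \<in> S" "length \<rho> = 2" by blast
    have "card I \<le> card {\<pi>\<in>S. length \<pi> \<ge> 3} + 1"
      unfolding I_def using True card_Un_le[of "{\<pi>\<in>S. length \<pi> \<ge> 3}" "{[1,2]}"] by simp
    also have "\<dots> = card (insert \<rho> {\<pi>\<in>S. length \<pi> \<ge> 3})" using S(1) \<rho>(2) by simp
    also have "\<dots> \<le> card S" using S(1) \<rho>(1) by (intro card_mono) auto
    finally show ?thesis .
  next
    case False
    then have "I = {\<pi>\<in>S. length \<pi> \<ge> 3}" unfolding I_def by auto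
    then show ?thesis using S(1) by (auto intro: card_mono)
  qed
  then have I: "finite I" "card I \<le> 3" "\<And>\<pi>. \<pi> \<in> I \<Longrightarrow> is_perm \<pi>" "\<pi>\<^sub>0 \<in> I"
    using S assms(1) \<pi>0 by (auto simp: I_def is_perm_def split: if_splits)
  obtain J where J: "I \<subseteq> J" "finite J" "card J = 3" "\<And>\<pi>. \<pi> \<in> J \<Longrightarrow> is_perm \<pi>" "\<And>\<pi>. \<pi> \<in> J - I \<Longrightarrow> length \<pi> \<ge> 3"
    using ex_perm_extension[OF I(1,3,2)] by metis
  \<comment> \<open>The only possible member of order 2 is [1,2], so the second longest of the three
    has order at least 3.\<close>
  have J2: "length \<pi> \<ge> 3 \<or> \<pi> = [1,2]" if "\<pi> \<in> J" for \<pi>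
  proof (cases "\<pi> \<in> I")
    case True
    then show ?thesis by (auto simp: I_def split: if_split_asm)
  qed (use J(5) that in blast)
  obtain p q r where pqr: "J = {p, q, r}" "p \<noteq> q" "p \<noteq> r" "q \<noteq> r" "length p \<ge> length q" "length q \<ge> length r"
    using ex_sorted_triple[OF J(3), of length] by metis
  have "pert_independent J"
    unfolding pqr(1)
  proof (rule pert_independent_three)
    show "is_perm p" "is_perm q" "is_perm r" using J(4) pqr(1) by auto
    show "length r \<ge> 2" using J2[of r] pqr(1) by auto
    show "length q \<ge> 3" using J2[of q] J2[of r] pqr by auto
    show "length p \<ge> 4" using I(4) J(1) \<pi>0(2) pqr by auto
  qed (use pqr in auto)
  then obtain \<sigma> where \<sigma>: "\<And>M. is_perm (\<sigma> M)" "\<not> quasirandom \<sigma>"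
    "\<And>\<pi>. \<pi> \<in> J \<Longrightarrow> (\<lambda>M. Defs.density \<pi> (\<sigma> M)) \<longlonglongrightarrow> 1 / fact (length \<pi>)"
    using ex_non_quasirandom_of_pert_independent[OF J(2,3,4)] by metis
  have long: "\<forall>\<^sub>F M in sequentially. length (\<sigma> M) \<ge> 4"
  proof -
    have "(\<lambda>M. Defs.density \<pi>\<^sub>0 (\<sigma> M)) \<longlonglongrightarrow> 1 / fact (length \<pi>\<^sub>0)" using \<sigma>(3) I(4) J(1) by blast
    then have "\<forall>\<^sub>F M in sequentially. 0 < Defs.density \<pi>\<^sub>0 (\<sigma> M)" by (rule order_tendstoD) simp
    then show ?thesis
      by (rule eventually_mono) (use \<pi>0(2) in \<open>auto simp: Defs.density_def split: if_splits\<close>)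
  qed
  have "(\<lambda>M. Defs.density \<pi> (\<sigma> M)) \<longlonglongrightarrow> 1 / fact (length \<pi>)" if \<pi>: "\<pi> \<in> S" for \<pi>
  proof -
    have "is_perm \<pi>" using assms(1) \<pi> by blast
    then consider "length \<pi> \<ge> 3" | "length \<pi> \<le> 3" "\<pi> = [1]" | "length \<pi> \<le> 3" "\<pi> = [1,2]" | "length \<pi> \<le> 3" "\<pi> = [2,1]"
      using is_perm_length_le_3[of \<pi>] by fastforce
    then show ?thesis
    proof cases
      case 1
      then show ?thesis using \<sigma>(3) J(1) \<pi> by (auto simp: I_def)
    next
      case 2
      have "\<forall>\<^sub>F M in sequentially. 1 = Defs.density \<pi> (\<sigma> M)"
        using long
      proof eventually_elim
        case (elim M)
        have "{A. A \<subseteq> {0..<length (\<sigma> M)} \<and> card A = 1 \<and> induces [1] (\<sigma> M) A} = {A. A \<subseteq> {0..<length (\<sigma> M)} \<and> card A = 1}"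
          by (auto simp: induces_def)
        moreover have "card \<dots> = length (\<sigma> M)" using n_subsets[of "{0..<length (\<sigma> M)}" 1] by simp
        moreover have "\<sigma> M \<noteq> []" using elim by auto
        ultimately show ?case using elim 2 by (simp add: Defs.density_def)
      qed
      then show ?thesis using 2 by (simp add: Lim_transform_eventually[OF tendsto_const])
    next
      case 3
      then have "\<exists>\<pi>\<in>S. length \<pi> = 2" using \<pi> by (intro bexI[of _ \<pi>]) auto
      then have "[1,2] \<in> J" using J(1) by (auto simp: I_def)
      then show ?thesis using \<sigma>(3) 3 by blast
    next
      case 4
      then have "\<exists>\<pi>\<in>S. length \<pi> = 2" using \<pi> by (intro bexI[of _ \<pi>]) auto
      then have "[1,2] \<in> J" using J(1) by (auto simp: I_def)
      from tendsto_diff[OF tendsto_const[of 1] \<sigma>(3)[OF this]]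
      have "(\<lambda>M. 1 - Defs.density [1,2] (\<sigma> M)) \<longlonglongrightarrow> 1 / fact (length \<pi>)"
        using 4 by (simp add: numeral_2_eq_2[symmetric])
      moreover have "\<forall>\<^sub>F M in sequentially. 1 - Defs.density [1,2] (\<sigma> M) = Defs.density \<pi> (\<sigma> M)"
        using long
      proof eventually_elim
        case (elim M)
        then show ?case using density_21[of "\<sigma> M"] \<sigma>(1)[of M] 4 by (simp add: is_perm_def)
      qed
      ultimately show ?thesis by (rule Lim_transform_eventually)
    qed
  qed
  then have "quasirandom \<sigma>" using assms(2) \<sigma>(1) unfolding forcing_def by blast
  with \<sigma>(2) show False by blast
qed

end
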